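(* The graded vector space $\bigoplus_{d=0}^{\infty} \mathcal{S}_d/\mathcal{S}_{d+1}$ is isomorphic, as a graded $\mathbb{Q}$-vector space, to the polynomial ring $\mathbb{Q}[w_2, w_4, w_6, \dots]$, where for each even $n \ge 2$, $w_n$ is an indeterminate of degree $n$.
   Context: Let $\mathcal{M}$ be the set of integer square matrices $M$ of even size such that $M-{}^tM$ is unimodular; the $0\times 0$ matrix is included in $\mathcal{M}$. Here ${}^tM$ is the transpose of $M$, and $\mathrm{size}(M)$ is the number of rows of $M$. Two matrices in $\mathcal{M}$ are called S-equivalent if one can be obtained from the other by a finite sequence of transformations of the following three types (each may be applied in either direction): $$M \Leftrightarrow P M\,{}^tP,\qquad M\Leftrightarrow \begin{pmatrix} 0 & 0 & O\\ 1 & x & O\\ O & C & M\end{pmatrix},\qquad M\Leftrightarrow \begin{pmatrix} 0 & 1 & O\\ 0 & x & R\\ O & O & M\end{pmatrix},$$ where $P$ is a unimodular integer matrix, $x$ is an integer, $O$ denotes zero matrices of suitable sizes, $C$ is an integer column, and $R$ is an integer row. The S-equivalence class of $M$ is denoted $[M]$. Let $\mathcal{S}$ be the $\mathbb{Q}$-vector space with basis the set of S-equivalence classes of matrices in $\mathcal{M}$. For $d\ge 0$, let $\mathcal{S}_d\subseteq\mathcal{S}$ be the subspace spanned by all alternating sums $$\sum_{\varepsilon_1,\dots,\varepsilon_d\in\{0,1\}} (-1)^{\varepsilon_1+\cdots+\varepsilon_d}\,[M+\varepsilon_1E_{i_1i_1}+\cdots+\varepsilon_dE_{i_di_d}],$$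 for all $M\in\mathcal{M}$ and all integers $i_1,\dots,i_d$ (not required to be distinct) with $1\le i_k\le \mathrm{size}(M)$, where $E_{ii}$ is the matrix of the same size as $M$ with $(i,i)$-entry $1$ and all other entries $0$. In particular $\mathcal{S}_0=\mathcal{S}$, and $\mathcal{S}_{d+1}\subseteq\mathcal{S}_d$. The degree $d$ part of $\bigoplus_{d}\mathcal{S}_d/\mathcal{S}_{d+1}$ is $\mathcal{S}_d/\mathcal{S}_{d+1}$. *)

theory Defs
  imports
    "HOL-Library.Poly_Mapping"
    "HOL-Library.Set_Algebras"
    "HOL-Library.FuncSet"
    "Jordan_Normal_Form.Determinant"
begin

section \<open>Matrices and S-equivalence\<close>

definition unimodular_mat :: "int mat \<Rightarrow> bool" where
  "unimodular_mat P \<longleftrightarrow> square_mat P \<and> (det P = 1 \<or> det P = -1)"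

definition seifert_mats :: "int mat set" where
  "seifert_mats = {M. square_mat M \<and> even (dim_row M) \<and> unimodular_mat (M - transpose_mat M)}"

inductive S_move :: "int mat \<Rightarrow> int mat \<Rightarrow> bool" where
  congruence:
    "M \<in> carrier_mat n n \<Longrightarrow> P \<in> carrier_mat n n \<Longrightarrow> unimodular_mat P \<Longrightarrow>
     S_move M (P * M * transpose_mat P)"
| row_enlargement:
    "M \<in> carrier_mat n n \<Longrightarrow> C \<in> carrier_vec n \<Longrightarrow>
     S_move M (four_block_mat
       (mat_of_rows_list 2 [[0, 0], [1, x]])  (0\<^sub>m 2 n)
       (mat_of_cols n [0\<^sub>v n, C])              M)"
| column_enlargement:
    "M \<in> carrier_mat n n \<Longrightarrow> R \<in> carrier_vec n \<Longrightarrow>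
     S_move M (four_block_mat
       (mat_of_rows_list 2 [[0, 1], [0, x]])  (mat_of_rows n [0\<^sub>v n, R])
       (0\<^sub>m n 2)                               M)"

text \<open>A partial equivalence relation on all integer matrices, with domain \<^const>\<open>seifert_mats\<close>.\<close>

inductive S_equiv :: "int mat \<Rightarrow> int mat \<Rightarrow> bool" where
  refl: "M \<in> seifert_mats \<Longrightarrow> S_equiv M M"
| step: "M \<in> seifert_mats \<Longrightarrow> N \<in> seifert_mats \<Longrightarrow> S_move M N \<Longrightarrow> S_equiv M N"
| sym: "S_equiv M N \<Longrightarrow> S_equiv N M"
| trans: "S_equiv L M \<Longrightarrow> S_equiv M N \<Longrightarrow> S_equiv L N"

lemma part_equivp_S_equiv: "part_equivp S_equiv"
proof (rule part_equivpI)
  define Z :: "int mat" where "Z = 0\<^sub>m 0 0"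
  have Z: "dim_row Z = 0" "dim_col Z = 0"
    by (simp_all add: Z_def)
  have "det (Z - transpose_mat Z) = 1"
    by (rule det_dim_zero) (intro carrier_matI; simp add: Z)
  with Z have "Z \<in> seifert_mats"
    unfolding seifert_mats_def unimodular_mat_def by simp
  then show "\<exists>M. S_equiv M M"
    by (blast intro: S_equiv.refl)
  show "symp S_equiv"
    by (blast intro: sympI S_equiv.sym)
  show "transp S_equiv"
    by (blast intro: transpI S_equiv.trans)
qed

text \<open>The type of S-equivalence classes; \<open>abs_S_class M\<close> is the class of \<open>M\<close>
  for \<open>M \<in> seifert_mats\<close>, and is unspecified otherwise.\<close>

quotient_type S_class = "int mat" / partial: S_equiv
  by (rule part_equivp_S_equiv)


section \<open>Rational vector spaces of finitely supported functions\<close>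

definition pm_scale :: "rat \<Rightarrow> ('a \<Rightarrow>\<^sub>0 rat) \<Rightarrow> ('a \<Rightarrow>\<^sub>0 rat)" where
  "pm_scale c p = Poly_Mapping.map ((*) c) p"

lemma lookup_pm_scale: "Poly_Mapping.lookup (pm_scale c p) k = c * Poly_Mapping.lookup p k"
  by (simp add: pm_scale_def Poly_Mapping.map.rep_eq when_def)

interpretation pm: vector_space pm_scale
  by unfold_locales
    (simp_all add: poly_mapping_eq_iff fun_eq_iff lookup_pm_scale lookup_add algebra_simps)


section \<open>The filtration\<close>

definition diag_unit_mat :: "nat \<Rightarrow> nat \<Rightarrow> int mat" where
  "diag_unit_mat n i = mat n n (\<lambda>(a, b). if a = i \<and> b = i then 1 else 0)"

definition perturb :: "int mat \<Rightarrow> nat \<Rightarrow> (nat \<Rightarrow> nat) \<Rightarrow> (nat \<Rightarrow> nat) \<Rightarrow> int mat" where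
  "perturb M d i \<epsilon> =
     foldl (\<lambda>A k. A + int (\<epsilon> k) \<cdot>\<^sub>m diag_unit_mat (dim_row M) (i k)) M [0..<d]"

definition alternating_sum :: "int mat \<Rightarrow> nat \<Rightarrow> (nat \<Rightarrow> nat) \<Rightarrow> S_class \<Rightarrow>\<^sub>0 rat" where
  "alternating_sum M d i =
     (\<Sum>\<epsilon> \<in> {..<d} \<rightarrow>\<^sub>E {0, 1}.
        Poly_Mapping.single (abs_S_class (perturb M d i \<epsilon>)) ((-1) ^ (\<Sum>k<d. \<epsilon> k)))"

text \<open>The ambient space is the whole type \<^typ>\<open>S_class \<Rightarrow>\<^sub>0 rat\<close>. Matrix indices start at \<open>0\<close>.\<close>

definition S_filt :: "nat \<Rightarrow> (S_class \<Rightarrow>\<^sub>0 rat) set" where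
  "S_filt d = pm.span {alternating_sum M d i | M i.
     M \<in> seifert_mats \<and> (\<forall>k<d. i k < dim_row M)}"


section \<open>The associated graded space\<close>

text \<open>The quotient \<open>V / W\<close> as a set of cosets. The sum of two cosets is their elementwise sum
  (from \<^theory>\<open>HOL-Library.Set_Algebras\<close>). Elementwise scaling by \<open>0\<close> would give \<open>{0}\<close>
  instead of \<open>W\<close>, hence the extra summand \<open>W\<close> in \<open>coset_scale\<close>.\<close>

definition quotient_space :: "('a::ab_group_add) set \<Rightarrow> 'a set \<Rightarrow> 'a set set" where
  "quotient_space V W = (\<lambda>v. v +o W) ` V"

definition coset_scale :: "('a \<Rightarrow>\<^sub>0 rat) set \<Rightarrow> rat \<Rightarrow> ('a \<Rightarrow>\<^sub>0 rat) set \<Rightarrow> ('a \<Rightarrow>\<^sub>0 rat) set" where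
  "coset_scale W c A = pm_scale c ` A + W"

text \<open>The zero of the \<open>d\<close>-th summand is the coset \<open>S_filt (Suc d)\<close>.\<close>

definition gr_S :: "(nat \<Rightarrow> (S_class \<Rightarrow>\<^sub>0 rat) set) set" where
  "gr_S = {f. (\<forall>d. f d \<in> quotient_space (S_filt d) (S_filt (Suc d))) \<and>
              finite {d. f d \<noteq> S_filt (Suc d)}}"

definition gr_S_add ::
  "(nat \<Rightarrow> (S_class \<Rightarrow>\<^sub>0 rat) set) \<Rightarrow> (nat \<Rightarrow> (S_class \<Rightarrow>\<^sub>0 rat) set) \<Rightarrow> nat \<Rightarrow> (S_class \<Rightarrow>\<^sub>0 rat) set"
  where "gr_S_add f g = (\<lambda>d. f d + g d)"

definition gr_S_scale ::
  "rat \<Rightarrow> (nat \<Rightarrow> (S_class \<Rightarrow>\<^sub>0 rat) set) \<Rightarrow> nat \<Rightarrow> (S_class \<Rightarrow>\<^sub>0 rat) set"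
  where "gr_S_scale c f = (\<lambda>d. coset_scale (S_filt (Suc d)) c (f d))"

definition gr_S_part :: "nat \<Rightarrow> (nat \<Rightarrow> (S_class \<Rightarrow>\<^sub>0 rat) set) set" where
  "gr_S_part d = {f \<in> gr_S. \<forall>e. e \<noteq> d \<longrightarrow> f e = S_filt (Suc e)}"


section \<open>The polynomial ring in variables of degrees 2, 4, 6, ...\<close>

text \<open>In \<^typ>\<open>(nat \<Rightarrow>\<^sub>0 nat) \<Rightarrow>\<^sub>0 rat\<close>, the polynomials in indeterminates \<open>w n\<close> for all
  natural numbers \<open>n\<close>, we take the subring of the polynomials in which only \<open>w 2, w 4, w 6, ...\<close> occur.\<close>

definition even_poly_ring :: "((nat \<Rightarrow>\<^sub>0 nat) \<Rightarrow>\<^sub>0 rat) set" where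
  "even_poly_ring = {p. \<forall>m \<in> Poly_Mapping.keys p. \<forall>n \<in> Poly_Mapping.keys m. even n \<and> n \<ge> 2}"

definition weighted_degree :: "(nat \<Rightarrow>\<^sub>0 nat) \<Rightarrow> nat" where
  "weighted_degree m = (\<Sum>n \<in> Poly_Mapping.keys m. n * Poly_Mapping.lookup m n)"

definition even_poly_part :: "nat \<Rightarrow> ((nat \<Rightarrow>\<^sub>0 nat) \<Rightarrow>\<^sub>0 rat) set" where
  "even_poly_part d = {p \<in> even_poly_ring. \<forall>m \<in> Poly_Mapping.keys p. weighted_degree m = d}"

end

theory Submission
  imports
    Defs
    "HOL-Combinatorics.Permutations"
    "HOL-Computational_Algebra.Formal_Power_Series"
begin

text \<open>
  Modulo the next step of the filtration, an alternating sum is multilinear in its symmetric directions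
  and depends on its matrix \<open>M\<close> only through \<open>A = M - \<^sup>tM\<close>. Enlargements followed by congruences replace
  the vectors that span the directions by new basis vectors, one at a time, so that only the Gram matrix of
  these vectors with respect to the inverse of \<open>A\<close> matters. Expanding it along its rows leaves the Gram
  matrices of perfect matchings of \<open>2d\<close> vectors, two for each direction, which are unions of cycles. Reversing
  a cycle of odd length changes the sign, so that the multisets of even numbers with sum \<open>d\<close> span the degree
  \<open>d\<close> part.

  Conversely, let \<open>\<Delta>(u) = det ((1 + u) M - \<^sup>tM) / (1 + u) ^ (size M / 2)\<close>, an invariant of S-equivalence. The
  coefficient of \<open>u ^ n\<close> in \<open>u \<Delta>'(u) / \<Delta>(u)\<close> is additive under direct sums and of finite type of degree
  \<open>n\<close>. On the alternating sum of a union of even cycles, the products of these coefficients form a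
  matrix that is triangular with respect to the number of factors, with nonzero diagonal.
\<close>

text \<open>Nothing new is spanned: an enlargement turns \<open>v v^t\<close> into a diagonal unit,
  and such squares generate the symmetric integer matrices. Two matrices with the same
  \<open>A\<close> differ by a symmetric matrix; using this difference as one more direction shows
  that the choice of \<open>M\<close> only matters in the next step. A congruence \<open>P\<close>
  sends \<open>A\<close> to \<open>P A P^t\<close> and a vector \<open>v\<close> to
  \<open>P v\<close>, so the pairing it preserves is the one by the inverse of \<open>A\<close>.
  This pairing is alternating, while a direction is symmetric in its two vectors; the two facts
  together give the sign under reversal of a cycle. Rational scalars enter in two places:
  \<open>v v^t\<close> is half the symmetric product of \<open>v\<close> with itself, and an odd
  cycle equals its own negative. For a partly perturbed union of even cycles,
  \<open>u \<Delta>'(u) / \<Delta>(u)\<close> only sees the cycles all of whose directions are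
  switched on. Alternating over the switches is then inclusion-exclusion over coverings by
  cycles.\<close>

lemma sum_lessThan_unique:
  fixes f :: "nat \<Rightarrow> 'a::comm_monoid_add"
  assumes "k < n" "\<And>j. j < n \<Longrightarrow> j \<noteq> k \<Longrightarrow> f j = 0"
  shows "(\<Sum>j<n. f j) = f k"
proof -
  have "(\<Sum>j<n. f j) = (\<Sum>j\<in>{k}. f j)"
    by (rule sum.mono_neutral_right) (use assms in auto)
  then show ?thesis by simp
qed

lemma sum_Pow_insert:
  assumes "finite I" "x \<notin> I"
  shows "(\<Sum>X\<in>Pow (insert x I). f X) = (\<Sum>X\<in>Pow I. f X) + (\<Sum>X\<in>Pow I. f (insert x X))"
proof -
  have "(\<Sum>X\<in>Pow (insert x I). f X) = (\<Sum>X\<in>Pow I. f X) + (\<Sum>X\<in>insert x ` Pow I. f X)"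
    unfolding Pow_insert using assms by (subst sum.union_disjoint) auto
  also have "(\<Sum>X\<in>insert x ` Pow I. f X) = (\<Sum>X\<in>Pow I. f (insert x X))"
    by (subst sum.reindex) (use assms in \<open>auto simp: inj_on_def\<close>)
  finally show ?thesis .
qed

text \<open>Expansion along row 0, whose only entry is in column 1, and then along column 0 of the
  minor. The ring is general because the lemma serves integer antisymmetrizations, where the two
  entries have product -1, as well as power series matrices, where the product is
  \<open>-(1 + u)\<close>.\<close>

lemma det_enlargement:
  fixes E :: "nat \<Rightarrow> nat \<Rightarrow> 'a::comm_ring_1"
  assumes r0: "\<And>j. j < n + 2 \<Longrightarrow> j \<noteq> 1 \<Longrightarrow> E 0 j = 0"
    and c0: "\<And>i. i < n \<Longrightarrow> E (i + 2) 0 = 0"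
  shows "det (mat (n + 2) (n + 2) (\<lambda>(i, j). E i j)) =
    - (E 0 1 * E 1 0 * det (mat n n (\<lambda>(i, j). E (i + 2) (j + 2))))"
proof -
  let ?A = "mat (n + 2) (n + 2) (\<lambda>(i, j). E i j)"
  let ?B = "mat (n + 1) (n + 1) (\<lambda>(i, j). E (i + 1) (if j = 0 then 0 else j + 1))"
  have A: "?A \<in> carrier_mat (n + 2) (n + 2)" by simp
  have "det ?A = (\<Sum>j<n + 2. ?A $$ (0, j) * cofactor ?A 0 j)"
    by (rule laplace_expansion_row[OF A]) simp
  also have "\<dots> = ?A $$ (0, 1) * cofactor ?A 0 1"
    by (rule sum_lessThan_unique) (auto simp: r0)
  also have "mat_delete ?A 0 1 = ?B"
    by (rule eq_matI) (auto simp: mat_delete_def)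
  then have "cofactor ?A 0 1 = - det ?B" by (simp add: cofactor_def)
  also have "det ?B = (\<Sum>i<n + 1. ?B $$ (i, 0) * cofactor ?B i 0)"
    by (rule laplace_expansion_column) auto
  also have "\<dots> = ?B $$ (0, 0) * cofactor ?B 0 0"
  proof (rule sum_lessThan_unique)
    fix j assume "j < n + 1" "j \<noteq> 0"
    then obtain i where "j = Suc i" "i < n" by (cases j) auto
    then show "?B $$ (j, 0) * cofactor ?B j 0 = 0" using c0[of i] by simp
  qed simp
  also have "mat_delete ?B 0 0 = mat n n (\<lambda>(i, j). E (i + 2) (j + 2))"
    by (rule eq_matI) (auto simp: mat_delete_def)
  then have "cofactor ?B 0 0 = det (mat n n (\<lambda>(i, j). E (i + 2) (j + 2)))"
    by (simp add: cofactor_def)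
  finally show ?thesis by simp
qed

section \<open>Matrices as functions\<close>

type_synonym imat = "nat \<Rightarrow> nat \<Rightarrow> int"

text \<open>Entries are kept in total functions with the size as a separate argument, so that sums,
  shifts and enlargements of matrices need no carrier conditions.\<close>

definition fun_mat :: "nat \<Rightarrow> imat \<Rightarrow> int mat" where
  "fun_mat n m = mat n n (\<lambda>(i, j). m i j)"

definition seifert :: "nat \<Rightarrow> imat \<Rightarrow> bool" where
  "seifert n m \<longleftrightarrow> fun_mat n m \<in> seifert_mats"

definition S_cls :: "nat \<Rightarrow> imat \<Rightarrow> S_class" where
  "S_cls n m = abs_S_class (fun_mat n m)"

lemma fun_mat_carrier [simp]: "fun_mat n m \<in> carrier_mat n n"
  and dim_fun_mat [simp]: "dim_row (fun_mat n m) = n" "dim_col (fun_mat n m) = n"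
  and index_fun_mat [simp]: "i < n \<Longrightarrow> j < n \<Longrightarrow> fun_mat n m $$ (i, j) = m i j"
  by (auto simp: fun_mat_def)

lemma fun_mat_of_mat: "A \<in> carrier_mat n n \<Longrightarrow> fun_mat n (\<lambda>i j. A $$ (i, j)) = A"
  by (rule eq_matI) auto

lemma fun_mat_cong: "(\<And>i j. i < n \<Longrightarrow> j < n \<Longrightarrow> m i j = m' i j) \<Longrightarrow> fun_mat n m = fun_mat n m'"
  by (rule eq_matI) auto

lemma S_cls_cong: "(\<And>i j. i < n \<Longrightarrow> j < n \<Longrightarrow> m i j = m' i j) \<Longrightarrow> S_cls n m = S_cls n m'"
  unfolding S_cls_def by (simp cong: fun_mat_cong)

lemma seifert_iff: "seifert n m \<longleftrightarrow> even n \<and> \<bar>det (fun_mat n (\<lambda>i j. m i j - m j i))\<bar> = 1"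
proof -
  have "fun_mat n m - transpose_mat (fun_mat n m) = fun_mat n (\<lambda>i j. m i j - m j i)"
    by (rule eq_matI) auto
  then show ?thesis
    by (auto simp: seifert_def seifert_mats_def unimodular_mat_def)
qed

lemma seifert_antisym_cong:
  assumes "\<And>i j. i < n \<Longrightarrow> j < n \<Longrightarrow> m i j - m j i = m' i j - m' j i"
  shows "seifert n m = seifert n m'"
proof -
  have "fun_mat n (\<lambda>i j. m i j - m j i) = fun_mat n (\<lambda>i j. m' i j - m' j i)"
    by (rule fun_mat_cong) (rule assms)
  then show ?thesis by (simp add: seifert_iff)
qed

lemma abs_S_class_eqI: "S_equiv M N \<Longrightarrow> abs_S_class M = abs_S_class N"
  using Quotient3_rel[OF Quotient3_S_class] by blast

lemma unimodular_congruence: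
  assumes P: "P \<in> carrier_mat n n" "unimodular_mat P" and m: "seifert n m"
    and m': "fun_mat n m' = P * fun_mat n m * transpose_mat P"
  shows "seifert n m'" "S_cls n m' = S_cls n m"
proof -
  have TP: "transpose_mat P \<in> carrier_mat n n" using P by simp
  let ?A = "fun_mat n m - transpose_mat (fun_mat n m)"
  have "fun_mat n m' - transpose_mat (fun_mat n m') = P * ?A * transpose_mat P"
  proof -
    have "transpose_mat (P * fun_mat n m * transpose_mat P) = P * transpose_mat (fun_mat n m) * transpose_mat P"
      using P TP by (subst transpose_mult[of _ n n _ n], auto, subst transpose_mult[of _ n n _ n], auto,
        subst assoc_mult_mat[of _ n n _ n _ n], auto)
    moreover have "P * ?A = P * fun_mat n m - P * transpose_mat (fun_mat n m)"
      using P by (intro mult_minus_distrib_mat[of _ n n _ n]) auto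
    moreover have "(P * fun_mat n m - P * transpose_mat (fun_mat n m)) * transpose_mat P =
       P * fun_mat n m * transpose_mat P - P * transpose_mat (fun_mat n m) * transpose_mat P"
      by (rule minus_mult_distrib_mat[of _ n n _ _ n]) (use P in auto)
    ultimately show ?thesis by (simp add: m')
  qed
  moreover have "det (P * ?A * transpose_mat P) = det P * det ?A * det P"
  proof -
    have A: "?A \<in> carrier_mat n n" by (rule minus_carrier_mat) simp
    show ?thesis
      by (subst det_mult[of _ n], use P A in simp, use TP in simp, subst det_mult[of _ n],
          use P in simp, use A in simp, use P in \<open>simp add: det_transpose\<close>)
  qed
  ultimately have "unimodular_mat (fun_mat n m' - transpose_mat (fun_mat n m'))"
    using P m by (auto simp: unimodular_mat_def seifert_def seifert_mats_def)
  then show s: "seifert n m'"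
    using m by (simp add: seifert_def seifert_mats_def)
  have "S_move (fun_mat n m) (fun_mat n m')"
    unfolding m' by (rule S_move.congruence[of _ n]) (use P in auto)
  then have "S_equiv (fun_mat n m) (fun_mat n m')"
    using s m by (auto intro: S_equiv.step simp: seifert_def)
  then show "S_cls n m' = S_cls n m"
    unfolding S_cls_def by (simp add: abs_S_class_eqI)
qed

text \<open>In block form \<open>(0, 0, 0; 1, e, w; -v, w, m)\<close>. The data \<open>e\<close> and
  \<open>w\<close> sit symmetrically in row and column 1, so changing them leaves the
  antisymmetrization alone, whereas \<open>v\<close> enters it.\<close>

definition enlarge :: "int \<Rightarrow> (nat \<Rightarrow> int) \<Rightarrow> (nat \<Rightarrow> int) \<Rightarrow> imat \<Rightarrow> imat" where
  "enlarge e v w m i j =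
    (if i = 0 then 0
     else if i = 1 then (if j = 0 then 1 else if j = 1 then e else w (j - 2))
     else if j = 0 then - v (i - 2) else if j = 1 then w (i - 2) else m (i - 2) (j - 2))"

lemma enlarge_row_enlargement:
  "fun_mat (n + 2) (\<lambda>i j. if i = 1 \<and> j \<ge> 2 then 0 else enlarge x (\<lambda>_. 0) c m i j) =
   four_block_mat (mat_of_rows_list 2 [[0, 0], [1, x]]) (0\<^sub>m 2 n)
     (mat_of_cols n [0\<^sub>v n, vec n c]) (fun_mat n m)"
  by (rule eq_matI)
    (auto simp: mat_of_rows_list_def mat_of_cols_def enlarge_def less_Suc_eq numeral_2_eq_2 split: if_splits)

lemma enlarge_unreduced:
  fixes x :: int and c :: "nat \<Rightarrow> int"
  assumes m: "seifert n m"
  defines "f \<equiv> \<lambda>i j. if i = 1 \<and> j \<ge> 2 then 0 else enlarge x (\<lambda>_. 0) c m i j"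
  shows "seifert (n + 2) f" "S_cls (n + 2) f = S_cls n m"
proof -
  have "det (fun_mat (n + 2) (\<lambda>i j. f i j - f j i)) =
    det (fun_mat n (\<lambda>i j. f (i + 2) (j + 2) - f (j + 2) (i + 2)))"
    unfolding fun_mat_def
    by (subst det_enlargement) (auto simp: f_def enlarge_def)
  also have "(\<lambda>i j. f (i + 2) (j + 2) - f (j + 2) (i + 2)) = (\<lambda>i j. m i j - m j i)"
    by (auto simp: f_def enlarge_def)
  finally show s: "seifert (n + 2) f" using m by (simp add: seifert_iff)
  have "S_move (fun_mat n m) (fun_mat (n + 2) f)"
    unfolding f_def enlarge_row_enlargement by (rule S_move.row_enlargement) auto
  then have "S_equiv (fun_mat n m) (fun_mat (n + 2) f)"
    using s m by (auto intro: S_equiv.step simp: seifert_def)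
  then show "S_cls (n + 2) f = S_cls n m"
    unfolding S_cls_def by (simp add: abs_S_class_eqI)
qed

text \<open>Read from right to left, adding \<open>e v v^t + v w^t + w v^t\<close> to
  \<open>m\<close> amounts to changing row and column 1 of an enlargement. A direction built from an
  arbitrary \<open>v\<close> thus becomes one built from a basis vector, and \<open>v\<close> itself
  moves into the antisymmetrization.\<close>

lemma enlarge_reduce:
  assumes m: "seifert n m"
  shows "seifert (n + 2) (enlarge e v w m)"
    and "S_cls (n + 2) (enlarge e v w m) = S_cls n (\<lambda>i j. m i j + e * v i * v j + v i * w j + w i * v j)"
proof -
  define m' where "m' = (\<lambda>i j. m i j + e * v i * v j + v i * w j + w i * v j)"
  define c where "c = (\<lambda>i. e * v i + w i)"
  define f where "f = (\<lambda>i j. if i = 1 \<and> j \<ge> 2 then 0 else enlarge e (\<lambda>_. 0) c m' i j)"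
  have m': "seifert n m'"
    using m seifert_antisym_cong[of n m m'] by (simp add: m'_def algebra_simps)
  note f = enlarge_unreduced[OF m', of e c, folded f_def]
  \<comment> \<open>The columns are forced: the second one puts \<open>-v\<close> below the unit in
    column 0, and \<open>c = e v + w\<close> makes both the remaining column and the remaining row
    equal to \<open>w\<close>.\<close>
  define Z where "Z = mat n 2 (\<lambda>(i, j). if j = 0 then c i else - v i)"
  define P where "P = four_block_mat (1\<^sub>m 2) (0\<^sub>m 2 n) Z (1\<^sub>m n)"
  let ?X = "mat_of_rows_list 2 [[0, 0], [1, e]]" and ?Y = "mat_of_cols n [0\<^sub>v n, vec n c]"
  have Z: "Z \<in> carrier_mat n 2" by (simp add: Z_def)
  have P: "P \<in> carrier_mat (n + 2) (n + 2)"
    unfolding P_def using four_block_carrier_mat[of "1\<^sub>m 2" 2 2 "1\<^sub>m n" n n] by (simp add: add.commute)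
  have "det P = 1"
    unfolding P_def by (subst det_four_block_mat_upper_right_zero[of _ 2 _ n]) (auto simp: Z)
  then have uP: "unimodular_mat P" using P by (auto simp: unimodular_mat_def)
  have X: "?X \<in> carrier_mat 2 2" and Y: "?Y \<in> carrier_mat n 2" by (auto simp: mat_of_rows_list_def)
  have X0: "?X + 0\<^sub>m 2 k = ?X" if "k = 2" for k using that X by simp
  have TP: "transpose_mat P = four_block_mat (1\<^sub>m 2) (transpose_mat Z) (0\<^sub>m n 2) (1\<^sub>m n)"
    unfolding P_def by (subst transpose_four_block_mat[of _ 2 2 _ n _ n]) (auto simp: Z)
  have F: "fun_mat (n + 2) f = four_block_mat ?X (0\<^sub>m 2 n) ?Y (fun_mat n m')"
    unfolding f_def enlarge_row_enlargement by simp
  have "P * fun_mat (n + 2) f = four_block_mat ?X (0\<^sub>m 2 n) (Z * ?X + ?Y) (fun_mat n m')"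
    unfolding P_def F
    by (subst mult_four_block_mat[of _ 2 2 _ n _ n _ _ 2 _ n]) (use X Y Z in \<open>auto simp: X0\<close>)
  also have "\<dots> * transpose_mat P =
     four_block_mat ?X (?X * transpose_mat Z) (Z * ?X + ?Y) ((Z * ?X + ?Y) * transpose_mat Z + fun_mat n m')"
    unfolding TP
    by (subst mult_four_block_mat[of _ 2 2 _ n _ n _ _ 2 _ n]) (use X Y Z in auto)
  also have ZX: "Z * ?X + ?Y = mat n 2 (\<lambda>(i, j). if j = 0 then - v i else w i)"
    by (rule eq_matI) (auto simp: Z_def mat_of_rows_list_def mat_of_cols_def scalar_prod_def
        less_Suc_eq numeral_2_eq_2 c_def)
  also have "?X * transpose_mat Z = mat 2 n (\<lambda>(i, j). if i = 0 then 0 else w j)"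
    by (rule eq_matI) (auto simp: Z_def mat_of_rows_list_def scalar_prod_def
        less_Suc_eq numeral_2_eq_2 c_def)
  also have "mat n 2 (\<lambda>(i, j). if j = 0 then - v i else w i) * transpose_mat Z + fun_mat n m' = fun_mat n m"
    by (rule eq_matI) (auto simp: Z_def m'_def scalar_prod_def numeral_2_eq_2 c_def algebra_simps)
  also have "four_block_mat ?X (mat 2 n (\<lambda>(i, j). if i = 0 then 0 else w j))
      (mat n 2 (\<lambda>(i, j). if j = 0 then - v i else w i)) (fun_mat n m) = fun_mat (n + 2) (enlarge e v w m)"
    by (rule eq_matI)
      (auto simp: mat_of_rows_list_def enlarge_def less_Suc_eq numeral_2_eq_2 split: if_splits)
  finally have "fun_mat (n + 2) (enlarge e v w m) = P * fun_mat (n + 2) f * transpose_mat P" by simp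
  note c = unimodular_congruence[OF P uP f(1) this]
  show "seifert (n + 2) (enlarge e v w m)" by (rule c(1))
  show "S_cls (n + 2) (enlarge e v w m) = S_cls n (\<lambda>i j. m i j + e * v i * v j + v i * w j + w i * v j)"
    using c(2) f(2) by (simp add: m'_def)
qed

section \<open>Alternating sums along symmetric directions\<close>

lemma
  shows S_filt_0: "0 \<in> S_filt d"
    and S_filt_add: "x \<in> S_filt d \<Longrightarrow> y \<in> S_filt d \<Longrightarrow> x + y \<in> S_filt d"
    and S_filt_diff: "x \<in> S_filt d \<Longrightarrow> y \<in> S_filt d \<Longrightarrow> x - y \<in> S_filt d"
    and S_filt_neg: "x \<in> S_filt d \<Longrightarrow> - x \<in> S_filt d"
    and S_filt_scale: "x \<in> S_filt d \<Longrightarrow> pm_scale c x \<in> S_filt d"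
  unfolding S_filt_def
  by (auto intro: pm.span_zero pm.span_add pm.span_diff pm.span_neg pm.span_scale)

definition symm :: "nat \<Rightarrow> imat \<Rightarrow> bool" where
  "symm n s \<longleftrightarrow> (\<forall>i<n. \<forall>j<n. s i j = s j i)"

definition plus_sum :: "imat \<Rightarrow> (nat \<Rightarrow> imat) \<Rightarrow> nat set \<Rightarrow> imat" where
  "plus_sum m s X = (\<lambda>i j. m i j + (\<Sum>k\<in>X. s k i j))"

text \<open>The directions are arbitrary matrices indexed by a set instead of \<open>{..<d}\<close>,
  so that single directions can be split off, inserted and reindexed.\<close>

definition altsum :: "nat \<Rightarrow> nat set \<Rightarrow> (nat \<Rightarrow> imat) \<Rightarrow> imat \<Rightarrow> S_class \<Rightarrow>\<^sub>0 rat" where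
  "altsum n K s m = (\<Sum>X\<in>Pow K. Poly_Mapping.single (S_cls n (plus_sum m s X)) ((-1) ^ card X))"

lemma symm_sum: "(\<And>k. k \<in> X \<Longrightarrow> symm n (s k)) \<Longrightarrow> symm n (\<lambda>i j. \<Sum>k\<in>X. s k i j)"
  unfolding symm_def by (auto intro: sum.cong)

lemma seifert_add_symm: "seifert n m \<Longrightarrow> symm n t \<Longrightarrow> seifert n (\<lambda>i j. m i j + t i j)"
  using seifert_antisym_cong[of n "\<lambda>i j. m i j + t i j" m] by (simp add: symm_def)

lemma seifert_plus_sum:
  "seifert n m \<Longrightarrow> (\<And>k. k \<in> X \<Longrightarrow> symm n (s k)) \<Longrightarrow> seifert n (plus_sum m s X)"
  unfolding plus_sum_def by (intro seifert_add_symm symm_sum)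

lemma altsum_cong:
  assumes "\<And>X. X \<subseteq> K \<Longrightarrow> S_cls n (plus_sum m s X) = S_cls n' (plus_sum m' s' X)"
  shows "altsum n K s m = altsum n' K s' m'"
  unfolding altsum_def by (rule sum.cong) (use assms in auto)

lemma altsum_cong_entries:
  assumes "\<And>i j. i < n \<Longrightarrow> j < n \<Longrightarrow> m i j = m' i j"
    and "\<And>k i j. k \<in> K \<Longrightarrow> i < n \<Longrightarrow> j < n \<Longrightarrow> s k i j = s' k i j"
  shows "altsum n K s m = altsum n K s' m'"
proof (rule altsum_cong, rule S_cls_cong)
  fix X i j assume "X \<subseteq> K" "i < n" "j < n"
  then show "plus_sum m s X i j = plus_sum m' s' X i j"
    using assms unfolding plus_sum_def by (intro arg_cong2[where f = "(+)"] sum.cong) auto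
qed

lemma altsum_reindex:
  assumes "bij_betw p K K'"
  shows "altsum n K (\<lambda>k. s (p k)) m = altsum n K' s m"
proof -
  have inj: "inj_on p X" if "X \<subseteq> K" for X
    using assms that by (meson bij_betw_def inj_on_subset)
  have "altsum n K' s m = (\<Sum>X\<in>Pow K. Poly_Mapping.single (S_cls n (plus_sum m s (p ` X))) ((-1) ^ card (p ` X)))"
    unfolding altsum_def by (rule sum.reindex_bij_betw[OF bij_betw_Pow[OF assms], symmetric])
  also have "\<dots> = altsum n K (\<lambda>k. s (p k)) m"
    unfolding altsum_def
  proof (rule sum.cong)
    fix X assume "X \<in> Pow K"
    then have i: "inj_on p X" using inj by auto
    have "plus_sum m s (p ` X) = plus_sum m (\<lambda>k. s (p k)) X"
      unfolding plus_sum_def by (simp add: sum.reindex[OF i])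
    then show "Poly_Mapping.single (S_cls n (plus_sum m s (p ` X))) ((-1) ^ card (p ` X)) =
      Poly_Mapping.single (S_cls n (plus_sum m (\<lambda>k. s (p k)) X)) ((-1) ^ card X)"
      using i by (simp add: card_image)
  qed simp
  finally show ?thesis by simp
qed

lemma plus_sum_insert:
  "finite X \<Longrightarrow> x \<notin> X \<Longrightarrow> plus_sum m s (insert x X) = plus_sum (\<lambda>i j. m i j + s x i j) s X"
  unfolding plus_sum_def by (simp add: add.assoc)

lemma altsum_insert:
  assumes "finite K" "x \<notin> K"
  shows "altsum n (insert x K) s m = altsum n K s m - altsum n K s (\<lambda>i j. m i j + s x i j)"
proof -
  have "(\<Sum>X\<in>Pow K. Poly_Mapping.single (S_cls n (plus_sum m s (insert x X))) ((-1) ^ card (insert x X) :: rat)) =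
    (\<Sum>X\<in>Pow K. - Poly_Mapping.single (S_cls n (plus_sum (\<lambda>i j. m i j + s x i j) s X)) ((-1) ^ card X))"
  proof (rule sum.cong)
    fix X assume "X \<in> Pow K"
    then have "finite X" "x \<notin> X" using assms finite_subset by auto
    then show "Poly_Mapping.single (S_cls n (plus_sum m s (insert x X))) ((-1) ^ card (insert x X)) =
       - (Poly_Mapping.single (S_cls n (plus_sum (\<lambda>i j. m i j + s x i j) s X)) ((-1) ^ card X) :: _ \<Rightarrow>\<^sub>0 rat)"
      by (simp add: plus_sum_insert single_uminus)
  qed simp
  then show ?thesis
    unfolding altsum_def by (simp add: sum_Pow_insert[OF assms] sum_negf)
qed

section \<open>Diagonal directions and membership in the filtration\<close>

definition unit_mat :: "nat \<Rightarrow> imat" where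
  "unit_mat c = (\<lambda>a b. of_bool (a = c \<and> b = c))"

lemma perturb_fun_mat:
  "perturb (fun_mat n m) d i \<epsilon> = fun_mat n (\<lambda>a b. m a b + (\<Sum>k<d. int (\<epsilon> k) * unit_mat (i k) a b))"
proof -
  have "foldl (\<lambda>A k. A + int (\<epsilon> k) \<cdot>\<^sub>m diag_unit_mat n (i k)) (fun_mat n m) [0..<d] =
    fun_mat n (\<lambda>a b. m a b + (\<Sum>k<d. int (\<epsilon> k) * unit_mat (i k) a b))"
  proof (induction d)
    case (Suc d)
    show ?case
      by (simp add: Suc) (rule eq_matI, auto simp: diag_unit_mat_def unit_mat_def)
  qed (auto intro!: fun_mat_cong)
  then show ?thesis by (simp add: perturb_def)
qed

lemma alternating_sum_altsum:
  "alternating_sum (fun_mat n m) d i = altsum n {..<d} (\<lambda>k. unit_mat (i k)) m"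
  unfolding alternating_sum_def altsum_def
proof (rule sum.reindex_bij_witness[where i = "\<lambda>X. \<lambda>k\<in>{..<d}. of_bool (k \<in> X)"
      and j = "\<lambda>\<epsilon>. {k\<in>{..<d}. \<epsilon> k = 1}"])
  fix \<epsilon> :: "nat \<Rightarrow> nat" assume e: "\<epsilon> \<in> {..<d} \<rightarrow>\<^sub>E {0, 1}"
  then have e01: "k < d \<Longrightarrow> \<epsilon> k = of_bool (\<epsilon> k = 1)" for k by (auto simp: PiE_iff)
  show "(\<lambda>k\<in>{..<d}. of_bool (k \<in> {k \<in> {..<d}. \<epsilon> k = 1})) = \<epsilon>"
    using e e01 by (intro ext) (auto simp: PiE_iff restrict_def extensional_def)
  show "{k \<in> {..<d}. \<epsilon> k = 1} \<in> Pow {..<d}" by auto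
  have "(\<Sum>k<d. \<epsilon> k) = (\<Sum>k<d. of_bool (\<epsilon> k = 1))"
    by (rule sum.cong) (use e01 in auto)
  then have 1: "(\<Sum>k<d. \<epsilon> k) = card {k \<in> {..<d}. \<epsilon> k = 1}"
    by (simp add: of_bool_def sum.If_cases Collect_conj_eq lessThan_def)
  have "(\<Sum>k<d. int (\<epsilon> k) * unit_mat (i k) a b) = (\<Sum>k\<in>{k \<in> {..<d}. \<epsilon> k = 1}. unit_mat (i k) a b)" for a b
  proof -
    have "(\<Sum>k<d. int (\<epsilon> k) * unit_mat (i k) a b) = (\<Sum>k<d. if \<epsilon> k = 1 then unit_mat (i k) a b else 0)"
      by (rule sum.cong) (use e in \<open>auto simp: PiE_iff\<close>)
    also have "\<dots> = (\<Sum>k\<in>{k \<in> {..<d}. \<epsilon> k = 1}. unit_mat (i k) a b)"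
      by (rule sum.inter_filter[symmetric]) simp
    finally show ?thesis .
  qed
  then have 2: "abs_S_class (perturb (fun_mat n m) d i \<epsilon>) =
    S_cls n (plus_sum m (\<lambda>k. unit_mat (i k)) {k \<in> {..<d}. \<epsilon> k = 1})"
    by (simp add: perturb_fun_mat S_cls_def plus_sum_def)
  show "Poly_Mapping.single (S_cls n (plus_sum m (\<lambda>k. unit_mat (i k)) {k \<in> {..<d}. \<epsilon> k = 1}))
           ((-1) ^ card {k \<in> {..<d}. \<epsilon> k = 1}) =
        Poly_Mapping.single (abs_S_class (perturb (fun_mat n m) d i \<epsilon>)) ((-1 :: rat) ^ (\<Sum>k<d. \<epsilon> k))"
    unfolding 1 2 ..
qed (auto simp: fun_eq_iff)

lemma altsum_unit:
  assumes "seifert n m" "finite K" "\<And>k. k \<in> K \<Longrightarrow> i k < n"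
  shows "altsum n K (\<lambda>k. unit_mat (i k)) m \<in> S_filt (card K)"
proof -
  obtain h where h: "bij_betw h {..<card K} K"
    using assms(2) ex_bij_betw_nat_finite by (metis atLeast0LessThan)
  have "altsum n K (\<lambda>k. unit_mat (i k)) m = alternating_sum (fun_mat n m) (card K) (\<lambda>k. i (h k))"
    by (simp add: alternating_sum_altsum altsum_reindex[OF h, symmetric])
  also have "\<dots> \<in> S_filt (card K)"
    unfolding S_filt_def
  proof (rule pm.span_base, clarify, intro exI conjI)
    show "fun_mat n m \<in> seifert_mats" using assms(1) by (simp add: seifert_def)
    show "\<forall>k<card K. i (h k) < dim_row (fun_mat n m)"
      using assms(3) h by (auto dest: bij_betwE)
  qed simp
  finally show ?thesis .
qed

definition shift_vec :: "(nat \<Rightarrow> int) \<Rightarrow> nat \<Rightarrow> int" where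
  "shift_vec v i = (if i < 2 then 0 else v (i - 2))"

definition shift_mat :: "imat \<Rightarrow> imat" where
  "shift_mat s i j = (if i < 2 \<or> j < 2 then 0 else s (i - 2) (j - 2))"

definition delta :: "nat \<Rightarrow> nat \<Rightarrow> int" where
  "delta i j = of_bool (j = i)"

definition sym_prod :: "(nat \<Rightarrow> int) \<Rightarrow> (nat \<Rightarrow> int) \<Rightarrow> imat" where
  "sym_prod a b i j = a i * b j + b i * a j"

text \<open>One enlargement serves all summands at once: switching direction \<open>k\<close> on
  only changes \<open>e\<close> and \<open>w\<close> in row and column 1, over the fixed base
  \<open>enlarge 0 v (\<lambda>_. 0) m\<close>. The vector \<open>v\<close> of this direction gives
  way to basis vector 1.\<close>

lemma altsum_enlarge:
  assumes m: "seifert n m" and K: "finite K" and sym: "\<And>l. l \<in> K \<Longrightarrow> symm n (s l)"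
    and k: "k \<in> K" "s k = (\<lambda>i j. e * v i * v j + sym_prod v w i j)"
    and s'k: "s' k = (\<lambda>i j. e * delta 1 i * delta 1 j + sym_prod (delta 1) (shift_vec w) i j)"
    and s'l: "\<And>l. l \<in> K \<Longrightarrow> l \<noteq> k \<Longrightarrow> s' l = shift_mat (s l)"
  shows "altsum (n + 2) K s' (enlarge 0 v (\<lambda>_. 0) m) = altsum n K s m"
proof (rule altsum_cong)
  fix X assume X: "X \<subseteq> K"
  \<comment> \<open>The switch of direction \<open>k\<close>; the other switched directions are
    absorbed into \<open>m1\<close>.\<close>
  let ?b = "of_bool (k \<in> X) :: int"
  define m1 where "m1 = plus_sum m s (X - {k})"
  have m1: "seifert n m1" unfolding m1_def using X by (intro seifert_plus_sum m sym) auto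
  have fX: "finite X" using X K finite_subset by auto
  have split: "(\<Sum>l\<in>X. f l) = ?b * f k + (\<Sum>l\<in>X - {k}. f l)" for f :: "nat \<Rightarrow> int"
    using fX by (cases "k \<in> X") (auto simp: sum.remove)
  have "plus_sum (enlarge 0 v (\<lambda>_. 0) m) s' X = enlarge (?b * e) v (\<lambda>i. ?b * w i) m1"
  proof (intro ext)
    fix i j
    have "(\<Sum>l\<in>X - {k}. s' l i j) = (\<Sum>l\<in>X - {k}. shift_mat (s l) i j)"
      by (rule sum.cong) (use X s'l in auto)
    then show "plus_sum (enlarge 0 v (\<lambda>_. 0) m) s' X i j = enlarge (?b * e) v (\<lambda>i. ?b * w i) m1 i j"
      unfolding plus_sum_def split[of "\<lambda>l. s' l i j"] s'k
      by (auto simp: enlarge_def m1_def plus_sum_def shift_mat_def shift_vec_def sym_prod_def delta_def)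
  qed
  then have "S_cls (n + 2) (plus_sum (enlarge 0 v (\<lambda>_. 0) m) s' X) =
     S_cls n (\<lambda>i j. m1 i j + ?b * e * v i * v j + v i * (?b * w j) + ?b * w i * v j)"
    using enlarge_reduce(2)[OF m1] by simp
  also have "(\<lambda>i j. m1 i j + ?b * e * v i * v j + v i * (?b * w j) + ?b * w i * v j) = plus_sum m s X"
    unfolding plus_sum_def split[of "\<lambda>l. s l _ _"] k
    by (auto simp: m1_def plus_sum_def sym_prod_def algebra_simps)
  finally show "S_cls (n + 2) (plus_sum (enlarge 0 v (\<lambda>_. 0) m) s' X) = S_cls n (plus_sum m s X)" .
qed

text \<open>Induction on the set \<open>U\<close> of directions that are not known to be diagonal
  units. Enlarging with \<open>e = 1\<close> and \<open>w = 0\<close> turns \<open>v k\<close> into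
  basis vector 1 and shifts the other directions by two places, which keeps diagonal units diagonal
  units.\<close>

lemma altsum_rank_one:
  assumes "finite U"
  shows "seifert n m \<Longrightarrow> finite K \<Longrightarrow> U \<subseteq> K \<Longrightarrow> (\<And>k. k \<in> U \<Longrightarrow> s k = (\<lambda>i j. v k i * v k j)) \<Longrightarrow>
    (\<And>k. k \<in> K - U \<Longrightarrow> s k = unit_mat (c k) \<and> c k < n) \<Longrightarrow> altsum n K s m \<in> S_filt (card K)"
  using assms
proof (induction U arbitrary: n m s v c rule: finite_induct)
  case empty
  then have "altsum n K s m = altsum n K (\<lambda>k. unit_mat (c k)) m"
    by (intro altsum_cong_entries) auto
  then show ?case using empty altsum_unit[of n m K c] by simp
next
  case (insert k U)
  define s' where "s' l = (if l = k then unit_mat 1 else shift_mat (s l))" for l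
  have sym: "symm n (s l)" if "l \<in> K" for l
    using insert.prems that by (cases "l \<in> insert k U") (auto simp: symm_def unit_mat_def)
  have "altsum (n + 2) K s' (enlarge 0 (v k) (\<lambda>_. 0) m) \<in> S_filt (card K)"
  proof (rule insert.IH[where v = "\<lambda>l. shift_vec (v l)" and c = "\<lambda>l. if l = k then 1 else c l + 2"])
    show "seifert (n + 2) (enlarge 0 (v k) (\<lambda>_. 0) m)" using insert.prems by (intro enlarge_reduce)
    show "s' l = (\<lambda>i j. shift_vec (v l) i * shift_vec (v l) j)" if "l \<in> U" for l
      using that insert by (auto simp: s'_def shift_mat_def shift_vec_def fun_eq_iff)
    show "s' l = unit_mat (if l = k then 1 else c l + 2) \<and> (if l = k then 1 else c l + 2) < n + 2"
      if "l \<in> K - U" for l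
      using that insert.prems(5)[of l] by (auto simp: s'_def shift_mat_def unit_mat_def fun_eq_iff)
  qed (use insert.prems in auto)
  also have "altsum (n + 2) K s' (enlarge 0 (v k) (\<lambda>_. 0) m) = altsum n K s m"
    by (rule altsum_enlarge[where e = 1 and k = k and w = "\<lambda>_. 0"])
      (use insert.prems sym in \<open>auto simp: s'_def sym_prod_def delta_def unit_mat_def shift_vec_def fun_eq_iff\<close>)
  finally show ?case .
qed

text \<open>Polarization over the integers: for basis vectors \<open>a\<close> and \<open>b\<close>,
  the matrix \<open>(a + b)(a + b)^t - a a^t - b b^t\<close> equals \<open>a b^t + b a^t\<close>, so
  squares generate all symmetric integer matrices without division.\<close>

lemma symm_induct [consumes 1, case_names cong rank_one add neg]:
  assumes sym: "symm n t"
    and cong: "\<And>t t'. P t \<Longrightarrow> (\<And>i j. i < n \<Longrightarrow> j < n \<Longrightarrow> t i j = t' i j) \<Longrightarrow> P t'"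
    and R: "\<And>v. P (\<lambda>i j. v i * v j)"
    and add: "\<And>s t. P s \<Longrightarrow> P t \<Longrightarrow> P (\<lambda>i j. s i j + t i j)"
    and neg: "\<And>t. P t \<Longrightarrow> P (\<lambda>i j. - t i j)"
  shows "P t"
proof -
  have zero: "P (\<lambda>i j. 0)" using R[of "\<lambda>_. 0"] by simp
  have sum: "P (\<lambda>i j. \<Sum>k\<in>A. f k i j)" if "finite A" "\<And>k. k \<in> A \<Longrightarrow> P (f k)" for A :: "nat set" and f
    using that by (induction A rule: finite_induct) (auto intro: zero add)
  have nat_scale: "P (\<lambda>i j. int c * f i j)" if "P f" for f c
  proof (induction c)
    case (Suc c) then show ?case using add[OF that Suc] by (simp add: algebra_simps)
  qed (simp add: zero)
  have scale: "P (\<lambda>i j. c * f i j)" if "P f" for f c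
  proof (cases "c \<ge> 0")
    case True then show ?thesis using nat_scale[OF that, of "nat c"] by simp
  next
    case False then show ?thesis using neg[OF nat_scale[OF that, of "nat (- c)"]] by simp
  qed
  define U where "U a b = (\<lambda>i j. (delta a i + delta b i) * (delta a j + delta b j) +
    - (delta a i * delta a j + delta b i * delta b j))" for a b
  have U: "P (U a b)" for a b
    unfolding U_def by (intro add neg R)
  define t' where "t' = (\<lambda>i j. (\<Sum>a<n. t a a * (delta a i * delta a j)) + (\<Sum>a<n. \<Sum>b<a. t a b * U a b i j))"
  have "P t'"
    unfolding t'_def by (intro add sum scale R U) auto
  then show ?thesis
  proof (rule cong)
    fix i j assume ij: "i < n" "j < n"
    have diag: "(\<Sum>a<n. t a a * (delta a i * delta a j)) = (if i = j then t i i else 0)"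
      by (subst sum_lessThan_unique[of i]) (use ij in \<open>auto simp: delta_def\<close>)
    have U': "U a b i j = delta a i * delta b j + delta b i * delta a j" for a b
      by (simp add: U_def algebra_simps)
    have row: "(\<Sum>b<a. t a b * U a b i j) =
       (if a = i \<and> j < i then t i j else 0) + (if a = j \<and> i < j then t j i else 0)" for a
    proof -
      have "(\<Sum>b<a. t a b * U a b i j) = (\<Sum>b<a. t a b * (delta a i * delta b j)) + (\<Sum>b<a. t a b * (delta b i * delta a j))"
        by (simp add: U' algebra_simps sum.distrib)
      also have "(\<Sum>b<a. t a b * (delta a i * delta b j)) = (if a = i \<and> j < i then t i j else 0)"
        by (cases "j < a") (auto simp: delta_def sum_lessThan_unique[of j])
      also have "(\<Sum>b<a. t a b * (delta b i * delta a j)) = (if a = j \<and> i < j then t j i else 0)"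
        by (cases "i < a") (auto simp: delta_def sum_lessThan_unique[of i])
      finally show ?thesis .
    qed
    have "(\<Sum>a<n. \<Sum>b<a. t a b * U a b i j) = (if j < i then t i j else 0) + (if i < j then t j i else 0)"
      unfolding row sum.distrib
      by (subst sum_lessThan_unique[of i], (use ij in auto)[2], subst sum_lessThan_unique[of j]) (use ij in auto)
    then show "t' i j = t i j"
      unfolding t'_def diag using ij sym by (auto simp: symm_def)
  qed
qed

text \<open>The identity \<open>1 - t t' = (1 - t) + t (1 - t')\<close> for translation operators.
  The second summand has a shifted base, so that genuine additivity only appears modulo the next
  step.\<close>

lemma altsum_add:
  assumes "finite K" "k \<in> K"
  shows "altsum n K (s(k := \<lambda>i j. t i j + t' i j)) m =
    altsum n K (s(k := t)) m + altsum n K (s(k := t')) (\<lambda>i j. m i j + t i j)"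
proof -
  obtain L where L: "K = insert k L" "k \<notin> L" using assms by (metis Set.set_insert)
  have fL: "finite L" using L assms by auto
  have c: "altsum n L (s(k := r)) m' = altsum n L s m'" for r m'
    by (rule altsum_cong_entries) (use L in auto)
  show ?thesis
    unfolding L(1) by (simp add: altsum_insert[OF fL L(2)] c add.assoc)
qed

lemma altsum_zero:
  assumes "finite K" "k \<in> K" "\<And>i j. i < n \<Longrightarrow> j < n \<Longrightarrow> s k i j = 0"
  shows "altsum n K s m = 0"
proof -
  obtain L where L: "K = insert k L" "k \<notin> L" using assms by (metis Set.set_insert)
  have fL: "finite L" using L assms by auto
  have "altsum n L s (\<lambda>i j. m i j + s k i j) = altsum n L s m"
    by (rule altsum_cong_entries) (use assms in auto)
  then show ?thesis by (simp add: L(1) altsum_insert[OF fL L(2)])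
qed

lemma altsum_neg:
  assumes "finite K" "k \<in> K"
  shows "altsum n K (s(k := \<lambda>i j. - t i j)) m = - altsum n K (s(k := t)) (\<lambda>i j. m i j - t i j)"
proof -
  have "altsum n K (s(k := \<lambda>i j. t i j + - t i j)) (\<lambda>i j. m i j - t i j) = 0"
    by (rule altsum_zero[OF assms]) simp
  then have "altsum n K (s(k := t)) (\<lambda>i j. m i j - t i j) + altsum n K (s(k := \<lambda>i j. - t i j)) m = 0"
    unfolding altsum_add[OF assms] by simp
  then show ?thesis by (simp add: eq_neg_iff_add_eq_0 add.commute)
qed

text \<open>One direction at a time is freed from being a square, by induction over symmetric
  matrices. The predicate \<open>P\<close> quantifies over all bases because sums and negatives of
  directions shift the base.\<close>

lemma altsum_symm:
  assumes K: "finite K" and m: "seifert n m" and sym: "\<And>k. k \<in> K \<Longrightarrow> symm n (s k)"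
  shows "altsum n K s m \<in> S_filt (card K)"
proof -
  have "altsum n K s m \<in> S_filt (card K)"
    if "finite U" "seifert n m" "U \<subseteq> K" "\<And>k. k \<in> U \<Longrightarrow> symm n (s k)"
      "\<And>k. k \<in> K - U \<Longrightarrow> \<exists>v. s k = (\<lambda>i j. v i * v j)" for U s m
    using that
  proof (induction U arbitrary: m s rule: finite_induct)
    case empty
    then obtain v where "\<forall>k\<in>K. s k = (\<lambda>i j. v k i * v k j)" by (metis Diff_empty)
    with empty K show ?case by (intro altsum_rank_one[of K n m K s v]) auto
  next
    case (insert k U)
    have k: "k \<in> K" using insert by auto
    define P where "P t \<longleftrightarrow> symm n t \<and> (\<forall>m. seifert n m \<longrightarrow> altsum n K (s(k := t)) m \<in> S_filt (card K))" for t
    have "symm n (s k)" using insert by auto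
    then have "P (s k)"
    proof (induction rule: symm_induct)
      case (cong t t')
      have "altsum n K (s(k := t')) m = altsum n K (s(k := t)) m" for m
        by (rule altsum_cong_entries) (use cong(2) in auto)
      moreover have "symm n t'" using cong by (auto simp: P_def symm_def)
      ultimately show ?case using cong(1) by (auto simp: P_def)
    next
      case (rank_one v)
      have "altsum n K (s(k := \<lambda>i j. v i * v j)) m \<in> S_filt (card K)" if "seifert n m" for m
        by (rule insert.IH) (use that insert.prems insert.hyps in auto)
      then show ?case by (simp add: P_def symm_def)
    next
      case (add t t')
      have "symm n (\<lambda>i j. t i j + t' i j)" using add by (simp add: P_def symm_def)
      with add show ?case
        by (auto simp: P_def altsum_add[OF K k] intro!: S_filt_add seifert_add_symm)
    next
      case (neg t)
      have "symm n (\<lambda>i j. - t i j)" using neg by (simp add: P_def symm_def)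
      with neg seifert_add_symm[of n _ "\<lambda>i j. - t i j"] show ?case
        by (auto simp: P_def altsum_neg[OF K k] intro!: S_filt_neg)
    qed
    then show ?case using insert.prems by (auto simp: P_def)
  qed
  from this[of K m s] show ?thesis using assms by auto
qed

section \<open>Congruence modulo the next step of the filtration\<close>

definition filt_eq :: "nat \<Rightarrow> (S_class \<Rightarrow>\<^sub>0 rat) \<Rightarrow> (S_class \<Rightarrow>\<^sub>0 rat) \<Rightarrow> bool" where
  "filt_eq d x y \<longleftrightarrow> x - y \<in> S_filt (Suc d)"

lemma filt_eq_refl [simp]: "filt_eq d x x"
  by (simp add: filt_eq_def S_filt_0)

lemma filt_eq_sym: "filt_eq d x y \<Longrightarrow> filt_eq d y x"
  unfolding filt_eq_def using S_filt_neg[of "x - y"] by simp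

lemma filt_eq_trans [trans]: "filt_eq d x y \<Longrightarrow> filt_eq d y z \<Longrightarrow> filt_eq d x z"
  unfolding filt_eq_def using S_filt_add[of "x - y" _ "y - z"] by simp

lemma filt_eq_add: "filt_eq d x y \<Longrightarrow> filt_eq d x' y' \<Longrightarrow> filt_eq d (x + x') (y + y')"
  unfolding filt_eq_def using S_filt_add[of "x - y" _ "x' - y'"] by (simp add: algebra_simps)

text \<open>The symmetric matrix \<open>m' - m\<close> is used as an additional direction with a
  fresh index \<open>x\<close>; the difference of the two sums is an alternating sum with one
  direction more.\<close>

lemma altsum_base_change:
  assumes K: "finite K" and m: "seifert n m" and sym: "\<And>k. k \<in> K \<Longrightarrow> symm n (s k)"
    and a: "\<And>i j. i < n \<Longrightarrow> j < n \<Longrightarrow> m i j - m j i = m' i j - m' j i"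
  shows "filt_eq (card K) (altsum n K s m) (altsum n K s m')"
proof -
  obtain x where x: "x \<notin> K" using K ex_new_if_finite infinite_UNIV_nat by blast
  define s' where "s' = s(x := \<lambda>i j. m' i j - m i j)"
  have c: "altsum n K s' m0 = altsum n K s m0" for m0
    by (rule altsum_cong_entries) (use x in \<open>auto simp: s'_def\<close>)
  have "symm n (\<lambda>i j. m' i j - m i j)"
    unfolding symm_def using a by (smt (verit))
  then have "altsum n (insert x K) s' m \<in> S_filt (card (insert x K))"
    by (intro altsum_symm) (use K m sym in \<open>auto simp: s'_def\<close>)
  then show ?thesis
    using K x by (simp add: filt_eq_def altsum_insert c) (simp add: s'_def)
qed

lemma altsum_multilinear:
  assumes K: "finite K" "k \<in> K" and m: "seifert n m" and sym: "\<And>k. k \<in> K \<Longrightarrow> symm n (s k)"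
    and t: "symm n t" "symm n t'"
  shows "filt_eq (card K) (altsum n K (s(k := \<lambda>i j. t i j + t' i j)) m)
    (altsum n K (s(k := t)) m + altsum n K (s(k := t')) m)"
  unfolding altsum_add[OF K]
  by (intro filt_eq_add filt_eq_refl altsum_base_change)
    (use K m sym t seifert_add_symm[OF m t(1)] in \<open>auto simp: symm_def\<close>)

lemma altsum_uminus:
  assumes K: "finite K" "k \<in> K" and m: "seifert n m" and sym: "\<And>k. k \<in> K \<Longrightarrow> symm n (s k)"
    and t: "symm n t"
  shows "filt_eq (card K) (altsum n K (s(k := \<lambda>i j. - t i j)) m) (pm_scale (- 1) (altsum n K (s(k := t)) m))"
proof -
  let ?A = "\<lambda>t. altsum n K (s(k := t)) m"
  have "filt_eq (card K) (?A (\<lambda>i j. t i j + - t i j)) (?A t + ?A (\<lambda>i j. - t i j))"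
    by (rule altsum_multilinear[OF K m sym t]) (use t in \<open>auto simp: symm_def\<close>)
  moreover have "?A (\<lambda>i j. t i j + - t i j) = 0"
    by (rule altsum_zero[OF K]) simp
  ultimately have "- (?A t + ?A (\<lambda>i j. - t i j)) \<in> S_filt (Suc (card K))"
    by (simp only: filt_eq_def diff_0)
  from S_filt_neg[OF this] show ?thesis by (simp add: filt_eq_def add.commute)
qed

lemma altsum_congruence:
  assumes P: "unimodular_mat (fun_mat n p)" and m: "seifert n m" and sym: "\<And>k. k \<in> K \<Longrightarrow> symm n (s k)"
    and m': "\<And>i j. i < n \<Longrightarrow> j < n \<Longrightarrow> m' i j = (\<Sum>a<n. \<Sum>b<n. p i a * m a b * p j b)"
    and s': "\<And>k i j. k \<in> K \<Longrightarrow> i < n \<Longrightarrow> j < n \<Longrightarrow> s' k i j = (\<Sum>a<n. \<Sum>b<n. p i a * s k a b * p j b)"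
  shows "altsum n K s' m' = altsum n K s m"
proof (rule altsum_cong)
  fix X assume X: "X \<subseteq> K"
  have "fun_mat n (plus_sum m' s' X) = fun_mat n p * fun_mat n (plus_sum m s X) * transpose_mat (fun_mat n p)"
  proof (rule eq_matI)
    fix i j assume "i < dim_row (fun_mat n p * fun_mat n (plus_sum m s X) * transpose_mat (fun_mat n p))"
      "j < dim_col (fun_mat n p * fun_mat n (plus_sum m s X) * transpose_mat (fun_mat n p))"
    then have ij: "i < n" "j < n" by auto
    have "(fun_mat n p * fun_mat n (plus_sum m s X) * transpose_mat (fun_mat n p)) $$ (i, j) =
      (\<Sum>b<n. (\<Sum>a<n. p i a * plus_sum m s X a b) * p j b)"
      using ij by (simp add: scalar_prod_def atLeast0LessThan)
    also have "\<dots> = (\<Sum>a<n. \<Sum>b<n. p i a * plus_sum m s X a b * p j b)"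
      by (subst sum.swap) (simp add: sum_distrib_right)
    also have "\<dots> = (\<Sum>a<n. \<Sum>b<n. p i a * m a b * p j b) + (\<Sum>a<n. \<Sum>b<n. \<Sum>k\<in>X. p i a * s k a b * p j b)"
      by (simp add: plus_sum_def algebra_simps sum.distrib sum_distrib_left sum_distrib_right)
    also have "(\<Sum>a<n. \<Sum>b<n. \<Sum>k\<in>X. p i a * s k a b * p j b) = (\<Sum>k\<in>X. \<Sum>a<n. \<Sum>b<n. p i a * s k a b * p j b)"
    proof -
      have inner: "(\<Sum>b<n. \<Sum>k\<in>X. p i a * s k a b * p j b) = (\<Sum>k\<in>X. \<Sum>b<n. p i a * s k a b * p j b)" for a
        by (rule sum.swap)
      have "(\<Sum>a<n. \<Sum>b<n. \<Sum>k\<in>X. p i a * s k a b * p j b) = (\<Sum>a<n. \<Sum>k\<in>X. \<Sum>b<n. p i a * s k a b * p j b)"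
        by (intro sum.cong HOL.refl inner)
      also have "\<dots> = (\<Sum>k\<in>X. \<Sum>a<n. \<Sum>b<n. p i a * s k a b * p j b)"
        by (rule sum.swap)
      finally show ?thesis .
    qed
    also have "\<dots> = (\<Sum>k\<in>X. s' k i j)"
      by (rule sum.cong) (use X ij s' in auto)
    finally show "fun_mat n (plus_sum m' s' X) $$ (i, j) =
      (fun_mat n p * fun_mat n (plus_sum m s X) * transpose_mat (fun_mat n p)) $$ (i, j)"
      using ij m' by (simp add: plus_sum_def)
  qed auto
  moreover have "seifert n (plus_sum m s X)" using X m sym by (intro seifert_plus_sum) auto
  ultimately show "S_cls n (plus_sum m' s' X) = S_cls n (plus_sum m s X)"
    by (intro unimodular_congruence(2)[OF _ P]) auto
qed

section \<open>The Gram matrix determines an alternating sum\<close>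

definition std_mat :: imat where
  "std_mat i j = of_bool (odd i \<and> i = Suc j)"

text \<open>This is \<open>a^t A^(-1) b\<close>, where \<open>A\<close> is the antisymmetrization of
  \<open>std_mat\<close>, a direct sum of blocks \<open>(0, -1; 1, 0)\<close>.\<close>

definition symp :: "nat \<Rightarrow> (nat \<Rightarrow> int) \<Rightarrow> (nat \<Rightarrow> int) \<Rightarrow> int" where
  "symp g a b = (\<Sum>i<g. a (2 * i) * b (2 * i + 1) - a (2 * i + 1) * b (2 * i))"

lemma symp_antisym: "symp g b a = - symp g a b"
  unfolding symp_def sum_negf[symmetric] by (rule sum.cong) auto

lemma symp_self [simp]: "symp g a a = 0"
  unfolding symp_def by simp

lemma symp_Suc: "symp (Suc g) a b = a 0 * b 1 - a 1 * b 0 + symp g (\<lambda>i. a (i + 2)) (\<lambda>i. b (i + 2))"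
  unfolding symp_def by (subst sum.lessThan_Suc_shift) simp

lemma sum_double: "(\<Sum>a<2 * g. f a) = (\<Sum>i<g. f (2 * i) + f (2 * i + 1 :: nat) :: 'a::comm_monoid_add)"
  by (induction g) (auto simp: add.assoc)

lemma enlarge_std_mat: "enlarge 0 (\<lambda>_. 0) (\<lambda>_. 0) std_mat = std_mat"
proof (intro ext)
  fix i j :: nat
  show "enlarge 0 (\<lambda>_. 0) (\<lambda>_. 0) std_mat i j = std_mat i j"
  proof (cases "i < 2 \<or> j < 2")
    case True
    then show ?thesis by (auto simp: enlarge_def std_mat_def less_2_cases_iff)
  next
    case False
    then obtain i' j' where "i = i' + 2" "j = j' + 2" by (metis le_add_diff_inverse2 not_less)
    then show ?thesis by (simp add: enlarge_def std_mat_def)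
  qed
qed

lemma seifert_std_mat: "seifert (2 * g) std_mat"
proof (induction g)
  case (Suc g)
  then show ?case using enlarge_reduce(1)[of "2 * g" std_mat 0 "\<lambda>_. 0" "\<lambda>_. 0"] by (simp add: enlarge_std_mat)
qed (simp add: seifert_iff)

text \<open>The preimage of \<open>shift_vec x\<close> under the unipotent matrix that relates an
  enlargement by \<open>v\<close> to the standard form. With this entry 0, pairing with basis vector
  1 reproduces the old pairing with \<open>v\<close>.\<close>

definition project :: "nat \<Rightarrow> (nat \<Rightarrow> int) \<Rightarrow> (nat \<Rightarrow> int) \<Rightarrow> nat \<Rightarrow> int" where
  "project g v x i = (if i = 0 then - symp g v x else shift_vec x i)"

lemma sym_prod_commute: "sym_prod a b = sym_prod b a"
  unfolding sym_prod_def by (intro ext) simp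

lemma symm_sym_prod [simp]: "symm n (sym_prod a b)"
  unfolding symm_def sym_prod_def by simp

lemma sum_std_mat_antisym:
  assumes "even n" "j < n"
  shows "(\<Sum>a<n. f a * (std_mat a j - std_mat j a)) = (if even j then f (j + 1) else - f (j - 1))"
proof (cases "even j")
  case True
  then have "j + 1 < n" using assms by presburger
  then have "(\<Sum>a<n. f a * (std_mat a j - std_mat j a)) = f (j + 1) * (std_mat (j + 1) j - std_mat j (j + 1))"
    by (intro sum_lessThan_unique) (use True in \<open>auto simp: std_mat_def\<close>)
  then show ?thesis using True by (simp add: std_mat_def)
next
  case False
  then have "(\<Sum>a<n. f a * (std_mat a j - std_mat j a)) = f (j - 1) * (std_mat (j - 1) j - std_mat j (j - 1))"
    by (intro sum_lessThan_unique) (use False assms in \<open>auto simp: std_mat_def\<close>)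
  then show ?thesis using False by (simp add: std_mat_def)
qed

text \<open>An enlargement exchanges \<open>v\<close> for basis vector 1 at the cost of putting
  \<open>v\<close> into \<open>A\<close>; a congruence that differs from the identity only in row 0
  removes it from \<open>A\<close> again. The other vectors then record their pairing with
  \<open>v\<close> in coordinate 0.\<close>

lemma altsum_step:
  fixes g :: nat and v :: "nat \<Rightarrow> int"
  defines "h \<equiv> project g v"
  assumes K: "finite K" "k \<in> K" and sk: "s k = sym_prod v w" and sl: "\<And>l. l \<in> K \<Longrightarrow> l \<noteq> k \<Longrightarrow> s l = sym_prod (x l) (y l)"
    and s'k: "s' k = sym_prod (delta 1) (h w)" and s'l: "\<And>l. l \<in> K \<Longrightarrow> l \<noteq> k \<Longrightarrow> s' l = sym_prod (h (x l)) (h (y l))"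
  shows "filt_eq (card K) (altsum (2 * g) K s std_mat) (altsum (2 * Suc g) K s' std_mat)"
proof -
  define n where n: "n = 2 * g + 2"
  define e where "e = enlarge 0 v (\<lambda>_. 0) std_mat"
  define s1 where "s1 l = (if l = k then sym_prod (delta 1) (shift_vec w) else sym_prod (shift_vec (x l)) (shift_vec (y l)))" for l
  have sym: "symm n (s l)" if "l \<in> K" for l n
    using that sk sl by (cases "l = k") auto
  have sym': "symm n (s' l)" if "l \<in> K" for l n
    using that s'k s'l by (cases "l = k") auto
  have step1: "altsum n K s1 e = altsum (2 * g) K s std_mat"
    unfolding e_def n
  proof (rule altsum_enlarge[OF seifert_std_mat K(1) _ K(2), where e = 0 and w = w])
    show "s1 l = shift_mat (s l)" if "l \<in> K" "l \<noteq> k" for l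
      using that sl by (auto simp: s1_def fun_eq_iff sym_prod_def shift_vec_def shift_mat_def)
  qed (auto simp: sym sk s1_def sym_prod_def fun_eq_iff)
  \<comment> \<open>The row vector \<open>v^t A^(-1)\<close>, moved by two places; summing against
    it is therefore the pairing with \<open>v\<close>.\<close>
  define kv where "kv a = (if a < 2 then 0 else if even a then - v (a - 1) else v (a - 3))" for a
  define p where "p i a = delta i a + (if i = 0 then kv a else 0)" for i a
  have p_sum: "(\<Sum>a<n. p i a * f a) = f i + (if i = 0 then \<Sum>a<n. kv a * f a else 0)" if "i < n" for i f
  proof -
    have "(\<Sum>a<n. delta i a * f a) = f i"
      by (subst sum_lessThan_unique[of i]) (use that in \<open>auto simp: delta_def\<close>)
    then show ?thesis by (simp add: p_def distrib_right sum.distrib)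
  qed
  have kv_sum: "(\<Sum>a<n. kv a * f a) = symp g v (\<lambda>i. f (i + 2))" for f
  proof -
    have "(\<Sum>a<2 * Suc g. kv a * f a) = symp g v (\<lambda>i. f (i + 2))"
      unfolding sum_double symp_def
      by (subst sum.lessThan_Suc_shift) (auto simp: kv_def intro!: sum.cong)
    then show ?thesis by (simp add: n)
  qed
  have up: "upper_triangular (fun_mat n p)"
    by (auto simp: p_def delta_def)
  have "det (fun_mat n p) = prod_list (diag_mat (fun_mat n p))"
    by (rule det_upper_triangular[OF up]) (rule fun_mat_carrier)
  also have "diag_mat (fun_mat n p) = replicate n 1"
    by (rule nth_equalityI) (auto simp: diag_mat_def p_def delta_def kv_def)
  finally have "unimodular_mat (fun_mat n p)" by (simp add: unimodular_mat_def)
  define m2 where "m2 i j = (\<Sum>a<n. \<Sum>b<n. p i a * std_mat a b * p j b)" for i j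
  have bil: "(\<Sum>a<n. \<Sum>b<n. p i a * sym_prod \<xi> \<eta> a b * p j b) =
      sym_prod (\<lambda>i. \<Sum>a<n. p i a * \<xi> a) (\<lambda>i. \<Sum>a<n. p i a * \<eta> a) i j" for \<xi> \<eta> i j
  proof -
    have "(\<Sum>a<n. p i a * \<xi> a) * (\<Sum>b<n. p j b * \<eta> b) + (\<Sum>a<n. p i a * \<eta> a) * (\<Sum>b<n. p j b * \<xi> b)
      = (\<Sum>a<n. \<Sum>b<n. p i a * sym_prod \<xi> \<eta> a b * p j b)"
      unfolding sum_product sum.distrib[symmetric] by (simp add: sym_prod_def algebra_simps)
    then show ?thesis by (simp add: sym_prod_def mult.commute)
  qed
  have ph: "(\<Sum>a<n. p i a * h \<xi> a) = shift_vec \<xi> i" if "i < n" for i \<xi>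
    using that by (simp only: p_sum kv_sum) (auto simp: h_def project_def shift_vec_def)
  have pd: "(\<Sum>a<n. p i a * delta 1 a) = delta 1 i" if "i < n" for i
    using that by (simp only: p_sum kv_sum) (auto simp: delta_def symp_def)
  have step2: "altsum n K s1 m2 = altsum n K s' std_mat"
  proof (rule altsum_congruence[OF \<open>unimodular_mat (fun_mat n p)\<close>])
    show "seifert n std_mat" using seifert_std_mat[of "Suc g"] by (simp add: n)
    show "s1 l i j = (\<Sum>a<n. \<Sum>b<n. p i a * s' l a b * p j b)" if "l \<in> K" "i < n" "j < n" for l i j
    proof (cases "l = k")
      case True
      then show ?thesis using that by (simp only: s'k bil) (simp only: sym_prod_def ph pd s1_def simp_thms if_True)
    next
      case False
      then show ?thesis using that by (simp only: s'l[OF that(1) False] bil) (simp only: sym_prod_def ph s1_def simp_thms if_False)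
    qed
  qed (auto simp: sym' m2_def)
  have kO: "(\<Sum>a<n. kv a * (std_mat a j - std_mat j a)) = shift_vec v j" if "j < n" for j
  proof -
    have "j = 0 \<or> j = 1 \<or> (\<exists>q. j = 2 * q + 2) \<or> (\<exists>q. j = 2 * q + 3)"
      by presburger
    then show ?thesis
      using that by (subst sum_std_mat_antisym) (auto simp: kv_def shift_vec_def n)
  qed
  \<comment> \<open>The base \<open>m2\<close> obtained from \<open>std_mat\<close> by the
    congruence need not be the enlargement \<open>e\<close>, but it has the same antisymmetrization,
    which is enough modulo the next step.\<close>
  have "filt_eq (card K) (altsum n K s1 e) (altsum n K s1 m2)"
  proof (rule altsum_base_change[OF K(1)])
    show "seifert n e" unfolding e_def n by (intro enlarge_reduce seifert_std_mat)
    show "symm n (s1 l)" for l by (simp add: s1_def)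
    fix i j assume ij: "i < n" "j < n"
    have "m2 j i = (\<Sum>a<n. \<Sum>b<n. p i a * std_mat b a * p j b)"
      unfolding m2_def by (subst sum.swap) (simp add: mult_ac)
    then have "m2 i j - m2 j i =
        (\<Sum>a<n. \<Sum>b<n. p i a * std_mat a b * p j b) - (\<Sum>a<n. \<Sum>b<n. p i a * std_mat b a * p j b)"
      by (simp only: m2_def[of i j])
    also have "\<dots> = (\<Sum>a<n. \<Sum>b<n. p i a * (p j b * (std_mat a b - std_mat b a)))"
      by (simp add: sum_subtractf right_diff_distrib mult_ac)
    also have "\<dots> = (\<Sum>a<n. p i a * (std_mat a j - std_mat j a + (if j = 0 then - shift_vec v a else 0)))"
    proof (rule sum.cong)
      fix a assume a: "a \<in> {..<n}"
      have "(\<Sum>b<n. p j b * (std_mat a b - std_mat b a)) = std_mat a j - std_mat j a + (if j = 0 then \<Sum>b<n. kv b * (std_mat a b - std_mat b a) else 0)"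
        by (rule p_sum) (rule ij)
      also have "(\<Sum>b<n. kv b * (std_mat a b - std_mat b a)) = - (\<Sum>b<n. kv b * (std_mat b a - std_mat a b))"
        by (simp add: right_diff_distrib sum_subtractf)
      also have "\<dots> = - shift_vec v a" using kO[of a] a by simp
      finally show "(\<Sum>b<n. p i a * (p j b * (std_mat a b - std_mat b a))) =
        p i a * (std_mat a j - std_mat j a + (if j = 0 then - shift_vec v a else 0))"
        by (simp add: sum_distrib_left[symmetric])
    qed simp
    also have "\<dots> = std_mat i j - std_mat j i + (if j = 0 then - shift_vec v i else 0) + (if i = 0 then shift_vec v j else 0)"
    proof -
      have "(\<Sum>a<n. kv a * (std_mat a j - std_mat j a + (if j = 0 then - shift_vec v a else 0))) =
          shift_vec v j - (if j = 0 then \<Sum>a<n. kv a * shift_vec v a else 0)"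
        unfolding kO[OF ij(2), symmetric]
        by (cases "j = 0") (simp_all add: distrib_left right_diff_distrib sum.distrib sum_subtractf sum_negf)
      also have "(\<Sum>a<n. kv a * shift_vec v a) = 0"
        by (simp only: kv_sum) (simp add: shift_vec_def)
      finally show ?thesis using ij by (simp only: p_sum) auto
    qed
    also have "\<dots> = e i j - e j i"
    proof -
      have "std_mat i j = enlarge 0 (\<lambda>_. 0) (\<lambda>_. 0) std_mat i j" "std_mat j i = enlarge 0 (\<lambda>_. 0) (\<lambda>_. 0) std_mat j i" by (simp_all only: enlarge_std_mat)
      then show ?thesis by (auto simp: e_def enlarge_def shift_vec_def)
    qed
    finally show "e i j - e j i = m2 i j - m2 j i" by simp
  qed
  then show ?thesis using step1 step2 by (simp add: n)
qed

text \<open>Direction \<open>k\<close> is spanned by the vectors in its two slots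
  \<open>(k, False)\<close> and \<open>(k, True)\<close>. Symmetric products replace squares because
  they are additive in each vector separately.\<close>

definition slot_sum :: "nat \<Rightarrow> nat \<Rightarrow> (nat \<times> bool \<Rightarrow> nat \<Rightarrow> int) \<Rightarrow> S_class \<Rightarrow>\<^sub>0 rat" where
  "slot_sum g d u = altsum (2 * g) {..<d} (\<lambda>k. sym_prod (u (k, False)) (u (k, True))) std_mat"

definition slots :: "nat \<Rightarrow> (nat \<times> bool) set" where
  "slots d = {..<d} \<times> UNIV"

lemma mem_slots [simp]: "(k, b) \<in> slots d \<longleftrightarrow> k < d"
  by (simp add: slots_def)

lemma finite_slots [simp]: "finite (slots d)"
  by (simp add: slots_def)

lemma slot_sum_cong: "(\<And>s i. s \<in> slots d \<Longrightarrow> i < 2 * g \<Longrightarrow> u s i = u' s i) \<Longrightarrow> slot_sum g d u = slot_sum g d u'"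
  unfolding slot_sum_def by (rule altsum_cong_entries) (auto simp: sym_prod_def)

lemma slot_sum_step:
  assumes "t \<in> slots d"
  shows "filt_eq d (slot_sum g d u) (slot_sum (Suc g) d (\<lambda>s. if s = t then delta 1 else project g (u t) (u s)))"
proof -
  obtain k b where t: "t = (k, b)" "k < d" using assms by (cases t) auto
  let ?u' = "\<lambda>s. if s = t then delta 1 else project g (u t) (u s)"
  have "filt_eq (card {..<d}) (altsum (2 * g) {..<d} (\<lambda>k. sym_prod (u (k, False)) (u (k, True))) std_mat)
     (altsum (2 * Suc g) {..<d} (\<lambda>k. sym_prod (?u' (k, False)) (?u' (k, True))) std_mat)"
    by (rule altsum_step[where k = k and v = "u t" and w = "u (k, \<not> b)"
        and x = "\<lambda>l. u (l, False)" and y = "\<lambda>l. u (l, True)"])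
      (cases b; use t in \<open>auto simp: sym_prod_commute\<close>)+
  then show ?thesis unfolding slot_sum_def by simp
qed

lemma symp_step:
  "symp (Suc g) (if s = t then delta 1 else project g (u t) (u s)) (if r = t then delta 1 else project g (u t) (u r))
    = symp g (u s) (u r)"
proof -
  have 1: "project g v x 0 = - symp g v x" "project g v x 1 = 0" "(\<lambda>i. project g v x (i + 2)) = x" for v x
    by (auto simp: project_def shift_vec_def)
  have 2: "delta 1 0 = 0" "delta 1 1 = 1" "(\<lambda>i. delta 1 (i + 2)) = (\<lambda>_. 0)"
    by (auto simp: delta_def)
  have 3: "symp g (\<lambda>_. 0) x = 0" "symp g x (\<lambda>_. 0) = 0" for x by (auto simp: symp_def)
  show ?thesis
    by (cases "s = t"; cases "r = t"; simp add: symp_Suc 1 2 3 symp_antisym[of g "u s" "u t"] del: One_nat_def add_2_eq_Suc')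
qed

text \<open>\<open>R\<close> holds the slots still to be treated; the vectors of the others live in
  the first \<open>2 * f\<close> coordinates, where the two families agree. Treating
  \<open>t\<close> prepends two coordinates: \<open>t\<close> gets basis vector 1, and the other
  slots get their negated pairing with \<open>t\<close>, which is the same in both families by the
  hypothesis on the Gram matrices. When \<open>R\<close> is empty, the families coincide.\<close>

lemma slot_sum_gram_same_genus:
  assumes "finite R" "R \<subseteq> slots d"
    and "\<And>s i. s \<in> slots d - R \<Longrightarrow> i \<ge> 2 * f \<Longrightarrow> u s i = 0 \<and> u' s i = 0"
    and "\<And>s i. s \<in> slots d \<Longrightarrow> i < 2 * f \<Longrightarrow> u s i = u' s i"
    and "\<And>s r. s \<in> slots d \<Longrightarrow> r \<in> slots d \<Longrightarrow> symp g (u s) (u r) = symp g (u' s) (u' r)"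
  shows "filt_eq d (slot_sum g d u) (slot_sum g d u')"
  using assms
proof (induction R arbitrary: f g u u' rule: finite_induct)
  case empty
  have "slot_sum g d u = slot_sum g d u'"
  proof (rule slot_sum_cong)
    fix s i assume "s \<in> slots d"
    then show "u s i = u' s i" using empty by (cases "i < 2 * f") auto
  qed
  then show ?case by simp
next
  case (insert t R)
  let ?st = "\<lambda>u s. if s = t then delta 1 else project g (u t) (u s)"
  have t: "t \<in> slots d" using insert by simp
  have "filt_eq d (slot_sum (Suc g) d (?st u)) (slot_sum (Suc g) d (?st u'))"
  proof (rule insert.IH[where f = "Suc f"])
    show "?st u s i = 0 \<and> ?st u' s i = 0" if "s \<in> slots d - R" "i \<ge> 2 * Suc f" for s i
      using that insert.prems(2)[of s "i - 2"] by (auto simp: project_def shift_vec_def delta_def)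
    show "?st u s i = ?st u' s i" if "s \<in> slots d" "i < 2 * Suc f" for s i
      using that insert.prems(3)[of s "i - 2"] insert.prems(4)[OF t that(1)]
      by (auto simp: project_def shift_vec_def)
    show "symp (Suc g) (?st u s) (?st u r) = symp (Suc g) (?st u' s) (?st u' r)"
      if "s \<in> slots d" "r \<in> slots d" for s r
      unfolding symp_step using insert.prems(4) that by blast
  qed (use insert in auto)
  then show ?case
    using slot_sum_step[OF t, of g u] slot_sum_step[OF t, of g u'] filt_eq_sym filt_eq_trans by blast
qed

lemma slot_sum_stabilize: "slot_sum (Suc g) d (\<lambda>s. shift_vec (u s)) = slot_sum g d u"
  unfolding slot_sum_def
proof (rule altsum_cong)
  fix X :: "nat set"
  let ?s = "\<lambda>k. sym_prod (u (k, False)) (u (k, True))" and ?s' = "\<lambda>k. sym_prod (shift_vec (u (k, False))) (shift_vec (u (k, True)))"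
  have s: "seifert (2 * g) (plus_sum std_mat ?s X)" by (intro seifert_plus_sum seifert_std_mat) simp
  have "plus_sum std_mat ?s' X = enlarge 0 (\<lambda>_. 0) (\<lambda>_. 0) (plus_sum std_mat ?s X)"
  proof (intro ext)
    fix i j
    show "plus_sum std_mat ?s' X i j = enlarge 0 (\<lambda>_. 0) (\<lambda>_. 0) (plus_sum std_mat ?s X) i j"
      unfolding plus_sum_def fun_cong[OF fun_cong[OF enlarge_std_mat[symmetric]], of i j]
      by (auto simp: enlarge_def sym_prod_def shift_vec_def)
  qed
  then show "S_cls (2 * Suc g) (plus_sum std_mat ?s' X) = S_cls (2 * g) (plus_sum std_mat ?s X)"
    using enlarge_reduce(2)[OF s, of 0 "\<lambda>_. 0" "\<lambda>_. 0"] by simp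
qed

lemma slot_sum_stabilize_ge:
  "g \<le> g' \<Longrightarrow> \<exists>u'. slot_sum g' d u' = slot_sum g d u \<and> (\<forall>s r. symp g' (u' s) (u' r) = symp g (u s) (u r))"
proof (induction g' rule: dec_induct)
  case (step g')
  then obtain u' where u': "slot_sum g' d u' = slot_sum g d u" "\<forall>s r. symp g' (u' s) (u' r) = symp g (u s) (u r)" by blast
  have "symp (Suc g') (shift_vec (u' s)) (shift_vec (u' r)) = symp g' (u' s) (u' r)" for s r
    by (simp add: symp_Suc shift_vec_def)
  then show ?case using u' slot_sum_stabilize[of g' d u'] by (intro exI[of _ "\<lambda>s. shift_vec (u' s)"]) auto
qed auto

theorem slot_sum_gram:
  assumes "\<And>s r. s \<in> slots d \<Longrightarrow> r \<in> slots d \<Longrightarrow> symp g (u s) (u r) = symp g' (u' s) (u' r)"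
  shows "filt_eq d (slot_sum g d u) (slot_sum g' d u')"
proof -
  obtain v where v: "slot_sum (max g g') d v = slot_sum g d u" "\<forall>s r. symp (max g g') (v s) (v r) = symp g (u s) (u r)"
    using slot_sum_stabilize_ge[of g "max g g'" d u] by auto
  obtain v' where v': "slot_sum (max g g') d v' = slot_sum g' d u'" "\<forall>s r. symp (max g g') (v' s) (v' r) = symp g' (u' s) (u' r)"
    using slot_sum_stabilize_ge[of g' "max g g'" d u'] by auto
  have "filt_eq d (slot_sum (max g g') d v) (slot_sum (max g g') d v')"
    by (rule slot_sum_gram_same_genus[where R = "slots d" and f = 0]) (use assms v v' in auto)
  then show ?thesis using v v' by simp
qed

section \<open>Reduction to the standard symplectic form\<close>

definition congr :: "nat \<Rightarrow> imat \<Rightarrow> imat \<Rightarrow> bool" where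
  "congr n A B \<longleftrightarrow> (\<exists>p. \<bar>det (fun_mat n p)\<bar> = 1 \<and>
     (\<forall>i<n. \<forall>j<n. B i j = (\<Sum>a<n. \<Sum>b<n. p i a * A a b * p j b)))"

lemma congr_iff:
  "congr n A B \<longleftrightarrow>
    (\<exists>P \<in> carrier_mat n n. \<bar>det P\<bar> = 1 \<and> fun_mat n B = P * fun_mat n A * transpose_mat P)"
proof -
  have entry: "(fun_mat n p * fun_mat n A * transpose_mat (fun_mat n p)) $$ (i, j) = (\<Sum>a<n. \<Sum>b<n. p i a * A a b * p j b)"
    if "i < n" "j < n" for p i j
    using that by (subst assoc_mult_mat[of _ n n _ n _ n])
      (simp_all add: scalar_prod_def atLeast0LessThan sum_distrib_left mult.assoc)
  have eq: "fun_mat n B = fun_mat n p * fun_mat n A * transpose_mat (fun_mat n p) \<longleftrightarrow>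
    (\<forall>i<n. \<forall>j<n. B i j = (\<Sum>a<n. \<Sum>b<n. p i a * A a b * p j b))" for p
    unfolding mat_eq_iff by (auto simp: entry simp del: index_mult_mat(1))
  show ?thesis
    unfolding congr_def eq[symmetric] using fun_mat_carrier fun_mat_of_mat by metis
qed

lemma congr_trans:
  assumes "congr n A B" "congr n B C"
  shows "congr n A C"
proof -
  obtain P where P: "P \<in> carrier_mat n n" "\<bar>det P\<bar> = 1" "fun_mat n B = P * fun_mat n A * transpose_mat P"
    using assms(1) unfolding congr_iff by blast
  obtain Q where Q: "Q \<in> carrier_mat n n" "\<bar>det Q\<bar> = 1" "fun_mat n C = Q * fun_mat n B * transpose_mat Q"
    using assms(2) unfolding congr_iff by blast
  have "fun_mat n C = (Q * P) * fun_mat n A * transpose_mat (Q * P)"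
    using P Q by (simp add: transpose_mult[of _ n n _ n] assoc_mult_mat[of _ n n _ n _ n] mult_carrier_mat[of _ n n _ n])
  moreover have "\<bar>det (Q * P)\<bar> = 1" using P Q by (simp add: det_mult[of _ n] abs_mult)
  ultimately show ?thesis unfolding congr_iff using P(1) Q(1) by (meson mult_carrier_mat)
qed

lemma congr_refl: "congr n A A"
  unfolding congr_iff by (intro bexI[of _ "1\<^sub>m n"]) auto

definition skew :: "nat \<Rightarrow> imat \<Rightarrow> bool" where
  "skew n A \<longleftrightarrow> (\<forall>i<n. \<forall>j<n. A i j = - A j i)"

lemma skewD: "skew n A \<Longrightarrow> i < n \<Longrightarrow> j < n \<Longrightarrow> A i j = - A j i"
  unfolding skew_def by blast

lemma congr_skew:
  assumes "congr n A B" "skew n A"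
  shows "skew n B"
  unfolding skew_def
proof (intro allI impI)
  obtain p where p: "\<And>i j. i < n \<Longrightarrow> j < n \<Longrightarrow> B i j = (\<Sum>a<n. \<Sum>b<n. p i a * A a b * p j b)"
    using assms(1) unfolding congr_def by blast
  fix i j assume ij: "i < n" "j < n"
  have "B j i = (\<Sum>a<n. \<Sum>b<n. p j b * A b a * p i a)"
    unfolding p[OF ij(2,1)] by (rule sum.swap)
  also have "\<dots> = (\<Sum>a<n. \<Sum>b<n. - (p i a * A a b * p j b))"
  proof (intro sum.cong HOL.refl)
    fix a b assume "a \<in> {..<n}" "b \<in> {..<n}"
    then have "A b a = - A a b" using skewD[OF assms(2), of b a] by simp
    then show "p j b * A b a * p i a = - (p i a * A a b * p j b)" by simp
  qed
  finally show "B i j = - B j i" by (simp add: p[OF ij] sum_negf)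
qed

lemma congr_det:
  assumes "congr n A B"
  shows "\<bar>det (fun_mat n B)\<bar> = \<bar>det (fun_mat n A)\<bar>"
proof -
  obtain P where P: "P \<in> carrier_mat n n" "\<bar>det P\<bar> = 1" "fun_mat n B = P * fun_mat n A * transpose_mat P"
    using assms unfolding congr_iff by blast
  then show ?thesis by (simp add: det_mult[of _ n] det_transpose[of _ n] abs_mult)
qed

text \<open>Multiplying row \<open>i\<close> by \<open>e i\<close> and adding \<open>c i\<close>
  times row \<open>r\<close>, for all \<open>i\<close> and likewise for columns, covers sign
  changes, single additions and the clearing of a whole row. As \<open>c r = 0\<close>, row
  \<open>r\<close> of the transformation matrix is diagonal, and expanding along it leaves a
  diagonal minor.\<close>

lemma congr_elementary:
  assumes r: "r < n" "c r = 0" and e: "\<And>i. \<bar>e i\<bar> = 1"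
    and B: "\<And>i j. i < n \<Longrightarrow> j < n \<Longrightarrow>
      B i j = e i * e j * A i j + e i * c j * A i r + c i * e j * A r j + c i * c j * A r r"
  shows "congr n A B"
  unfolding congr_def
proof (intro exI[of _ "\<lambda>i a. e i * delta i a + c i * delta r a"] conjI allI impI)
  let ?p = "\<lambda>i a. e i * delta i a + c i * delta r a"
  have psum: "(\<Sum>a<n. ?p i a * f a) = e i * f i + c i * f r" if "i < n" for i f
  proof -
    have "(\<Sum>a<n. delta j a * f a) = f j" if "j < n" for j
      by (subst sum_lessThan_unique[of j]) (use that in \<open>auto simp: delta_def\<close>)
    then show ?thesis
      using that r by (simp add: distrib_right sum.distrib sum_distrib_left[symmetric] mult.assoc)
  qed
  obtain k where k: "n = Suc k" using r by (cases n) auto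
  let ?D = "mat_delete (fun_mat n ?p) r r"
  have D: "?D \<in> carrier_mat k k" using k by (auto intro: mat_delete_carrier)
  have De: "?D $$ (i, j) = (if i = j then e (if i < r then i else Suc i) else 0)" if "i < k" "j < k" for i j
    using that k r by (auto simp: mat_delete_def delta_def)
  have "det (fun_mat n ?p) = (\<Sum>j<n. fun_mat n ?p $$ (r, j) * cofactor (fun_mat n ?p) r j)"
    by (rule laplace_expansion_row) (use r in auto)
  also have "\<dots> = fun_mat n ?p $$ (r, r) * cofactor (fun_mat n ?p) r r"
    by (rule sum_lessThan_unique) (use r in \<open>auto simp: delta_def\<close>)
  also have "\<dots> = e r * det ?D"
    using r by (simp add: cofactor_def delta_def)
  also have "det ?D = prod_list (diag_mat ?D)"
  proof (rule det_upper_triangular[OF upper_triangularI D])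
    fix i j assume "j < i" "i < dim_row ?D"
    then have "i < k" "j < k" "i \<noteq> j" using carrier_matD(1)[OF D] by linarith+
    then show "?D $$ (i, j) = 0" by (simp only: De if_False)
  qed
  also have "\<bar>e r * prod_list (diag_mat ?D)\<bar> = 1"
  proof -
    have "\<bar>prod_list (map f [0..<m])\<bar> = 1" if "\<And>i. i < m \<Longrightarrow> \<bar>f i\<bar> = 1" for m and f :: "nat \<Rightarrow> int"
      using that by (induction m) (simp_all add: abs_mult)
    from this[of k "\<lambda>i. ?D $$ (i, i)"] have "\<bar>prod_list (diag_mat ?D)\<bar> = 1"
      unfolding diag_mat_def carrier_matD(1)[OF D] by (simp only: De e simp_thms if_True)
    then show ?thesis by (simp add: abs_mult e)
  qed
  finally show "\<bar>det (fun_mat n ?p)\<bar> = 1" .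
  fix i j assume ij: "i < n" "j < n"
  have "(\<Sum>a<n. \<Sum>b<n. ?p i a * A a b * ?p j b) = (\<Sum>a<n. ?p i a * (\<Sum>b<n. ?p j b * A a b))"
    by (simp add: sum_distrib_left mult_ac)
  also have "\<dots> = e i * (e j * A i j + c j * A i r) + c i * (e j * A r j + c j * A r r)"
    by (simp only: psum[OF ij(1)] psum[OF ij(2)])
  finally show "B i j = (\<Sum>a<n. \<Sum>b<n. ?p i a * A a b * ?p j b)"
    using B[OF ij] by (simp add: algebra_simps)
qed

text \<open>Only row 0 is recorded: for nonzero \<open>k\<close> it changes through the column
  operation alone, and the reduction of the first row needs no more.\<close>

lemma congr_add_row:
  assumes "k < n" "r < n" "k \<noteq> r" and skew: "skew n A"
  obtains B where "congr n A B" "\<And>l. k \<noteq> 0 \<Longrightarrow> B 0 l = A 0 l + (if l = k then c * A 0 r else 0)"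
proof -
  let ?c = "\<lambda>i. if i = k then c else 0"
  let ?B = "\<lambda>i j. A i j + ?c j * A i r + ?c i * A r j + ?c i * ?c j * A r r"
  have "congr n A ?B"
    by (rule congr_elementary[of r n ?c "\<lambda>_. 1"]) (use assms in auto)
  then show thesis by (rule that) auto
qed

lemma det_row_expansion:
  assumes "0 < n"
  shows "det (fun_mat n B) = (\<Sum>j<n. B 0 j * cofactor (fun_mat n B) 0 j)"
  using laplace_expansion_row[OF fun_mat_carrier assms, of B] assms by simp

lemma skew_diag: "skew n A \<Longrightarrow> i < n \<Longrightarrow> A i i = 0"
  unfolding skew_def by (metis equal_neg_zero)

text \<open>Euclid's algorithm in the form of a minimum: if the sum of absolute values in row 0 is
  least within the congruence class, this row cannot have two nonzero entries. The single one left
  divides the determinant and is a unit; it is off the diagonal by skew symmetry.\<close>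

lemma skew_first_row:
  assumes A: "skew n A" "\<bar>det (fun_mat n A)\<bar> = 1" and n: "n > 0"
  shows "n \<ge> 2" "\<exists>B. congr n A B \<and> (\<forall>j<n. B 0 j = (if j = 1 then - 1 else 0))"
proof -
  define w where "w B = (\<Sum>j<n. nat \<bar>B 0 j\<bar>)" for B :: imat
  obtain B where B: "congr n A B" and min: "\<And>B'. congr n A B' \<Longrightarrow> w B \<le> w B'"
    using ex_has_least_nat[of "congr n A" A w] congr_refl by blast
  have sB: "skew n B" and dB: "\<bar>det (fun_mat n B)\<bar> = 1"
    using congr_skew[OF B A(1)] congr_det[OF B] A(2) by auto
  obtain j where j: "j < n" "B 0 j \<noteq> 0"
  proof (rule ccontr)
    assume "\<not> thesis"
    then have "\<And>j. j < n \<Longrightarrow> B 0 j = 0" using that by blast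
    then have "det (fun_mat n B) = 0" unfolding det_row_expansion[OF n] by (intro sum.neutral) auto
    then show False using dB by simp
  qed
  have j0: "j \<noteq> 0" using j skew_diag[OF sB n] by metis
  show n2: "n \<ge> 2" using j j0 by simp
  \<comment> \<open>Applied to a pair of nonzero entries in both orders, this strict inequality is
    contradictory.\<close>
  have less: "\<bar>B 0 i\<bar> < \<bar>B 0 k\<bar>" if ik: "i < n" "k < n" "i \<noteq> k" "B 0 i \<noteq> 0" "B 0 k \<noteq> 0" for i k
  proof (rule ccontr)
    assume le: "\<not> \<bar>B 0 i\<bar> < \<bar>B 0 k\<bar>"
    have i0: "i \<noteq> 0" using ik skew_diag[OF sB n] by metis
    define c where "c = - (sgn (B 0 i) * sgn (B 0 k))"
    obtain B' where B': "congr n B B'" "\<And>l. B' 0 l = B 0 l + (if l = i then c * B 0 k else 0)"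
      using congr_add_row[OF ik(1-3) sB, of c] i0 by metis
    have lt: "\<bar>B' 0 i\<bar> < \<bar>B 0 i\<bar>"
      using le ik unfolding B'(2) c_def by (auto simp: sgn_if)
    have "w B' < w B"
      unfolding w_def by (rule sum_strict_mono_ex1) (use B'(2) lt ik(1) in \<open>auto intro!: bexI[of _ i]\<close>)
    then show False using min[OF congr_trans[OF B B'(1)]] by simp
  qed
  have uniq: "B 0 i = 0" if "i < n" "i \<noteq> j" for i
    using less[OF that(1) j(1) that(2)] less[OF j(1) that(1)] that j by force
  have "det (fun_mat n B) = B 0 j * cofactor (fun_mat n B) 0 j"
    unfolding det_row_expansion[OF n] by (rule sum_lessThan_unique) (use j uniq in auto)
  then have unit: "\<bar>B 0 j\<bar> = 1"
    using dB abs_zmult_eq_1 by metis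
  show "\<exists>B. congr n A B \<and> (\<forall>j<n. B 0 j = (if j = 1 then - 1 else 0))"
  proof (cases "j = 1")
    case True
    let ?e = "\<lambda>i. if i = 1 then - B 0 1 else 1"
    let ?C = "\<lambda>i j. ?e i * ?e j * B i j"
    have "congr n B ?C"
      by (rule congr_elementary[of 0 n "\<lambda>_. 0" ?e]) (use n unit True in auto)
    moreover have "?C 0 l = (if l = 1 then - 1 else 0)" if "l < n" for l
      using uniq that unit True by (auto simp: abs_if split: if_splits)
    ultimately show ?thesis using congr_trans[OF B] by blast
  next
    case False
    \<comment> \<open>Column 1 of row 0 is 0 and \<open>B 0 j\<close> is its own inverse: one
      addition creates -1 in column 1, and a second one uses it to clear column
      \<open>j\<close>.\<close>
    obtain C where C: "congr n B C" "\<And>l. C 0 l = B 0 l + (if l = 1 then - B 0 j * B 0 j else 0)"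
      using congr_add_row[of 1 n j B "- B 0 j"] n2 j(1) False sB by (metis One_nat_def Suc_1 Suc_le_lessD zero_neq_one)
    have "B 0 j * B 0 j = 1" using unit by (auto simp: abs_if split: if_splits)
    then have C': "C 0 l = B 0 l + (if l = 1 then - 1 else 0)" for l using C(2) by simp
    obtain E where E: "congr n C E" "\<And>l. E 0 l = C 0 l + (if l = j then B 0 j * C 0 1 else 0)"
      using congr_add_row[of j n 1 C "B 0 j"] n2 j(1) False j0 congr_skew[OF C(1) sB]
      by (metis Suc_1 Suc_le_lessD)
    have "E 0 l = (if l = 1 then - 1 else 0)" if "l < n" for l
      using uniq[OF that] uniq[of 1] n2 False by (auto simp: E(2) C')
    then show ?thesis using congr_trans[OF congr_trans[OF B C(1)] E(1)] by blast
  qed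
qed

lemma congr_embed:
  assumes rest: "congr n (\<lambda>i j. A (i + 2) (j + 2)) (\<lambda>i j. B (i + 2) (j + 2))"
    and eq: "\<And>i j. i < 2 \<Longrightarrow> A i j = B i j" "\<And>i j. j < 2 \<Longrightarrow> A i j = B i j"
    and zero: "\<And>i j. i < 2 \<Longrightarrow> 2 \<le> j \<Longrightarrow> j < n + 2 \<Longrightarrow> A i j = 0"
      "\<And>i j. j < 2 \<Longrightarrow> 2 \<le> i \<Longrightarrow> i < n + 2 \<Longrightarrow> A i j = 0"
  shows "congr (n + 2) A B"
proof -
  obtain p where p: "\<bar>det (fun_mat n p)\<bar> = 1"
    "\<And>i j. i < n \<Longrightarrow> j < n \<Longrightarrow> B (i + 2) (j + 2) = (\<Sum>a<n. \<Sum>b<n. p i a * A (a + 2) (b + 2) * p j b)"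
    using rest unfolding congr_def by blast
  define q where "q i a = (if i < 2 \<or> a < 2 then delta i a else p (i - 2) (a - 2))" for i a
  have "fun_mat (n + 2) q = four_block_mat (1\<^sub>m 2) (0\<^sub>m 2 n) (0\<^sub>m n 2) (fun_mat n p)"
    by (rule eq_matI) (auto simp: q_def delta_def)
  then have "det (fun_mat (n + 2) q) = det (fun_mat n p)"
    by (simp add: det_four_block_mat_upper_right_zero[of _ 2 _ n])
  moreover have "B i j = (\<Sum>a<n + 2. \<Sum>b<n + 2. q i a * A a b * q j b)" if "i < n + 2" "j < n + 2" for i j
  proof -
    have shift: "(\<Sum>a<n + 2. f a) = f 0 + f 1 + (\<Sum>a<n. f (a + 2))" for f :: "nat \<Rightarrow> int"
      by (induction n) (auto simp: add_ac)
    have qs: "(\<Sum>a<n + 2. q i a * f a) = (if i < 2 then f i else \<Sum>a<n. p (i - 2) a * f (a + 2))"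
      if "i < n + 2" for i f
      unfolding shift using that by (auto simp: q_def delta_def less_2_cases_iff)
    have "(\<Sum>a<n + 2. \<Sum>b<n + 2. q i a * A a b * q j b) = (\<Sum>a<n + 2. q i a * (\<Sum>b<n + 2. q j b * A a b))"
      by (simp only: sum_distrib_left mult_ac)
    also have "\<dots> = B i j"
    proof (cases "i < 2 \<or> j < 2")
      case True
      then show ?thesis
        by (simp only: qs[OF that(1)] qs[OF that(2)]) (use eq zero that in \<open>auto intro!: sum.neutral\<close>)
    next
      case False
      then have "B i j = (\<Sum>a<n. \<Sum>b<n. p (i - 2) a * A (a + 2) (b + 2) * p (j - 2) b)"
      proof -
        have "i - 2 < n" "j - 2 < n" using that False by linarith+
        then show ?thesis
          using p(2)[of "i - 2" "j - 2"] False by (simp del: add_2_eq_Suc')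
      qed
      then show ?thesis
        using False by (simp only: qs[OF that(1)] qs[OF that(2)] if_False) (simp add: sum_distrib_left mult_ac)
    qed
    finally show ?thesis by simp
  qed
  ultimately show ?thesis
    unfolding congr_def using p(1) by (intro exI[of _ q]) auto
qed

text \<open>Hyperbolic planes are split off one by one. Once row 0 is standard, its multiples clear
  row 1 beyond column 1 without disturbing row 0, because \<open>B 0 0 = 0\<close>; the
  complementary block is unimodular again by \<open>det_enlargement\<close>.\<close>

theorem skew_unimodular_standard:
  "skew n A \<Longrightarrow> \<bar>det (fun_mat n A)\<bar> = 1 \<Longrightarrow> congr n A (\<lambda>i j. std_mat i j - std_mat j i)"
proof (induction n arbitrary: A rule: less_induct)
  case (less n)
  show ?case
  proof (cases "n = 0")
    case True
    then show ?thesis by (simp add: congr_def)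
  next
    case False
    then have "n \<ge> 2" using skew_first_row(1)[OF less.prems] by simp
    then obtain k where k: "n = k + 2" by (metis le_add_diff_inverse2)
    obtain B where B: "congr n A B" "\<And>j. j < n \<Longrightarrow> B 0 j = (if j = 1 then - 1 else 0)"
      using skew_first_row(2)[OF less.prems] False by blast
    have sB: "skew n B" using congr_skew B less.prems by blast
    let ?c = "\<lambda>i. if i \<ge> 2 then - B 1 i else 0"
    define C where "C i j = B i j + ?c j * B i 0 + ?c i * B 0 j + ?c i * ?c j * B 0 0" for i j
    have BC: "congr n B C"
      by (rule congr_elementary[of 0 n ?c "\<lambda>_. 1"]) (use k in \<open>auto simp: C_def\<close>)
    have sC: "skew n C" using congr_skew BC sB by blast
    have dC: "\<bar>det (fun_mat n C)\<bar> = 1" using congr_det B(1) BC less.prems by metis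
    have "B 1 0 = - B 0 1" by (rule skewD[OF sB]) (use k in auto)
    then have B10: "B 1 0 = 1" using B(2)[of 1] k by simp
    have C0: "C 0 j = (if j = 1 then - 1 else 0)" if "j < n" for j
      using B(2)[OF that] skew_diag[OF sB, of 0] k by (simp add: C_def)
    have C1: "C 1 j = (if j = 0 then 1 else 0)" if "j < n" for j
    proof -
      have "j = 0 \<or> j = 1 \<or> j \<ge> 2" by auto
      then show ?thesis
        using B10 skew_diag[OF sB, of 0] skew_diag[OF sB, of 1] k by (auto simp: C_def)
    qed
    have C0': "C j 0 = (if j = 1 then 1 else 0)" and C1': "C j 1 = (if j = 0 then - 1 else 0)" if "j < n" for j
      using skewD[OF sC that, of 0] skewD[OF sC that, of 1] C0[OF that] C1[OF that] k by auto
    let ?R = "\<lambda>i j. C (i + 2) (j + 2)"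
    have "det (fun_mat n C) = - (C 0 1 * C 1 0 * det (fun_mat k ?R))"
      unfolding k fun_mat_def by (rule det_enlargement) (use C0 C0' k in auto)
    then have "\<bar>det (fun_mat k ?R)\<bar> = 1" using dC C0[of 1] C1[of 0] k by simp
    moreover have "skew k ?R" unfolding skew_def by (intro allI impI skewD[OF sC]) (use k in auto)
    ultimately have R: "congr k ?R (\<lambda>i j. std_mat i j - std_mat j i)" using less.IH[of k] k by simp
    \<comment> \<open>Beyond size \<open>n\<close> this copies \<open>C\<close>, because
      \<open>congr_embed\<close> asks for equality of the first two rows and columns at all
      indices.\<close>
    let ?O = "\<lambda>i j. if i < n \<and> j < n then std_mat i j - std_mat j i else C i j"
    have J2: "std_mat (i + 2) (j + 2) = std_mat i j" for i j by (simp add: std_mat_def)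
    have "congr (k + 2) C ?O"
    proof (rule congr_embed)
      show "congr k ?R (\<lambda>i j. ?O (i + 2) (j + 2))"
        using R unfolding congr_def by (simp add: J2 k del: add_2_eq_Suc')
      show "C i j = ?O i j" if "i < 2" for i j
        using that C0[of j] C1[of j] by (auto simp: less_2_cases_iff std_mat_def)
      show "C i j = ?O i j" if "j < 2" for i j
        using that C0'[of i] C1'[of i] by (auto simp: less_2_cases_iff std_mat_def)
      show "C i j = 0" if "i < 2" "2 \<le> j" "j < k + 2" for i j
        using that C0[of j] C1[of j] k by (auto simp: less_2_cases_iff)
      show "C i j = 0" if "j < 2" "2 \<le> i" "i < k + 2" for i j
        using that C0'[of i] C1'[of i] k by (auto simp: less_2_cases_iff)
    qed
    then have "congr n C (\<lambda>i j. std_mat i j - std_mat j i)"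
      unfolding congr_def by (simp add: k)
    then show ?thesis using congr_trans B(1) BC by blast
  qed
qed

section \<open>Slot sums generate each step of the filtration modulo the next\<close>

lemma filt_eq_scale: "filt_eq d x y \<Longrightarrow> filt_eq d (pm_scale c x) (pm_scale c y)"
  unfolding filt_eq_def using S_filt_scale[of "x - y"] by (simp add: pm.scale_right_diff_distrib)

lemma altsum_scale_all:
  assumes K: "finite K" "finite U" "U \<subseteq> K" and sym: "\<And>k. k \<in> K \<Longrightarrow> symm n (t k) \<and> symm n (t' k)"
    and step: "\<And>k s. k \<in> K \<Longrightarrow> (\<And>l. l \<in> K \<Longrightarrow> symm n (s l)) \<Longrightarrow>
      filt_eq (card K) (altsum n K (s(k := t' k)) m) (pm_scale c (altsum n K (s(k := t k)) m))"
  shows "filt_eq (card K) (altsum n K (\<lambda>k. if k \<in> U then t' k else t k) m)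
    (pm_scale (c ^ card U) (altsum n K t m))"
  using K(2,3)
proof (induction U rule: finite_induct)
  case empty
  then show ?case by simp
next
  case (insert k U)
  let ?s = "\<lambda>U k. if k \<in> U then t' k else t k"
  have 1: "?s (insert k U) = (?s U)(k := t' k)" and 2: "(?s U)(k := t k) = ?s U" using insert.hyps by auto
  have "filt_eq (card K) (altsum n K ((?s U)(k := t' k)) m) (pm_scale c (altsum n K ((?s U)(k := t k)) m))"
    by (rule step) (use insert sym in auto)
  then have "filt_eq (card K) (altsum n K (?s (insert k U)) m) (pm_scale c (altsum n K (?s U) m))"
    unfolding 1 2 .
  also have "filt_eq (card K) \<dots> (pm_scale c (pm_scale (c ^ card U) (altsum n K t m)))"
    using insert by (intro filt_eq_scale) auto
  finally show ?case using insert.hyps by simp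
qed

text \<open>Under the congruence that standardizes \<open>A\<close>, diagonal units become squares
  \<open>v v^t\<close> of columns \<open>v\<close> of \<open>p\<close>, and
  \<open>sym_prod v v\<close> is twice such a square. Doubling all directions multiplies the sum by
  \<open>2 ^ d\<close> modulo the next step, and this factor is divided out. Quantifying over
  subspaces \<open>T\<close> expresses generation without forming the quotient.\<close>

lemma S_filt_generated:
  assumes T: "pm.subspace T" "S_filt (Suc d) \<subseteq> T" "\<And>g u. slot_sum g d u \<in> T"
  shows "S_filt d \<subseteq> T"
  unfolding S_filt_def
proof (rule pm.span_minimal[OF _ T(1)], clarify)
  have filt_eq_T: "filt_eq d x y \<Longrightarrow> y \<in> T \<Longrightarrow> x \<in> T" for x y
    using T(2) pm.subspace_add[OF T(1), of y "x - y"] by (auto simp: filt_eq_def)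
  fix M i assume M: "M \<in> seifert_mats" and i: "\<forall>k<d. i k < dim_row M"
  define n where "n = dim_row M"
  define m where "m = (\<lambda>i j. M $$ (i, j))"
  have Mm: "M = fun_mat n m"
    using M by (intro eq_matI) (auto simp: n_def m_def seifert_mats_def)
  have m: "seifert n m" using M by (simp add: seifert_def Mm)
  then have even: "even n" and dm: "\<bar>det (fun_mat n (\<lambda>i j. m i j - m j i))\<bar> = 1" by (auto simp: seifert_iff)
  then obtain g where g: "n = 2 * g" by blast
  have "skew n (\<lambda>i j. m i j - m j i)" by (simp add: skew_def)
  from skew_unimodular_standard[OF this dm] obtain p where p: "\<bar>det (fun_mat n p)\<bar> = 1"
    "\<And>i j. i < n \<Longrightarrow> j < n \<Longrightarrow> std_mat i j - std_mat j i = (\<Sum>a<n. \<Sum>b<n. p i a * (m a b - m b a) * p j b)"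
    unfolding congr_def by blast
  define m' where "m' i j = (\<Sum>a<n. \<Sum>b<n. p i a * m a b * p j b)" for i j
  define t where "t k = (\<lambda>a b. p a (i k) * p b (i k))" for k
  have anti: "m' a b - m' b a = std_mat a b - std_mat b a" if "a < n" "b < n" for a b
  proof -
    have "m' b a = (\<Sum>c<n. \<Sum>e<n. p a c * m e c * p b e)"
      unfolding m'_def by (subst sum.swap) (simp add: mult_ac)
    then have "m' a b - m' b a = (\<Sum>c<n. \<Sum>e<n. p a c * m c e * p b e) - (\<Sum>c<n. \<Sum>e<n. p a c * m e c * p b e)"
      by (simp only: m'_def[of a b])
    then show ?thesis using p(2)[OF that] by (simp add: sum_subtractf algebra_simps)
  qed
  have sJ: "seifert n std_mat" using g seifert_std_mat by simp
  have st: "symm n (t k)" for k by (simp add: t_def symm_def)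
  have "alternating_sum M d i = altsum n {..<d} (\<lambda>k. unit_mat (i k)) m"
    by (simp add: Mm alternating_sum_altsum)
  also have "\<dots> = altsum n {..<d} t m'"
  proof (rule altsum_congruence[symmetric, OF _ m])
    show "unimodular_mat (fun_mat n p)" using p(1) by (auto simp: unimodular_mat_def)
    show "t k a b = (\<Sum>c<n. \<Sum>e<n. p a c * unit_mat (i k) c e * p b e)"
      if "k \<in> {..<d}" "a < n" "b < n" for k a b
    proof -
      have "i k < n" using i that by (simp add: n_def)
      then show ?thesis
        by (subst sum_lessThan_unique[of "i k"], simp, simp add: unit_mat_def,
            subst sum_lessThan_unique[of "i k"]) (auto simp: unit_mat_def t_def)
    qed
  qed (auto simp: symm_def unit_mat_def m'_def)
  finally have 1: "filt_eq d (altsum n {..<d} t std_mat) (alternating_sum M d i)"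
    using altsum_base_change[of "{..<d}" n std_mat t m'] sJ st anti by simp
  have "(\<lambda>k. if k \<in> {..<d} then (\<lambda>i j. t k i j + t k i j) else t k) k =
    (\<lambda>k. sym_prod (\<lambda>a. p a (i k)) (\<lambda>a. p a (i k))) k" if "k < d" for k
    using that by (auto simp: t_def sym_prod_def fun_eq_iff)
  then have "altsum n {..<d} (\<lambda>k. if k \<in> {..<d} then (\<lambda>i j. t k i j + t k i j) else t k) std_mat =
    slot_sum g d (\<lambda>(k, b) a. p a (i k))"
    unfolding slot_sum_def g by (intro altsum_cong_entries) auto
  moreover have "filt_eq (card {..<d}) (altsum n {..<d} (\<lambda>k. if k \<in> {..<d} then (\<lambda>i j. t k i j + t k i j) else t k) std_mat)
      (pm_scale (2 ^ card {..<d}) (altsum n {..<d} t std_mat))"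
  proof (rule altsum_scale_all)
    fix k s assume k: "k \<in> {..<d}" and s: "\<And>l. l \<in> {..<d} \<Longrightarrow> symm n (s l)"
    have "filt_eq (card {..<d}) (altsum n {..<d} (s(k := \<lambda>i j. t k i j + t k i j)) std_mat)
        (altsum n {..<d} (s(k := t k)) std_mat + altsum n {..<d} (s(k := t k)) std_mat)"
      by (rule altsum_multilinear) (use k s sJ st in auto)
    then show "filt_eq (card {..<d}) (altsum n {..<d} (s(k := \<lambda>i j. t k i j + t k i j)) std_mat)
        (pm_scale 2 (altsum n {..<d} (s(k := t k)) std_mat))"
      by (simp add: pm.scale_left_distrib[of 1 1, simplified])
  qed (use st in \<open>auto simp: symm_def\<close>)
  ultimately have "filt_eq d (slot_sum g d (\<lambda>(k, b) a. p a (i k))) (pm_scale (2 ^ d) (altsum n {..<d} t std_mat))"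
    by simp
  from filt_eq_scale[OF filt_eq_sym[OF this], of "1 / 2 ^ d"]
  have "filt_eq d (altsum n {..<d} t std_mat) (pm_scale (1 / 2 ^ d) (slot_sum g d (\<lambda>(k, b) a. p a (i k))))"
    by simp
  then show "alternating_sum M d i \<in> T"
    using 1 T(1,3) filt_eq_T filt_eq_sym by (meson pm.subspace_scale)
qed

section \<open>Alternating sums as functions of a skew matrix\<close>

type_synonym slot = "nat \<times> bool"

definition skewS :: "nat \<Rightarrow> (slot \<Rightarrow> slot \<Rightarrow> int) \<Rightarrow> bool" where
  "skewS d G \<longleftrightarrow> (\<forall>s\<in>slots d. \<forall>r\<in>slots d. G s r = - G r s)"

lemma skewS_D: "skewS d G \<Longrightarrow> s \<in> slots d \<Longrightarrow> r \<in> slots d \<Longrightarrow> G s r = - G r s"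
  unfolding skewS_def by blast

lemma skewS_diag: "skewS d G \<Longrightarrow> s \<in> slots d \<Longrightarrow> G s s = 0"
  using skewS_D[of d G s s] by simp

definition slot_index :: "slot \<Rightarrow> nat" where
  "slot_index s = 2 * fst s + of_bool (snd s)"

definition slot_of :: "nat \<Rightarrow> slot" where
  "slot_of i = (i div 2, odd i)"

lemma slot_of_index [simp]: "slot_of (slot_index s) = s"
  by (cases s) (simp add: slot_of_def slot_index_def)

lemma slot_index_less: "s \<in> slots d \<Longrightarrow> slot_index s < 2 * d"
  by (cases s) (auto simp: slot_index_def)

text \<open>Each of the \<open>2 * d\<close> slots owns one hyperbolic pair of coordinates. The odd
  coordinate of its pair marks the slot, and even coordinates hold, in triangular fashion, its
  entries of \<open>G\<close> against slots of smaller index. Hence every skew integer matrix is a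
  Gram matrix in genus \<open>2 * d\<close>.\<close>

definition realize :: "(slot \<Rightarrow> slot \<Rightarrow> int) \<Rightarrow> slot \<Rightarrow> nat \<Rightarrow> int" where
  "realize G s c =
    (if odd c then of_bool (c div 2 = slot_index s)
     else if c div 2 < slot_index s then - G (slot_of (c div 2)) s else 0)"

lemma symp_realize:
  assumes G: "skewS d G" and s: "s \<in> slots d" and r: "r \<in> slots d"
  shows "symp (2 * d) (realize G s) (realize G r) = G s r"
proof -
  have *: "symp (2 * d) (realize G s) (realize G r) =
      realize G s (2 * slot_index r) - realize G r (2 * slot_index s)"
  proof -
    have "symp (2 * d) (realize G s) (realize G r) =
      (\<Sum>i<2 * d. realize G s (2 * i) * of_bool (i = slot_index r)) -
      (\<Sum>i<2 * d. of_bool (i = slot_index s) * realize G r (2 * i))"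
      unfolding symp_def by (simp add: sum_subtractf realize_def)
    also have "(\<Sum>i<2 * d. realize G s (2 * i) * of_bool (i = slot_index r)) = realize G s (2 * slot_index r)"
      by (subst sum_lessThan_unique[of "slot_index r"]) (use slot_index_less[OF r] in auto)
    also have "(\<Sum>i<2 * d. of_bool (i = slot_index s) * realize G r (2 * i)) = realize G r (2 * slot_index s)"
      by (subst sum_lessThan_unique[of "slot_index s"]) (use slot_index_less[OF s] in auto)
    finally show ?thesis .
  qed
  have "slot_index s = slot_index r \<Longrightarrow> s = r" by (metis slot_of_index)
  then consider "s = r" | "slot_index s < slot_index r" | "slot_index r < slot_index s" by force
  then show ?thesis
  proof cases
    case 1
    then show ?thesis using skewS_diag[OF G s] by simp
  next
    case 2
    then show ?thesis unfolding * by (simp add: realize_def)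
  next
    case 3
    then show ?thesis unfolding * using skewS_D[OF G s r] by (simp add: realize_def)
  qed
qed

definition gram_sum :: "nat \<Rightarrow> (slot \<Rightarrow> slot \<Rightarrow> int) \<Rightarrow> S_class \<Rightarrow>\<^sub>0 rat" where
  "gram_sum d G = slot_sum (2 * d) d (realize G)"

lemma slot_sum_gram_sum:
  assumes "\<And>s r. s \<in> slots d \<Longrightarrow> r \<in> slots d \<Longrightarrow> symp g (u s) (u r) = G s r"
  shows "filt_eq d (slot_sum g d u) (gram_sum d G)"
  unfolding gram_sum_def
proof (rule slot_sum_gram)
  have "skewS d G"
    unfolding skewS_def using assms symp_antisym by metis
  then show "symp g (u s) (u r) = symp (2 * d) (realize G s) (realize G r)" if "s \<in> slots d" "r \<in> slots d" for s r
    using that by (simp add: assms symp_realize)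
qed

lemma gram_sum_cong:
  assumes "skewS d G" "\<And>s r. s \<in> slots d \<Longrightarrow> r \<in> slots d \<Longrightarrow> G s r = G' s r"
  shows "filt_eq d (gram_sum d G) (gram_sum d G')"
  unfolding gram_sum_def[of d G] by (rule slot_sum_gram_sum) (simp add: symp_realize assms)

lemma slot_sum_add:
  assumes "t \<in> slots d"
  shows "filt_eq d (slot_sum g d (u(t := \<lambda>c. x c + y c))) (slot_sum g d (u(t := x)) + slot_sum g d (u(t := y)))"
proof -
  obtain k b where t: "t = (k, b)" "k < d" using assms by (cases t) auto
  let ?s = "\<lambda>u k. sym_prod (u (k, False)) (u (k, True)) :: imat" and ?w = "u (k, \<not> b)"
  have 1: "?s (u(t := z)) = (?s u)(k := sym_prod z ?w)" for z
    using t by (cases b) (auto simp: fun_eq_iff sym_prod_def)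
  have 2: "sym_prod (\<lambda>c. x c + y c) ?w = (\<lambda>i j. sym_prod x ?w i j + sym_prod y ?w i j)"
    by (auto simp: fun_eq_iff sym_prod_def algebra_simps)
  have "filt_eq (card {..<d}) (altsum (2 * g) {..<d} ((?s u)(k := \<lambda>i j. sym_prod x ?w i j + sym_prod y ?w i j)) std_mat)
    (altsum (2 * g) {..<d} ((?s u)(k := sym_prod x ?w)) std_mat + altsum (2 * g) {..<d} ((?s u)(k := sym_prod y ?w)) std_mat)"
    by (rule altsum_multilinear) (use t seifert_std_mat in auto)
  then show ?thesis unfolding slot_sum_def 1 2 by simp
qed

lemma slot_sum_zero:
  assumes "t \<in> slots d" "\<And>c. c < 2 * g \<Longrightarrow> u t c = 0"
  shows "slot_sum g d u = 0"
  unfolding slot_sum_def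
  by (rule altsum_zero[of _ "fst t"]) (use assms in \<open>cases t; cases "snd t"; auto simp: sym_prod_def\<close>)+

definition set_row :: "(slot \<Rightarrow> slot \<Rightarrow> int) \<Rightarrow> slot \<Rightarrow> (slot \<Rightarrow> int) \<Rightarrow> slot \<Rightarrow> slot \<Rightarrow> int" where
  "set_row G i \<rho> s r = (if s = i then (if r = i then 0 else \<rho> r) else if r = i then - \<rho> s else G s r)"

lemma skewS_set_row: "skewS d G \<Longrightarrow> skewS d (set_row G i \<rho>)"
  unfolding skewS_def[of d "set_row G i \<rho>"]
proof (intro ballI)
  fix s r assume "skewS d G" "s \<in> slots d" "r \<in> slots d"
  then have "G s r = - G r s" by (rule skewS_D)
  then show "set_row G i \<rho> s r = - set_row G i \<rho> r s" by (simp add: set_row_def)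
qed

lemma symp_add_left: "symp g (\<lambda>c. x c + y c) z = symp g x z + symp g y z"
  and symp_add_right: "symp g z (\<lambda>c. x c + y c) = symp g z x + symp g z y"
  unfolding symp_def sum.distrib[symmetric] by (auto intro!: sum.cong simp: algebra_simps)

text \<open>Additivity in one vector becomes additivity in one row of the Gram matrix as soon as
  both rows are realized against the same remaining vectors. The extra slot
  \<open>(d, False)\<close> of the larger matrix \<open>H\<close> provides the second
  vector.\<close>

lemma gram_sum_add:
  assumes G: "skewS d G" and i: "i \<in> slots d"
  shows "filt_eq d (gram_sum d (set_row G i (\<lambda>r. \<rho> r + \<sigma> r))) (gram_sum d (set_row G i \<rho>) + gram_sum d (set_row G i \<sigma>))"
proof -
  let ?e = "(d, False)"
  define H where "H s r = (if s = ?e then (if r \<in> slots d \<and> r \<noteq> i then \<sigma> r else 0)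
     else if r = ?e then (if s \<in> slots d \<and> s \<noteq> i then - \<sigma> s else 0)
     else if s \<in> slots d \<and> r \<in> slots d then set_row G i \<rho> s r else 0)" for s r
  have e: "?e \<notin> slots d" "?e \<in> slots (Suc d)" by auto
  have sub: "s \<in> slots d \<Longrightarrow> s \<in> slots (Suc d)" for s by (cases s) auto
  have H: "skewS (Suc d) H"
    unfolding skewS_def[of "Suc d" H]
  proof (intro ballI)
    fix s r
    have "s \<in> slots d \<Longrightarrow> r \<in> slots d \<Longrightarrow> set_row G i \<rho> s r = - set_row G i \<rho> r s"
      by (rule skewS_D[OF skewS_set_row[OF G]])
    then show "H s r = - H r s" using e by (auto simp: H_def)
  qed
  define g where "g = 2 * Suc d"
  define u where "u = realize H"
  have om_u: "symp g (u s) (u r) = H s r" if "s \<in> slots (Suc d)" "r \<in> slots (Suc d)" for s r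
    unfolding g_def u_def using that by (rule symp_realize[OF H])
  have He: "H ?e r = (if r = i then 0 else \<sigma> r)" "H r ?e = (if r = i then 0 else - \<sigma> r)" if "r \<in> slots d" for r
    using that e by (auto simp: H_def)
  have Hd: "H s r = set_row G i \<rho> s r" if "s \<in> slots d" "r \<in> slots d" for s r
    using that e by (auto simp: H_def)
  have "filt_eq d (slot_sum g d (u(i := u i))) (gram_sum d (set_row G i \<rho>))"
    by (rule slot_sum_gram_sum) (simp add: om_u sub Hd)
  moreover have "filt_eq d (slot_sum g d (u(i := u ?e))) (gram_sum d (set_row G i \<sigma>))"
    by (rule slot_sum_gram_sum) (use i in \<open>auto simp: om_u sub e(2) Hd He set_row_def\<close>)
  moreover have "filt_eq d (slot_sum g d (u(i := \<lambda>c. u i c + u ?e c))) (gram_sum d (set_row G i (\<lambda>r. \<rho> r + \<sigma> r)))"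
    by (rule slot_sum_gram_sum) (use i in \<open>auto simp: om_u sub e(2) Hd He set_row_def symp_add_left symp_add_right\<close>)
  ultimately show ?thesis
    using slot_sum_add[OF i, of g u "u i" "u ?e"] by (meson filt_eq_add filt_eq_sym filt_eq_trans)
qed

text \<open>As only the Gram matrix matters, the vector in slot \<open>i\<close> may be taken to be
  0, and then its direction vanishes.\<close>

lemma gram_sum_zero:
  assumes G: "skewS d G" and i: "i \<in> slots d" and z: "\<And>r. r \<in> slots d \<Longrightarrow> G i r = 0"
  shows "gram_sum d G \<in> S_filt (Suc d)"
proof -
  let ?u = "(realize G)(i := \<lambda>_. 0)"
  have z': "G r i = 0" if "r \<in> slots d" for r using z[OF that] skewS_D[OF G that i] by simp
  have om0: "symp g (\<lambda>_. 0) x = 0" "symp g x (\<lambda>_. 0) = 0" for g x by (simp_all add: symp_def)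
  have "filt_eq d (slot_sum (2 * d) d ?u) (gram_sum d G)"
    by (rule slot_sum_gram_sum) (auto simp: om0 z z' symp_realize[OF G])
  moreover have "slot_sum (2 * d) d ?u = 0"
    by (rule slot_sum_zero[OF i]) simp
  ultimately have "filt_eq d (gram_sum d G) 0" by (simp add: filt_eq_sym)
  then show ?thesis by (simp add: filt_eq_def)
qed

lemma gram_sum_relabel:
  assumes G: "skewS d G" and p: "bij_betw p {..<d} {..<d}"
  shows "filt_eq d (gram_sum d (\<lambda>(k, b) (l, c). G (p k, b \<noteq> f k) (p l, c \<noteq> f l))) (gram_sum d G)"
proof -
  let ?u = "\<lambda>(k, b). realize G (p k, b \<noteq> f k)"
  have pd: "p k < d" if "k < d" for k using p that by (auto dest: bij_betwE)
  have "(\<lambda>k. sym_prod (?u (k, False)) (?u (k, True))) = (\<lambda>k. (\<lambda>k. sym_prod (realize G (k, False)) (realize G (k, True))) (p k))"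
  proof
    fix k show "sym_prod (?u (k, False)) (?u (k, True)) = sym_prod (realize G (p k, False)) (realize G (p k, True))"
      by (cases "f k") (simp_all add: sym_prod_commute)
  qed
  then have "slot_sum (2 * d) d ?u =
      altsum (2 * (2 * d)) {..<d} (\<lambda>k. (\<lambda>k. sym_prod (realize G (k, False)) (realize G (k, True))) (p k)) std_mat"
    unfolding slot_sum_def by (rule arg_cong[where f = "\<lambda>s. altsum (2 * (2 * d)) {..<d} s std_mat"])
  also have "\<dots> = gram_sum d G"
    unfolding gram_sum_def slot_sum_def by (rule altsum_reindex[OF p])
  finally have "slot_sum (2 * d) d ?u = gram_sum d G" .
  moreover have "filt_eq d (slot_sum (2 * d) d ?u) (gram_sum d (\<lambda>(k, b) (l, c). G (p k, b \<noteq> f k) (p l, c \<noteq> f l)))"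
    by (rule slot_sum_gram_sum) (use pd in \<open>auto simp: symp_realize[OF G]\<close>)
  ultimately show ?thesis by (simp only: filt_eq_sym)
qed

text \<open>\<open>T\<close> is the preimage of a subspace of the quotient by
  \<open>S_filt (Suc d)\<close>; membership in it replaces calculations in the quotient.\<close>

locale residual_space =
  fixes d :: nat and T :: "(S_class \<Rightarrow>\<^sub>0 rat) set"
  assumes T: "pm.subspace T" and filt_T: "S_filt (Suc d) \<subseteq> T"
begin

lemma filt_eq_T: "filt_eq d x y \<Longrightarrow> y \<in> T \<Longrightarrow> x \<in> T"
  using filt_T pm.subspace_add[OF T, of y "x - y"] by (auto simp: filt_eq_def)

lemma gram_sum_set_row_neg:
  assumes "skewS d G" "i \<in> slots d" "gram_sum d (set_row G i \<rho>) \<in> T"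
  shows "gram_sum d (set_row G i (\<lambda>r. - \<rho> r)) \<in> T"
proof -
  have "filt_eq d (gram_sum d (set_row G i (\<lambda>r. \<rho> r + - \<rho> r))) (gram_sum d (set_row G i \<rho>) + gram_sum d (set_row G i (\<lambda>r. - \<rho> r)))"
    by (rule gram_sum_add[OF assms(1,2)])
  moreover have "gram_sum d (set_row G i (\<lambda>r. \<rho> r + - \<rho> r)) \<in> S_filt (Suc d)"
    by (rule gram_sum_zero[OF skewS_set_row[OF assms(1)] assms(2)]) (simp add: set_row_def)
  ultimately have "gram_sum d (set_row G i \<rho>) + gram_sum d (set_row G i (\<lambda>r. - \<rho> r)) \<in> T"
    using filt_eq_T filt_eq_sym filt_T by blast
  from pm.subspace_diff[OF T this assms(3)] show ?thesis by simp
qed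

lemma gram_sum_set_row_scale:
  assumes G: "skewS d G" "i \<in> slots d" and "gram_sum d (set_row G i \<rho>) \<in> T"
  shows "gram_sum d (set_row G i (\<lambda>r. c * \<rho> r)) \<in> T"
proof -
  have zero: "gram_sum d (set_row G i (\<lambda>r. 0)) \<in> T"
    by (rule subsetD[OF filt_T], rule gram_sum_zero[OF skewS_set_row[OF G(1)] G(2)]) (simp add: set_row_def)
  have nat: "gram_sum d (set_row G i (\<lambda>r. int n * \<rho> r)) \<in> T" for n
  proof (induction n)
    case (Suc n)
    have "gram_sum d (set_row G i (\<lambda>r. \<rho> r + int n * \<rho> r)) \<in> T"
      by (rule filt_eq_T[OF gram_sum_add[OF G]]) (rule pm.subspace_add[OF T assms(3) Suc])
    then show ?case by (simp add: algebra_simps)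
  qed (simp add: zero)
  show ?thesis
    using nat[of "nat c"] gram_sum_set_row_neg[OF G nat[of "nat (- c)"]] by (cases "c \<ge> 0") auto
qed

definition match_rows :: "(slot \<Rightarrow> slot \<Rightarrow> int) \<Rightarrow> slot \<Rightarrow> slot \<Rightarrow> slot \<Rightarrow> slot \<Rightarrow> int" where
  "match_rows G i j = set_row (set_row G i (\<lambda>r. of_bool (r = j))) j (\<lambda>r. - of_bool (r = i))"

lemma match_rows_apply:
  "i \<noteq> j \<Longrightarrow> match_rows G i j s r =
    (if s = i then of_bool (r = j) else if s = j then - of_bool (r = i)
     else if r = i \<or> r = j then 0 else G s r)"
  by (auto simp: match_rows_def set_row_def)

lemma skewS_match_rows: "skewS d G \<Longrightarrow> skewS d (match_rows G i j)"
  unfolding match_rows_def by (intro skewS_set_row)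

text \<open>Expansion along the row \<open>i\<close>, followed by an expansion along the row \<open>j\<close> of each summand.\<close>

lemma gram_sum_expand_row:
  assumes G: "skewS d G" and i: "i \<in> slots d"
    and matched: "\<And>j. j \<in> slots d \<Longrightarrow> j \<noteq> i \<Longrightarrow> G i j \<noteq> 0 \<Longrightarrow> gram_sum d (match_rows G i j) \<in> T"
  shows "gram_sum d G \<in> T"
proof -
  define J where "J = {j \<in> slots d. j \<noteq> i \<and> G i j \<noteq> 0}"
  have zero: "gram_sum d (set_row G i (\<lambda>r. 0)) \<in> T"
    by (rule subsetD[OF filt_T], rule gram_sum_zero[OF skewS_set_row[OF G] i]) (simp add: set_row_def)
  have row: "gram_sum d (set_row G i (\<lambda>r. of_bool (r = j))) \<in> T" if j: "j \<in> J" for j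
  proof -
    define G1 where "G1 = set_row G i (\<lambda>r. of_bool (r = j))"
    have G1: "skewS d G1" unfolding G1_def by (rule skewS_set_row[OF G])
    have jd: "j \<in> slots d" "j \<noteq> i" using j by (auto simp: J_def)
    \<comment> \<open>The rest of row \<open>j\<close> has entry 0 at \<open>i\<close>. Row
      \<open>i\<close> of \<open>G1\<close> meets only \<open>j\<close>, so with this rest it
      becomes zero and the summand drops out.\<close>
    let ?\<sigma> = "\<lambda>r. if r = i then 0 else G1 j r"
    have "gram_sum d (set_row G1 j (\<lambda>r. - of_bool (r = i) + ?\<sigma> r)) \<in> T"
    proof (rule filt_eq_T[OF gram_sum_add[OF G1 jd(1)]], rule pm.subspace_add[OF T])
      show "gram_sum d (set_row G1 j (\<lambda>r. - of_bool (r = i))) \<in> T"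
        using matched[of j] j by (simp add: J_def match_rows_def G1_def)
      have "gram_sum d (set_row G1 j ?\<sigma>) \<in> S_filt (Suc d)"
        by (rule gram_sum_zero[OF skewS_set_row[OF G1] i]) (use jd in \<open>auto simp: set_row_def G1_def\<close>)
      then show "gram_sum d (set_row G1 j ?\<sigma>) \<in> T" using filt_T by blast
    qed
    moreover have "filt_eq d (gram_sum d G1) (gram_sum d (set_row G1 j (\<lambda>r. - of_bool (r = i) + ?\<sigma> r)))"
    proof (rule gram_sum_cong[OF G1])
      fix s r assume sr: "s \<in> slots d" "r \<in> slots d"
      have "G1 j i = - 1" using jd by (simp add: G1_def set_row_def)
      then show "G1 s r = set_row G1 j (\<lambda>r. - of_bool (r = i) + ?\<sigma> r) s r"
        using skewS_D[OF G1 sr(1) jd(1)] skewS_diag[OF G1 jd(1)] by (auto simp: set_row_def)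
    qed
    ultimately show ?thesis using filt_eq_T unfolding G1_def by blast
  qed
  have "gram_sum d (set_row G i (\<lambda>r. \<Sum>j\<in>L. G i j * of_bool (r = j))) \<in> T" if "finite L" "L \<subseteq> J" for L
    using that
  proof (induction L rule: finite_induct)
    case empty
    then show ?case by (simp add: zero)
  next
    case (insert j L)
    have "gram_sum d (set_row G i (\<lambda>r. G i j * of_bool (r = j) + (\<Sum>j\<in>L. G i j * of_bool (r = j)))) \<in> T"
    proof (rule filt_eq_T[OF gram_sum_add[OF G i]], rule pm.subspace_add[OF T])
      show "gram_sum d (set_row G i (\<lambda>r. G i j * of_bool (r = j))) \<in> T"
        using insert by (intro gram_sum_set_row_scale[OF G i] row) auto
      show "gram_sum d (set_row G i (\<lambda>r. \<Sum>j\<in>L. G i j * of_bool (r = j))) \<in> T"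
        using insert by auto
    qed
    then show ?case by (simp only: sum.insert[OF insert.hyps])
  qed
  moreover have "finite J" unfolding J_def by simp
  ultimately have *: "gram_sum d (set_row G i (\<lambda>r. \<Sum>j\<in>J. G i j * of_bool (r = j))) \<in> T" by blast
  have "filt_eq d (gram_sum d G) (gram_sum d (set_row G i (\<lambda>r. \<Sum>j\<in>J. G i j * of_bool (r = j))))"
  proof (rule gram_sum_cong[OF G])
    fix s r assume sr: "s \<in> slots d" "r \<in> slots d"
    have "(\<Sum>j\<in>J. G i j * of_bool (r = j)) = G i r" if "r \<in> slots d" "r \<noteq> i" for r
    proof -
      have "(\<Sum>j\<in>J. G i j * of_bool (r = j)) = (\<Sum>j\<in>J. if r = j then G i j else 0)"
        by (rule sum.cong) auto
      then show ?thesis using that \<open>finite J\<close> by (auto simp: J_def)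
    qed
    then show "G s r = set_row G i (\<lambda>r. \<Sum>j\<in>J. G i j * of_bool (r = j)) s r"
      using sr skewS_D[OF G sr(1) i] skewS_diag[OF G i] by (auto simp: set_row_def)
  qed
  then show ?thesis using * filt_eq_T by blast
qed

end

section \<open>Cycle types\<close>

text \<open>The permutation with cycles of lengths \<open>rs\<close>, the first entry of \<open>rs\<close> belonging to the cycle on
  the largest numbers; beyond \<open>sum_list rs\<close> it is the successor function.\<close>

fun cyc_succ :: "nat list \<Rightarrow> nat \<Rightarrow> nat" where
  "cyc_succ [] k = Suc k"
| "cyc_succ (n # rs) k = (if Suc k = sum_list rs + n then sum_list rs else cyc_succ rs k)"

lemma cyc_succ_above: "k \<ge> sum_list rs \<Longrightarrow> cyc_succ rs k = Suc k"
  by (induction rs) auto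

lemma cyc_succ_less: "\<forall>n\<in>set rs. 0 < n \<Longrightarrow> k < sum_list rs \<Longrightarrow> cyc_succ rs k < sum_list rs"
proof (induction rs)
  case (Cons n rs)
  show ?case
  proof (cases "k < sum_list rs")
    case True
    then show ?thesis using Cons by auto
  next
    case False
    then show ?thesis using Cons.prems by (auto simp: cyc_succ_above)
  qed
qed simp

text \<open>Directions are the vertices, and a matched pair is an edge from the \<open>True\<close>
  slot of a vertex to the \<open>False\<close> slot of its successor. The sign of the entry records
  the orientation.\<close>

definition cycle_gram :: "nat list \<Rightarrow> slot \<Rightarrow> slot \<Rightarrow> int" where
  "cycle_gram rs s r =
    of_bool (snd s \<and> \<not> snd r \<and> fst r = cyc_succ rs (fst s)) - of_bool (snd r \<and> \<not> snd s \<and> fst s = cyc_succ rs (fst r))"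

lemma skewS_cycle_gram: "skewS d (cycle_gram rs)"
  by (simp add: skewS_def cycle_gram_def)

text \<open>These are the slots whose partner is settled. Vertices below \<open>c\<close> have been
  visited, and the open path from \<open>a\<close> to \<open>c - 1\<close> has the ends
  \<open>(a, False)\<close> and \<open>(c - 1, True)\<close>; there is no open path if
  \<open>a = c\<close>.\<close>

definition closed_slot :: "nat \<Rightarrow> nat \<Rightarrow> slot \<Rightarrow> bool" where
  "closed_slot a c s \<longleftrightarrow> fst s < c \<and> (a = c \<or> (if snd s then Suc (fst s) \<noteq> c else fst s \<noteq> a))"

text \<open>The vertices below \<open>sum_list rs\<close> form cycles, and those from \<open>sum_list rs\<close> to \<open>c\<close> form a path,
  whose two ends are not closed.\<close>

definition path_state :: "nat \<Rightarrow> nat list \<Rightarrow> nat \<Rightarrow> (slot \<Rightarrow> slot \<Rightarrow> int) \<Rightarrow> bool" where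
  "path_state d rs c G \<longleftrightarrow> skewS d G \<and> (\<forall>n\<in>set rs. 0 < n) \<and> sum_list rs \<le> c \<and> c \<le> d \<and>
    (\<forall>s\<in>slots d. closed_slot (sum_list rs) c s \<longrightarrow> (\<forall>r\<in>slots d. G s r = cycle_gram rs s r))"

context residual_space
begin

text \<open>Matching the two ends turns the path into a cycle, which goes to the head of the list
  because it occupies the largest numbers visited so far.\<close>

lemma path_close:
  assumes st: "path_state d rs c G" and ac: "sum_list rs < c"
  shows "path_state d ((c - sum_list rs) # rs) c (match_rows G (c - 1, True) (sum_list rs, False))"
proof -
  let ?a = "sum_list rs" and ?i = "(c - 1, True)" and ?j = "(sum_list rs, False)"
  have G: "skewS d G" and pos: "\<forall>n\<in>set rs. 0 < n" and cd: "c \<le> d"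
    and on_closed: "\<And>s r. s \<in> slots d \<Longrightarrow> r \<in> slots d \<Longrightarrow> closed_slot ?a c s \<Longrightarrow> G s r = cycle_gram rs s r"
    using st unfolding path_state_def by blast+
  have succ_eq: "cyc_succ ((c - ?a) # rs) k = (if k = c - 1 then ?a else cyc_succ rs k)" for k using ac by auto
  have sca: "cyc_succ rs k \<noteq> ?a" for k
    using cyc_succ_less[OF pos, of k] cyc_succ_above[of rs k] by (cases "k < ?a") auto
  have scc: "cyc_succ rs (c - 1) = c" using ac by (subst cyc_succ_above) auto
  have "match_rows G ?i ?j s r = cycle_gram ((c - ?a) # rs) s r"
    if s: "s \<in> slots d" "fst s < c" and r: "r \<in> slots d" for s r
  proof -
    obtain k b l b' where sr: "s = (k, b)" "r = (l, b')" by (cases s, cases r) auto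
    have "s = ?i \<or> s = ?j \<or> closed_slot ?a c s"
      using s(2) sr by (cases b) (auto simp: closed_slot_def)
    then show ?thesis
    proof (elim disjE)
      assume "s = ?i"
      then show ?thesis by (auto simp: match_rows_apply cycle_gram_def succ_eq sr simp del: cyc_succ.simps)
    next
      assume "s = ?j"
      then show ?thesis using sca[of k] sca[of l] by (auto simp: match_rows_apply cycle_gram_def succ_eq sr simp del: cyc_succ.simps)
    next
      assume c: "closed_slot ?a c s"
      then have "s \<noteq> ?i" "s \<noteq> ?j" using ac by (auto simp: closed_slot_def)
      then show ?thesis
        using on_closed[OF s(1) r c] sca[of k] sca[of l] s(2) by (auto simp: match_rows_apply cycle_gram_def succ_eq sr scc simp del: cyc_succ.simps)
    qed
  qed
  then show ?thesis
    unfolding path_state_def using skewS_match_rows[OF G] pos cd ac by (auto simp: closed_slot_def)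
qed

text \<open>The partner of the open end lies at an unvisited vertex \<open>w\<close>. Exchanging
  \<open>w\<close> with \<open>c\<close> makes it the next vertex, and exchanging its slots if
  \<open>b0\<close> holds makes the path enter through the \<open>False\<close> slot.\<close>

lemma path_extend:
  assumes st: "path_state d rs c G" and ac: "sum_list rs < c" and w: "c \<le> w" "w < d"
  shows "path_state d rs (Suc c) (\<lambda>(k, b) (l, b').
    match_rows G (c - 1, True) (w, b0) (transpose c w k, b \<noteq> (k = c \<and> b0)) (transpose c w l, b' \<noteq> (l = c \<and> b0)))"
proof -
  let ?a = "sum_list rs" and ?i = "(c - 1, True)" and ?j = "(w, b0)"
  define t where t_def: "t = (\<lambda>(k, b). (transpose c w k, b \<noteq> (k = c \<and> b0)))"
  have G: "skewS d G" and pos: "\<forall>n\<in>set rs. 0 < n" and cd: "c \<le> d"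
    and on_closed: "\<And>s r. s \<in> slots d \<Longrightarrow> r \<in> slots d \<Longrightarrow> closed_slot ?a c s \<Longrightarrow> G s r = cycle_gram rs s r"
    using st unfolding path_state_def by blast+
  have ij: "?i \<noteq> ?j" using ac w by auto
  have t_slot: "t s \<in> slots d" if "s \<in> slots d" for s
    using that w by (cases s) (auto simp: t_def transpose_def)
  have t_below: "t s = s" if "fst s < c" for s
    using that w by (cases s) (auto simp: t_def transpose_def)
  have t_above: "fst (t s) < c \<longleftrightarrow> fst s < c" for s
    using w by (cases s) (auto simp: t_def transpose_def)
  have t_j: "t s = ?j \<longleftrightarrow> s = (c, False)" for s
    using w by (cases s) (auto simp: t_def transpose_def)
  have t_i: "t s = ?i \<longleftrightarrow> s = ?i" for s
    using w ac by (cases s) (auto simp: t_def transpose_def)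
  have scc: "cyc_succ rs (c - 1) = c" using ac by (subst cyc_succ_above) auto
  have sc_eq_c: "cyc_succ rs k = c \<longleftrightarrow> k = c - 1" for k
    using cyc_succ_less[OF pos, of k] cyc_succ_above[of rs k] ac by (cases "k < ?a") auto
  have c_eq_sc: "c = cyc_succ rs k \<longleftrightarrow> k = c - Suc 0" for k
    using sc_eq_c[of k] by auto
  have sc_below: "cyc_succ rs k < c \<longleftrightarrow> k < c - 1" for k
    using cyc_succ_less[OF pos, of k] cyc_succ_above[of rs k] ac by (cases "k < ?a") auto
  have skew: "skewS d (\<lambda>s r. match_rows G ?i ?j (t s) (t r))"
    unfolding skewS_def by (intro ballI skewS_D[OF skewS_match_rows[OF G]] t_slot)
  have "match_rows G ?i ?j (t s) (t r) = cycle_gram rs s r"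
    if s: "s \<in> slots d" "closed_slot ?a (Suc c) s" and r: "r \<in> slots d" for s r
  proof -
    have "s = ?i \<or> s = (c, False) \<or> (closed_slot ?a c s \<and> fst s < c)"
      using s(2) ac by (cases s; cases "snd s") (auto simp: closed_slot_def less_Suc_eq)
    then show ?thesis
    proof (elim disjE conjE)
      assume si: "s = ?i"
      then have "t s = ?i" using t_i by blast
      then show ?thesis unfolding match_rows_apply[OF ij] using si
        by (cases r) (auto simp: t_j cycle_gram_def scc[unfolded One_nat_def])
    next
      assume sj: "s = (c, False)"
      then have "t s = ?j" using t_j by blast
      then show ?thesis unfolding match_rows_apply[OF ij] using sj ij t_i[of r] sc_eq_c[unfolded One_nat_def]
        by (cases r) (auto simp: cycle_gram_def c_eq_sc)
    next
      assume c: "closed_slot ?a c s" "fst s < c"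
      then have sn: "t s = s" "s \<noteq> ?i" "s \<noteq> ?j" using t_below ac w by (auto simp: closed_slot_def)
      obtain k b where sk: "s = (k, b)" by (cases s)
      have k: "k < c" "b \<Longrightarrow> k \<noteq> c - 1" using c ac sk by (auto simp: closed_slot_def)
      have "match_rows G ?i ?j (t s) (t r) = (if r = ?i \<or> r = (c, False) then 0 else cycle_gram rs s (t r))"
        unfolding match_rows_apply[OF ij] sn(1) t_i t_j using sn on_closed[OF s(1) t_slot[OF r] c(1)] by simp
      also have "\<dots> = cycle_gram rs s r"
      proof (cases "fst r < c")
        case True
        then show ?thesis
          using t_below[OF True] k sk sc_eq_c[unfolded One_nat_def]
          by (auto simp: cycle_gram_def scc[unfolded One_nat_def])
      next
        case False
        obtain l b' where rl: "r = (l, b')" by (cases r)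
        obtain l2 b2 where tr: "t r = (l2, b2)" by (cases "t r")
        have l2: "\<not> l2 < c" using t_above[of r] False tr by simp
        have "cycle_gram rs s (l2, b2) = 0" if "\<not> l2 < c" for l2 b2
        proof -
          have "cyc_succ rs k < c" if b using k that sc_below by auto
          moreover have "\<not> cyc_succ rs l2 < c" using \<open>\<not> l2 < c\<close> sc_below by auto
          ultimately show ?thesis using k sk that by (auto simp: cycle_gram_def)
        qed
        then show ?thesis using l2 False rl tr by auto
      qed
      finally show ?thesis .
    qed
  qed
  then have "path_state d rs (Suc c) (\<lambda>s r. match_rows G ?i ?j (t s) (t r))"
    unfolding path_state_def using skew pos cd ac w by auto
  moreover have "(\<lambda>s r. match_rows G ?i ?j (t s) (t r)) = (\<lambda>(k, b) (l, b').
    match_rows G ?i ?j (transpose c w k, b \<noteq> (k = c \<and> b0)) (transpose c w l, b' \<noteq> (l = c \<and> b0)))"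
    by (auto simp: fun_eq_iff t_def)
  ultimately show ?thesis by simp
qed

text \<open>Closed slots pair to 0 with the open end \<open>(c - 1, True)\<close>. Expansion along
  its row therefore meets only the start of the path, which closes it, and unvisited vertices, which
  extend it; without an open path, vertex \<open>c\<close> starts one. The measure counts unvisited
  vertices twice, so that opening a path lowers it in spite of the added 1, and closing one lowers
  it by that 1.\<close>

lemma path_state_in_T:
  assumes "path_state d rs c G"
    and basis: "\<And>rs. \<forall>n\<in>set rs. 0 < n \<Longrightarrow> sum_list rs = d \<Longrightarrow> gram_sum d (cycle_gram rs) \<in> T"
  shows "gram_sum d G \<in> T"
  using assms(1)
proof (induction "2 * (d - c) + of_bool (sum_list rs < c)" arbitrary: rs c G rule: less_induct)
  case less
  let ?a = "sum_list rs"
  have G: "skewS d G" and pos: "\<forall>n\<in>set rs. 0 < n" and ac: "?a \<le> c" and cd: "c \<le> d"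
    and on_closed: "\<And>s r. s \<in> slots d \<Longrightarrow> r \<in> slots d \<Longrightarrow> closed_slot ?a c s \<Longrightarrow> G s r = cycle_gram rs s r"
    using less.prems unfolding path_state_def by blast+
  consider "?a = c" "c = d" | "?a = c" "c < d" | "?a < c" using ac cd by linarith
  then show ?case
  proof cases
    case 1
    have "filt_eq d (gram_sum d G) (gram_sum d (cycle_gram rs))"
      by (rule gram_sum_cong[OF G], rule on_closed) (use 1 in \<open>auto simp: closed_slot_def slots_def\<close>)
    then show ?thesis using basis[OF pos] 1 filt_eq_T by simp
  next
    case 2
    have "closed_slot ?a c s" if "closed_slot ?a (Suc c) s" for s
      using that 2 by (cases "snd s") (auto simp: closed_slot_def)
    then have "path_state d rs (Suc c) G"
      using less.prems 2 unfolding path_state_def by auto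
    then show ?thesis using less.hyps[of "Suc c" rs G] 2 by simp
  next
    case 3
    let ?i = "(c - 1, True)"
    have i: "?i \<in> slots d" using 3 cd by auto
    show ?thesis
    proof (rule gram_sum_expand_row[OF G i])
      fix j assume j: "j \<in> slots d" "j \<noteq> ?i" "G ?i j \<noteq> 0"
      have scc: "cyc_succ rs (c - 1) = c" using 3 by (subst cyc_succ_above) auto
      have "\<not> closed_slot ?a c j"
      proof
        assume c: "closed_slot ?a c j"
        have "G j ?i \<noteq> 0" using j skewS_D[OF G i j(1)] by simp
        then show False using on_closed[OF j(1) i c] c scc by (auto simp: cycle_gram_def closed_slot_def split: if_splits)
      qed
      then have "j = (?a, False) \<or> fst j \<ge> c"
        using j(2) 3 by (cases j; cases "snd j") (auto simp: closed_slot_def)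
      then show "gram_sum d (match_rows G ?i j) \<in> T"
      proof
        assume "j = (?a, False)"
        then show ?thesis
          using less.hyps[OF _ path_close[OF less.prems 3]] 3 by simp
      next
        assume w: "fst j \<ge> c"
        obtain w b0 where jw: "j = (w, b0)" by (cases j)
        have w: "c \<le> w" "w < d" using w j jw by auto
        have "bij_betw (transpose c w) {..<d} {..<d}"
          by (intro permutes_imp_bij permutes_swap_id) (use w in auto)
        note rel = gram_sum_relabel[OF skewS_match_rows[OF G, of ?i j] this, of "\<lambda>k. k = c \<and> b0"]
        have "gram_sum d (\<lambda>(k, b) (l, b'). match_rows G ?i (w, b0) (transpose c w k, b \<noteq> (k = c \<and> b0)) (transpose c w l, b' \<noteq> (l = c \<and> b0))) \<in> T"
          by (rule less.hyps[OF _ path_extend[OF less.prems 3 w]]) (use 3 w in auto)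
        then show ?thesis using filt_eq_T[OF filt_eq_sym[OF rel]] jw by simp
      qed
    qed
  qed
qed

lemma gram_sum_in_T:
  assumes "skewS d G"
    and "\<And>rs. \<forall>n\<in>set rs. 0 < n \<Longrightarrow> sum_list rs = d \<Longrightarrow> gram_sum d (cycle_gram rs) \<in> T"
  shows "gram_sum d G \<in> T"
proof -
  have "path_state d [] 0 G" by (simp add: path_state_def closed_slot_def assms(1))
  then show ?thesis by (rule path_state_in_T) (rule assms(2))
qed

end

section \<open>Conjugacy of cycle types and vanishing of odd cycles\<close>

definition cyc_rel :: "nat list \<Rightarrow> nat list \<Rightarrow> bool" where
  "cyc_rel rs rs' \<longleftrightarrow> sum_list rs = sum_list rs' \<and>
    (\<exists>p. p permutes {..<sum_list rs} \<and> (\<forall>k<sum_list rs. p (cyc_succ rs' k) = cyc_succ rs (p k)))"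

lemma cyc_rel_refl: "cyc_rel rs rs"
  unfolding cyc_rel_def by (auto intro: exI[of _ id] permutes_id)

lemma cyc_rel_trans [trans]:
  assumes "cyc_rel rs rs'" "cyc_rel rs' rs''"
  shows "cyc_rel rs rs''"
proof -
  obtain p where p: "p permutes {..<sum_list rs}" "\<forall>k<sum_list rs. p (cyc_succ rs' k) = cyc_succ rs (p k)"
    and s: "sum_list rs = sum_list rs'"
    using assms(1) unfolding cyc_rel_def by blast
  obtain q where q: "q permutes {..<sum_list rs'}" "\<forall>k<sum_list rs'. q (cyc_succ rs'' k) = cyc_succ rs' (q k)"
    and s': "sum_list rs' = sum_list rs''"
    using assms(2) unfolding cyc_rel_def by blast
  have "p (q (cyc_succ rs'' k)) = cyc_succ rs (p (q k))" if k: "k < sum_list rs" for k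
  proof -
    have "q k < sum_list rs" using permutes_in_image[OF q(1), of k] k s by simp
    then show ?thesis using p(2) q(2) k s by simp
  qed
  moreover have "p \<circ> q permutes {..<sum_list rs}" using permutes_compose q(1) p(1) s by metis
  ultimately show ?thesis
    unfolding cyc_rel_def using s s' by (intro conjI exI[of _ "p \<circ> q"]) auto
qed

lemma cyc_rel_Cons:
  assumes "cyc_rel rs rs'" "0 < n"
  shows "cyc_rel (n # rs) (n # rs')"
proof -
  obtain p where p: "p permutes {..<sum_list rs}" "\<forall>k<sum_list rs. p (cyc_succ rs' k) = cyc_succ rs (p k)"
    and s: "sum_list rs = sum_list rs'"
    using assms(1) unfolding cyc_rel_def by blast
  have p_fix: "p k = k" if "k \<ge> sum_list rs" for k
    using p(1) that by (simp add: permutes_not_in)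
  have "p (cyc_succ (n # rs') k) = cyc_succ (n # rs) (p k)" for k
  proof (cases "k < sum_list rs")
    case True
    then have "p k < sum_list rs" using permutes_in_image[OF p(1), of k] by simp
    then show ?thesis using True p(2) assms(2) s by simp
  next
    case False
    then show ?thesis using p_fix s assms(2) by (simp add: cyc_succ_above)
  qed
  moreover have "p permutes {..<sum_list (n # rs)}"
    using permutes_subset[OF p(1), of "{..<sum_list (n # rs)}"] by auto
  ultimately show ?thesis
    unfolding cyc_rel_def using s by (intro conjI exI[of _ p] allI impI) (simp_all del: cyc_succ.simps)
qed

lemma cyc_rel_swap:
  assumes "0 < m" "0 < n" and pos: "\<forall>k\<in>set rs. 0 < k"
  shows "cyc_rel (m # n # rs) (n # m # rs)"
proof -
  define b where "b = sum_list rs"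
  \<comment> \<open>The head of a list owns the largest numbers, so in \<open>n # m # rs\<close> the
    cycle of length \<open>m\<close> starts at \<open>b\<close>. The map \<open>p\<close> carries it
    behind a block of length \<open>n\<close>, and \<open>q\<close> is its inverse.\<close>
  define p where "p k = (if b \<le> k \<and> k < b + m then k + n
    else if b + m \<le> k \<and> k < b + m + n then k - m else k)" for k
  define q where "q k = (if b \<le> k \<and> k < b + n then k + m
    else if b + n \<le> k \<and> k < b + m + n then k - n else k)" for k
  have "bij_betw p {..<b + m + n} {..<b + m + n}"
    by (rule bij_betw_byWitness[where f' = q]) (auto simp: p_def q_def)
  then have "p permutes {..<b + m + n}"
    by (rule bij_imp_permutes) (auto simp: p_def)
  moreover have "p (cyc_succ (n # m # rs) k) = cyc_succ (m # n # rs) (p k)" if k: "k < b + m + n" for k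
  proof -
    consider "k < b" | "b \<le> k" "k < b + m" | "b + m \<le> k" by linarith
    then show ?thesis
    proof cases
      case 1
      then have "p (cyc_succ rs k) = cyc_succ rs k" using cyc_succ_less[OF pos, of k] by (simp add: p_def b_def)
      with 1 show ?thesis using assms by (simp add: p_def b_def)
    qed (use k assms in \<open>auto simp: p_def b_def cyc_succ_above\<close>)
  qed
  ultimately show ?thesis
    unfolding cyc_rel_def b_def by (intro conjI exI[of _ p]) (auto simp: add_ac)
qed

lemma cyc_rel_front:
  "\<forall>k\<in>set rs. 0 < k \<Longrightarrow> n \<in> set rs \<Longrightarrow> cyc_rel rs (n # remove1 n rs)"
proof (induction rs)
  case (Cons x xs)
  show ?case
  proof (cases "x = n")
    case False
    then have "cyc_rel (x # xs) (x # n # remove1 n xs)"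
      using Cons by (intro cyc_rel_Cons) auto
    also have "cyc_rel (x # n # remove1 n xs) (n # x # remove1 n xs)"
      using Cons.prems by (intro cyc_rel_swap) (auto dest: notin_set_remove1)
    finally show ?thesis using False by simp
  qed (simp add: cyc_rel_refl)
qed simp

text \<open>The head of \<open>rs'\<close> is brought to the front of \<open>rs\<close>, and the
  tails are treated by induction. This is why a monomial, which knows no order of its factors, can
  stand for a cycle type.\<close>

lemma cyc_rel_mset:
  "mset rs = mset rs' \<Longrightarrow> \<forall>k\<in>set rs. 0 < k \<Longrightarrow> cyc_rel rs rs'"
proof (induction rs' arbitrary: rs)
  case Nil
  then show ?case by (simp add: cyc_rel_refl)
next
  case (Cons n rs')
  have n: "n \<in> set rs" using Cons.prems(1) by (metis list.set_intros(1) set_mset_mset)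
  have "mset (remove1 n rs) = mset rs'" using Cons.prems(1) by simp
  moreover have "\<forall>k\<in>set (remove1 n rs). 0 < k" using Cons.prems(2) by (meson notin_set_remove1)
  ultimately have "cyc_rel (n # remove1 n rs) (n # rs')"
    using Cons.IH Cons.prems(2) n by (intro cyc_rel_Cons) auto
  with cyc_rel_front[OF Cons.prems(2) n] show ?case by (rule cyc_rel_trans)
qed

lemma gram_sum_cyc_rel:
  assumes "cyc_rel rs rs'" "sum_list rs = d"
  shows "filt_eq d (gram_sum d (cycle_gram rs')) (gram_sum d (cycle_gram rs))"
proof -
  obtain p where p: "p permutes {..<d}" "\<forall>k<d. p (cyc_succ rs' k) = cyc_succ rs (p k)"
    using assms unfolding cyc_rel_def by blast
  have inj: "p x = p y \<longleftrightarrow> x = y" for x y using permutes_inj[OF p(1)] by (simp add: inj_eq)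
  have "filt_eq d (gram_sum d (cycle_gram rs')) (gram_sum d (\<lambda>(k, b) (l, c). cycle_gram rs (p k, b \<noteq> False) (p l, c \<noteq> False)))"
    by (rule gram_sum_cong[OF skewS_cycle_gram]) (auto simp: cycle_gram_def p(2)[rule_format, symmetric] inj)
  also have "filt_eq d \<dots> (gram_sum d (cycle_gram rs))"
    by (rule gram_sum_relabel[OF skewS_cycle_gram permutes_imp_bij[OF p(1)]])
  finally show ?thesis .
qed

text \<open>Negating the vectors in the \<open>False\<close> slots of the vertices from
  \<open>b\<close> on conjugates the Gram matrix by signs and negates \<open>d - b\<close>
  directions.\<close>

lemma gram_sum_sign:
  fixes b :: nat
  defines "sg \<equiv> \<lambda>s :: slot. if b \<le> fst s \<and> \<not> snd s then - 1 else 1 :: int"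
  assumes G: "skewS d G" and b: "b \<le> d"
  shows "filt_eq d (gram_sum d (\<lambda>s r. sg s * sg r * G s r)) (pm_scale ((-1) ^ (d - b)) (gram_sum d G))"
proof -
  let ?u = "\<lambda>s c. sg s * realize G s c"
  let ?t = "\<lambda>k. sym_prod (realize G (k, False)) (realize G (k, True))"
  have om_scale: "symp g (\<lambda>c. x * a c) (\<lambda>c. y * b c) = x * y * symp g a b" for g x y a b
    unfolding symp_def sum_distrib_left by (rule sum.cong) (auto simp: algebra_simps)
  have "filt_eq d (slot_sum (2 * d) d ?u) (gram_sum d (\<lambda>s r. sg s * sg r * G s r))"
    by (rule slot_sum_gram_sum) (simp add: om_scale symp_realize[OF G])
  then have "filt_eq d (gram_sum d (\<lambda>s r. sg s * sg r * G s r)) (slot_sum (2 * d) d ?u)" by (rule filt_eq_sym)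
  also have "slot_sum (2 * d) d ?u =
      altsum (2 * (2 * d)) {..<d} (\<lambda>k. if k \<in> {b..<d} then (\<lambda>i j. - ?t k i j) else ?t k) std_mat"
    unfolding slot_sum_def by (rule altsum_cong_entries) (auto simp: sg_def sym_prod_def)
  also have "filt_eq (card {..<d}) \<dots>
      (pm_scale ((-1) ^ card {b..<d}) (altsum (2 * (2 * d)) {..<d} ?t std_mat))"
    by (intro altsum_scale_all altsum_uminus seifert_std_mat) (auto simp: symm_def sym_prod_def)
  then have "filt_eq d (altsum (2 * (2 * d)) {..<d} (\<lambda>k. if k \<in> {b..<d} then (\<lambda>i j. - ?t k i j) else ?t k) std_mat)
      (pm_scale ((-1) ^ (d - b)) (gram_sum d G))"
    by (simp only: card_lessThan card_atLeastLessThan gram_sum_def slot_sum_def)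
  finally show ?thesis .
qed

text \<open>Reversing a cycle and exchanging the two slots of each of its vertices changes the signs of its
  matching pairs, so that a cycle of odd length contributes \<open>0\<close>.\<close>

lemma gram_sum_odd_cycle:
  assumes pos: "\<forall>k\<in>set rs. 0 < k" and d: "sum_list rs = d" and n: "n \<in> set rs" "odd n"
  shows "gram_sum d (cycle_gram rs) \<in> S_filt (Suc d)"
proof -
  define rs0 where "rs0 = remove1 n rs"
  define b where "b = sum_list rs0"
  let ?rs = "n # rs0"
  have rel: "cyc_rel rs ?rs" unfolding rs0_def by (rule cyc_rel_front[OF pos n(1)])
  then have bd: "d = b + n" using d by (simp add: cyc_rel_def b_def)
  have pos0: "\<forall>k\<in>set rs0. 0 < k" using pos unfolding rs0_def by (meson notin_set_remove1)
  let ?sg = "\<lambda>s :: slot. if b \<le> fst s \<and> \<not> snd s then - 1 else 1 :: int"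
  \<comment> \<open>Reversal of \<open>{b..<d}\<close>, the vertices of the odd cycle once it has
    been moved to the head of the list.\<close>
  define p where "p k = (if b \<le> k \<and> k < d then b + d - 1 - k else k)" for k
  have "bij_betw p {..<d} {..<d}"
    by (rule bij_betw_byWitness[where f' = p]) (auto simp: p_def)
  note rel' = gram_sum_relabel[OF skewS_cycle_gram[of d ?rs] this, of "\<lambda>k. b \<le> k"]
  have sc_lt: "k < b \<Longrightarrow> cyc_succ ?rs k < b" for k
    using cyc_succ_less[OF pos0, of k] odd_pos[OF n(2)] by (auto simp: b_def)
  have sc_ge: "b \<le> k \<Longrightarrow> k < d \<Longrightarrow> cyc_succ ?rs k = (if Suc k = d then b else Suc k)" for k
    by (auto simp: b_def bd cyc_succ_above)
  have rev: "p k = cyc_succ ?rs (p l) \<longleftrightarrow> l = cyc_succ ?rs k" if "b \<le> k" "k < d" "b \<le> l" "l < d" for k l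
  proof -
    have "p k = b + d - 1 - k" "p l = b + d - 1 - l" "b \<le> p l" "p l < d"
      using that by (auto simp: p_def)
    then have "p k = cyc_succ ?rs (p l) \<longleftrightarrow> b + d - 1 - k = (if l = b then b else b + d - l)"
      using that by (subst sc_ge) auto
    also have "\<dots> \<longleftrightarrow> l = (if Suc k = d then b else Suc k)" using that by auto
    also have "\<dots> \<longleftrightarrow> l = cyc_succ ?rs k" using that by (subst sc_ge) auto
    finally show ?thesis .
  qed
  have rev': "p k = cyc_succ ?rs l \<longleftrightarrow> False" if "b \<le> k" "k < d" "l < b" for k l
    using sc_lt[OF that(3)] that by (auto simp: p_def)
  have p_small: "p k = k" if "k < b" for k using that by (simp add: p_def)
  have "filt_eq d (gram_sum d (\<lambda>s r. ?sg s * ?sg r * cycle_gram ?rs s r))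
      (gram_sum d (\<lambda>(k, c) (l, c'). cycle_gram ?rs (p k, c \<noteq> (b \<le> k)) (p l, c' \<noteq> (b \<le> l))))"
  proof (rule gram_sum_cong)
    show "skewS d (\<lambda>s r. ?sg s * ?sg r * cycle_gram ?rs s r)"
      by (simp add: skewS_def cycle_gram_def)
    fix s r assume sr: "s \<in> slots d" "r \<in> slots d"
    obtain k c l c' where s: "s = (k, c)" and r: "r = (l, c')" by (cases s, cases r) auto
    have kl: "k < d" "l < d" using sr s r by auto
    have ge: "b \<le> x \<Longrightarrow> x < d \<Longrightarrow> b \<le> cyc_succ ?rs x" for x by (simp add: sc_ge del: cyc_succ.simps)
    have ge': "b \<le> x \<Longrightarrow> x < d \<Longrightarrow> b \<le> cyc_succ ?rs (p x)" for x
      by (rule ge) (auto simp: p_def)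
    show "?sg s * ?sg r * cycle_gram ?rs s r = (\<lambda>(k, c) (l, c'). cycle_gram ?rs (p k, c \<noteq> (b \<le> k)) (p l, c' \<noteq> (b \<le> l))) s r"
      using kl rev[of k l] rev[of l k] rev'[of k l] rev'[of l k] p_small[of k] p_small[of l]
        sc_lt[of k] sc_lt[of l] ge[of k] ge[of l] ge'[of k] ge'[of l]
      unfolding s r
      by (cases "b \<le> k"; cases "b \<le> l"; cases c; cases c'; simp add: cycle_gram_def del: cyc_succ.simps)
  qed
  then have "filt_eq d (gram_sum d (\<lambda>s r. ?sg s * ?sg r * cycle_gram ?rs s r)) (gram_sum d (cycle_gram ?rs))"
    using rel' by (rule filt_eq_trans)
  moreover have "filt_eq d (gram_sum d (\<lambda>s r. ?sg s * ?sg r * cycle_gram ?rs s r)) (- gram_sum d (cycle_gram ?rs))"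
    using gram_sum_sign[OF skewS_cycle_gram[of d ?rs], of b] n(2) bd by simp
  ultimately have "filt_eq d (gram_sum d (cycle_gram ?rs)) (- gram_sum d (cycle_gram ?rs))"
    by (meson filt_eq_sym filt_eq_trans)
  then have "gram_sum d (cycle_gram ?rs) + gram_sum d (cycle_gram ?rs) \<in> S_filt (Suc d)" by (simp add: filt_eq_def)
  \<comment> \<open>The element agrees with its negative modulo the next step, so its double lies
    there; halving needs the rational scalars.\<close>
  from S_filt_scale[OF this, of "1 / 2"] have "gram_sum d (cycle_gram ?rs) \<in> S_filt (Suc d)"
    by (simp add: pm.scale_right_distrib flip: pm.scale_left_distrib)
  then have "filt_eq d (gram_sum d (cycle_gram ?rs)) 0" by (simp add: filt_eq_def)
  then have "filt_eq d (gram_sum d (cycle_gram rs)) 0"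
    using gram_sum_cyc_rel[OF rel d] by (meson filt_eq_sym filt_eq_trans)
  then show ?thesis by (simp add: filt_eq_def)
qed

theorem S_filt_even_cycles:
  assumes T: "pm.subspace T" "S_filt (Suc d) \<subseteq> T"
    and "\<And>rs. \<forall>n\<in>set rs. 0 < n \<and> even n \<Longrightarrow> sum_list rs = d \<Longrightarrow> gram_sum d (cycle_gram rs) \<in> T"
  shows "S_filt d \<subseteq> T"
proof (rule S_filt_generated[OF T])
  interpret residual_space d T by standard (use T in auto)
  have basis: "gram_sum d (cycle_gram rs) \<in> T" if "\<forall>n\<in>set rs. 0 < n" "sum_list rs = d" for rs
    using assms(3)[of rs] gram_sum_odd_cycle[OF that] that assms(2) by blast
  fix g u
  have "filt_eq d (slot_sum g d u) (gram_sum d (\<lambda>s r. symp g (u s) (u r)))"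
    by (rule slot_sum_gram_sum) simp
  moreover have "skewS d (\<lambda>s r. symp g (u s) (u r))"
    unfolding skewS_def using symp_antisym by blast
  then have "gram_sum d (\<lambda>s r. symp g (u s) (u r)) \<in> T"
    by (rule gram_sum_in_T) (rule basis)
  ultimately show "slot_sum g d u \<in> T" by (rule filt_eq_T)
qed

unbundle fps_syntax

no_notation vec_index (infixl "$" 100)

section \<open>The Alexander polynomial\<close>

text \<open>The Alexander polynomial \<open>det (t M - M^t)\<close> at \<open>t = 1 + u\<close>,
  with \<open>u\<close> written \<open>fps_X\<close>. An enlargement multiplies the determinant by
  \<open>1 + u\<close>, which the power of the inverse compensates. At \<open>u = 0\<close> the
  matrix is the antisymmetrization, on which the graded pieces are based.\<close>

definition alex :: "nat \<Rightarrow> imat \<Rightarrow> rat fps" where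
  "alex n m = det (mat n n (\<lambda>(i, j). (1 + fps_X) * of_int (m i j) - of_int (m j i))) *
     inverse (1 + fps_X) ^ (n div 2)"

definition alex_mat :: "int mat \<Rightarrow> rat fps" where
  "alex_mat M = alex (dim_row M) (\<lambda>i j. M $$ (i, j))"

lemma inverse_1_X: "(1 + fps_X) * inverse (1 + fps_X) = (1 :: rat fps)"
  by (rule inverse_mult_eq_1') simp

lemma inverse_1_X_cancel:
  fixes c :: "rat fps"
  assumes "c = (1 + fps_X) * e"
  shows "c * inverse (1 + fps_X) ^ ((n + 2) div 2) = e * inverse (1 + fps_X) ^ (n div 2)"
proof -
  have "c * inverse (1 + fps_X) ^ ((n + 2) div 2) =
      ((1 + fps_X) * inverse (1 + fps_X)) * (e * inverse (1 + fps_X) ^ (n div 2))"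
    unfolding assms by (simp only: div_add_self2[of 2 n] zero_neq_numeral not_False_eq_True simp_thms power_add power_one_right mult_ac)
  then show ?thesis by (simp only: inverse_1_X mult_1)
qed

lemma alex_cong: "(\<And>i j. i < n \<Longrightarrow> j < n \<Longrightarrow> m i j = m' i j) \<Longrightarrow> alex n m = alex n m'"
  unfolding alex_def by (auto intro!: arg_cong[where f = det] eq_matI)

lemma alex_mat_fun_mat: "alex_mat (fun_mat n m) = alex n m"
  unfolding alex_mat_def by (auto intro: alex_cong)

lemma det_congruence:
  fixes p A :: "nat \<Rightarrow> nat \<Rightarrow> 'a::comm_ring_1"
  shows "det (mat n n (\<lambda>(i, j). \<Sum>a<n. \<Sum>b<n. p i a * A a b * p j b)) =
    det (mat n n (\<lambda>(i, j). p i j)) ^ 2 * det (mat n n (\<lambda>(i, j). A i j))"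
proof -
  let ?P = "mat n n (\<lambda>(i, j). p i j)" and ?A = "mat n n (\<lambda>(i, j). A i j)"
  have "mat n n (\<lambda>(i, j). \<Sum>a<n. \<Sum>b<n. p i a * A a b * p j b) = ?P * (?A * transpose_mat ?P)"
    by (rule eq_matI) (simp_all add: scalar_prod_def atLeast0LessThan sum_distrib_left mult.assoc)
  also have "det \<dots> = det ?P * (det ?A * det (transpose_mat ?P))"
    by (simp add: det_mult[of _ n] det_mult[OF _ mult_carrier_mat[of _ n n _ n]])
  finally show ?thesis
    by (simp add: det_transpose[of _ n] power2_eq_square mult_ac)
qed

lemma mat_of_rows_list_2:
  "mat_of_rows_list 2 [[a, b], [c, d]] =
    mat 2 2 (\<lambda>(i, j). if i = 0 then if j = 0 then a else b else if j = 0 then c else d)"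
  by (rule eq_matI) (auto simp: mat_of_rows_list_def less_2_cases_iff)

text \<open>The hypotheses fit row and column enlargements alike: in both cases the two entries met
  by the expansion are \<open>1 + u\<close> and -1, in some order.\<close>

lemma alex_mat_enlargement:
  assumes dims: "dim_row M = n" "dim_row N = n + 2"
    and zero: "\<And>j. j < n + 2 \<Longrightarrow> j \<noteq> 1 \<Longrightarrow> N $$ (0, j) = 0 \<and> N $$ (j, 0) = 0"
    and unit: "(N $$ (0, 1) = 0 \<and> N $$ (1, 0) = 1) \<or> (N $$ (0, 1) = 1 \<and> N $$ (1, 0) = 0)"
    and rest: "\<And>i j. i < n \<Longrightarrow> j < n \<Longrightarrow> N $$ (i + 2, j + 2) = M $$ (i, j)"
  shows "alex_mat M = alex_mat N"
proof -
  let ?E = "\<lambda>N i j. (1 + fps_X) * of_int (N $$ (i, j)) - of_int (N $$ (j, i)) :: rat fps"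
  have "det (mat (n + 2) (n + 2) (\<lambda>(i, j). ?E N i j)) =
      - (?E N 0 1 * ?E N 1 0 * det (mat n n (\<lambda>(i, j). ?E N (i + 2) (j + 2))))"
    by (rule det_enlargement) (use zero in auto)
  also have "mat n n (\<lambda>(i, j). ?E N (i + 2) (j + 2)) = mat n n (\<lambda>(i, j). ?E M i j)"
    by (rule eq_matI) (use rest in auto)
  also have "?E N 0 1 * ?E N 1 0 = - (1 + fps_X)"
    using unit by auto
  finally have "det (mat (n + 2) (n + 2) (\<lambda>(i, j). ?E N i j)) = (1 + fps_X) * det (mat n n (\<lambda>(i, j). ?E M i j))"
    by (simp only: mult_minus_left minus_minus)
  then show ?thesis
    unfolding alex_mat_def alex_def dims by (rule inverse_1_X_cancel[symmetric])
qed

lemma alex_mat_S_move: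
  assumes "S_move M N"
  shows "alex_mat M = alex_mat N"
  using assms
proof cases
  case (congruence n P)
  let ?p = "\<lambda>i j. of_int (P $$ (i, j)) :: rat fps" and ?m = "\<lambda>i j. of_int (M $$ (i, j)) :: rat fps"
  have dims: "dim_row M = n" "dim_row N = n" using congruence by auto
  have N: "N $$ (i, j) = (\<Sum>a<n. \<Sum>b<n. P $$ (i, a) * M $$ (a, b) * P $$ (j, b))" if "i < n" "j < n" for i j
  proof -
    have "N = P * (M * transpose_mat P)" using congruence by (simp add: assoc_mult_mat[of _ n n _ n _ n])
    then show ?thesis
      using congruence that by (simp add: scalar_prod_def atLeast0LessThan sum_distrib_left mult.assoc)
  qed
  have "(1 + fps_X) * of_int (N $$ (i, j)) - of_int (N $$ (j, i)) =
      (\<Sum>a<n. \<Sum>b<n. ?p i a * ((1 + fps_X) * ?m a b - ?m b a) * ?p j b)" if "i < n" "j < n" for i j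
  proof -
    have "of_int (N $$ (j, i)) = (\<Sum>a<n. \<Sum>b<n. ?p i a * ?m b a * ?p j b)"
      unfolding N[OF that(2,1)] by (subst sum.swap) (simp add: mult_ac)
    then show ?thesis
      using that by (simp add: N sum_distrib_left sum_subtractf algebra_simps sum.distrib)
  qed
  then have "mat n n (\<lambda>(i, j). (1 + fps_X) * of_int (N $$ (i, j)) - of_int (N $$ (j, i))) =
      mat n n (\<lambda>(i, j). \<Sum>a<n. \<Sum>b<n. ?p i a * ((1 + fps_X) * ?m a b - ?m b a) * ?p j b)"
    by (intro eq_matI) auto
  moreover have "det (mat n n (\<lambda>(i, j). ?p i j)) ^ 2 = 1"
  proof -
    have "mat n n (\<lambda>(i, j). ?p i j) = map_mat of_int P"
      using congruence by (intro eq_matI) auto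
    then have "det (mat n n (\<lambda>(i, j). ?p i j)) = of_int (det P)"
      by (simp add: of_int_hom.hom_det)
    then show ?thesis using congruence(4) by (auto simp: unimodular_mat_def)
  qed
  ultimately show ?thesis
    unfolding alex_mat_def alex_def dims by (simp add: det_congruence)
next
  case (row_enlargement n C x)
  then show ?thesis
    by (intro alex_mat_enlargement) (auto simp: mat_of_rows_list_2 mat_of_cols_def less_2_cases_iff)
next
  case (column_enlargement n R x)
  then show ?thesis
    by (intro alex_mat_enlargement) (auto simp: mat_of_rows_list_2 mat_of_rows_def less_2_cases_iff)
qed

lemma alex_mat_S_equiv: "S_equiv M N \<Longrightarrow> alex_mat M = alex_mat N"
  by (induction rule: S_equiv.induct) (auto dest: alex_mat_S_move)

section \<open>Finite type functions\<close>

definition has_antisym :: "imat \<Rightarrow> imat \<Rightarrow> bool" where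
  "has_antisym A m \<longleftrightarrow> (\<forall>i j. m i j - m j i = A i j)"

text \<open>\<open>degree_less A k h\<close>: all \<open>k\<close>-fold differences of \<open>h\<close> in symmetric directions vanish on the matrices with
  antisymmetrization \<open>A\<close>, that is, \<open>h\<close> is of degree less than \<open>k\<close>.\<close>

fun degree_less :: "imat \<Rightarrow> nat \<Rightarrow> (imat \<Rightarrow> rat) \<Rightarrow> bool" where
  "degree_less A 0 h \<longleftrightarrow> (\<forall>m. has_antisym A m \<longrightarrow> h m = 0)"
| "degree_less A (Suc k) h \<longleftrightarrow> (\<forall>s. (\<forall>i j. s i j = s j i) \<longrightarrow> degree_less A k (\<lambda>m. h (\<lambda>i j. m i j + s i j) - h m))"

lemma has_antisym_add:
  "has_antisym A m \<Longrightarrow> (\<forall>i j. s i j = s j i) \<Longrightarrow> has_antisym A (\<lambda>i j. m i j + s i j)"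
  unfolding has_antisym_def by (metis add_diff_cancel_right)

lemma degree_less_cong: "(\<And>m. has_antisym A m \<Longrightarrow> h m = h' m) \<Longrightarrow> degree_less A k h = degree_less A k h'"
proof (induction k arbitrary: h h')
  case (Suc k)
  have "degree_less A k (\<lambda>m. h (\<lambda>i j. m i j + s i j) - h m) = degree_less A k (\<lambda>m. h' (\<lambda>i j. m i j + s i j) - h' m)"
    if "\<forall>i j. s i j = s j i" for s
    by (rule Suc.IH) (use Suc.prems has_antisym_add that in auto)
  then show ?case by auto
qed auto

lemma degree_less_Suc: "degree_less A k h \<Longrightarrow> degree_less A (Suc k) h"
proof (induction k arbitrary: h)
  case 0
  then show ?case using has_antisym_add by auto
next
  case (Suc k)
  have "degree_less A (Suc k) (\<lambda>m. h (\<lambda>i j. m i j + s i j) - h m)" if "\<forall>i j. s i j = s j i" for s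
    by (rule Suc.IH) (use Suc.prems that in auto)
  then show ?case by (subst degree_less.simps(2)) blast
qed

lemma degree_less_mono: "degree_less A k h \<Longrightarrow> k \<le> l \<Longrightarrow> degree_less A l h"
proof -
  assume h: "degree_less A k h" and "k \<le> l"
  from \<open>k \<le> l\<close> show "degree_less A l h"
    by (induction l rule: dec_induct) (rule h, rule degree_less_Suc)
qed

lemma degree_less_const: "degree_less A (Suc k) (\<lambda>_. c)"
  by (rule degree_less_mono[of A 1]) auto

lemma degree_less_zero: "degree_less A k (\<lambda>_. 0)"
  by (rule degree_less_mono[of A 0]) auto

lemma degree_less_add: "degree_less A k h \<Longrightarrow> degree_less A k h' \<Longrightarrow> degree_less A k (\<lambda>m. h m + h' m)"
proof (induction k arbitrary: h h')
  case (Suc k)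
  have "degree_less A k (\<lambda>m. (h (\<lambda>i j. m i j + s i j) - h m) + (h' (\<lambda>i j. m i j + s i j) - h' m))"
    if "\<forall>i j. s i j = s j i" for s
    using Suc.prems that by (intro Suc.IH) auto
  then show ?case by (simp add: algebra_simps)
qed auto

lemma degree_less_sum: "(\<And>i. i \<in> I \<Longrightarrow> degree_less A k (h i)) \<Longrightarrow> degree_less A k (\<lambda>m. \<Sum>i\<in>I. h i m)"
  by (induction I rule: infinite_finite_induct) (auto intro: degree_less_zero degree_less_add)

lemma degree_less_shift: "degree_less A k h \<Longrightarrow> (\<forall>i j. t i j = t j i) \<Longrightarrow> degree_less A k (\<lambda>m. h (\<lambda>i j. m i j + t i j))"
proof (induction k arbitrary: h)
  case 0
  then show ?case using has_antisym_add by auto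
next
  case (Suc k)
  have "degree_less A k (\<lambda>m. h (\<lambda>i j. m i j + s i j + t i j) - h (\<lambda>i j. m i j + t i j))"
    if s: "\<forall>i j. s i j = s j i" for s
  proof -
    have "degree_less A k (\<lambda>m. h (\<lambda>i j. m i j + s i j) - h m)" using Suc.prems(1) s by simp
    from Suc.IH[OF this Suc.prems(2)] show ?thesis by (simp add: add_ac)
  qed
  then show ?case by simp
qed

text \<open>The discrete Leibniz rule: the difference of a product is
  \<open>(D h) h' + h (D h')\<close> with \<open>h'\<close> translated in the first term. Degrees
  below \<open>a\<close> and \<open>b\<close> add up to one below \<open>a + b - 1\<close>; if a
  bound is 0, that factor is zero and truncated subtraction does no harm.\<close>

lemma degree_less_mult: "degree_less A a h \<Longrightarrow> degree_less A b h' \<Longrightarrow> degree_less A (a + b - 1) (\<lambda>m. h m * h' m)"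
proof (induction "a + b" arbitrary: a b h h' rule: less_induct)
  case less
  show ?case
  proof (cases "a = 0 \<or> b = 0")
    case True
    then have "degree_less A 0 (\<lambda>m. h m * h' m)" using less.prems by auto
    then show ?thesis by (rule degree_less_mono) simp
  next
    case False
    then obtain a' b' where ab: "a = Suc a'" "b = Suc b'" by (metis not0_implies_Suc)
    have "degree_less A (a' + b') (\<lambda>m. h (\<lambda>i j. m i j + s i j) * h' (\<lambda>i j. m i j + s i j) - h m * h' m)"
      if s: "\<forall>i j. s i j = s j i" for s
    proof -
      have 1: "degree_less A a' (\<lambda>m. h (\<lambda>i j. m i j + s i j) - h m)" and 2: "degree_less A b' (\<lambda>m. h' (\<lambda>i j. m i j + s i j) - h' m)"
        using less.prems ab s by auto
      have "degree_less A (a' + b') (\<lambda>m. (h (\<lambda>i j. m i j + s i j) - h m) * h' (\<lambda>i j. m i j + s i j))"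
        using less.hyps[OF _ 1 degree_less_shift[OF less.prems(2) s]] ab by simp
      moreover have "degree_less A (a' + b') (\<lambda>m. h m * (h' (\<lambda>i j. m i j + s i j) - h' m))"
        using less.hyps[OF _ less.prems(1) 2] ab by simp
      ultimately have "degree_less A (a' + b') (\<lambda>m. (h (\<lambda>i j. m i j + s i j) - h m) * h' (\<lambda>i j. m i j + s i j) +
          h m * (h' (\<lambda>i j. m i j + s i j) - h' m))"
        by (rule degree_less_add)
      then show ?thesis by (simp add: algebra_simps)
    qed
    then show ?thesis by (simp add: ab)
  qed
qed

lemma degree_less_scale: "degree_less A k h \<Longrightarrow> degree_less A k (\<lambda>m. c * h m)"
  using degree_less_mult[OF degree_less_const[of A 0 c], of k h] by simp

text \<open>A growth condition that survives products, since exponents of \<open>u\<close> and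
  degrees add up in the same way.\<close>

definition coeffs_degree :: "imat \<Rightarrow> (imat \<Rightarrow> rat fps) \<Rightarrow> bool" where
  "coeffs_degree A F \<longleftrightarrow> (\<forall>n. degree_less A (Suc n) (\<lambda>m. F m $ n))"

lemma coeffs_degree_const: "coeffs_degree A (\<lambda>_. c)"
  unfolding coeffs_degree_def by (blast intro: degree_less_const)

lemma coeffs_degree_mult: "coeffs_degree A F \<Longrightarrow> coeffs_degree A G \<Longrightarrow> coeffs_degree A (\<lambda>m. F m * G m)"
  unfolding coeffs_degree_def
proof
  fix n assume FG: "\<forall>n. degree_less A (Suc n) (\<lambda>m. F m $ n)" "\<forall>n. degree_less A (Suc n) (\<lambda>m. G m $ n)"
  have "degree_less A (Suc n) (\<lambda>m. F m $ i * G m $ (n - i))" if "i \<in> {0..n}" for i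
  proof -
    have "degree_less A (Suc i + Suc (n - i) - 1) (\<lambda>m. F m $ i * G m $ (n - i))"
      by (rule degree_less_mult) (use FG in blast)+
    then show ?thesis using that by simp
  qed
  then show "degree_less A (Suc n) (\<lambda>m. (F m * G m) $ n)"
    unfolding fps_mult_nth by (rule degree_less_sum)
qed

lemma coeffs_degree_sum: "(\<And>i. i \<in> I \<Longrightarrow> coeffs_degree A (F i)) \<Longrightarrow> coeffs_degree A (\<lambda>m. \<Sum>i\<in>I. F i m)"
  unfolding coeffs_degree_def fps_sum_nth by (intro allI degree_less_sum) blast

lemma coeffs_degree_prod: "(\<And>i. i \<in> I \<Longrightarrow> coeffs_degree A (F i)) \<Longrightarrow> coeffs_degree A (\<lambda>m. \<Prod>i\<in>I. F i m)"
  by (induction I rule: infinite_finite_induct) (auto intro: coeffs_degree_const coeffs_degree_mult)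

text \<open>The entry is \<open>(m i j - m j i) + u * m i j\<close>: its constant term is fixed by
  \<open>A\<close>, and only the coefficient of \<open>u\<close> varies, linearly. This is the
  source of all the degree bounds.\<close>

lemma coeffs_degree_entry: "coeffs_degree A (\<lambda>m. (1 + fps_X) * of_int (m i j) - of_int (m j i))"
  unfolding coeffs_degree_def
proof
  fix n
  have eq: "((1 + fps_X) * of_int x - of_int y :: rat fps) $ n =
      (if n = 0 then of_int (x - y) else if n = 1 then of_int x else 0)" for x y
    by (auto simp: distrib_right fps_of_int[symmetric])
  have "degree_less A 1 (\<lambda>m. of_int (m i j - m j i))"
    by auto
  moreover have "degree_less A 2 (\<lambda>m. of_int (m i j))"
    by (simp add: numeral_2_eq_2)
  ultimately show "degree_less A (Suc n) (\<lambda>m. ((1 + fps_X) * of_int (m i j) - of_int (m j i)) $ n)"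
    unfolding eq by (cases "n = 0"; cases "n = 1") (auto intro: degree_less_zero simp: numeral_2_eq_2 simp del: degree_less.simps)
qed

lemma coeffs_degree_alex: "coeffs_degree A (alex n)"
proof -
  have "alex n = (\<lambda>m. (\<Sum>p\<in>{p. p permutes {0..<n}}. signof p *
      (\<Prod>i\<in>{0..<n}. (1 + fps_X) * of_int (m i (p i)) - of_int (m (p i) i))) * inverse (1 + fps_X) ^ (n div 2))"
  proof
    fix m
    have "(\<Sum>p\<in>{p. p permutes {0..<n}}. signof p *
        (\<Prod>i\<in>{0..<n}. mat n n (\<lambda>(i, j). (1 + fps_X) * of_int (m i j) - of_int (m j i)) $$ (i, p i))) =
      (\<Sum>p\<in>{p. p permutes {0..<n}}. signof p *
        (\<Prod>i\<in>{0..<n}. (1 + fps_X) * of_int (m i (p i)) - of_int (m (p i) i) :: rat fps))"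
    proof (intro sum.cong HOL.refl arg_cong2[where f = "(*)"] prod.cong)
      fix p i assume "p \<in> {p. p permutes {0..<n}}" "i \<in> {0..<n}"
      then show "mat n n (\<lambda>(i, j). (1 + fps_X) * of_int (m i j) - of_int (m j i)) $$ (i, p i) =
          (1 + fps_X) * of_int (m i (p i)) - of_int (m (p i) i)"
        using permutes_in_image[of p "{0..<n}" i] by auto
    qed
    then show "alex n m = (\<Sum>p\<in>{p. p permutes {0..<n}}. signof p *
      (\<Prod>i\<in>{0..<n}. (1 + fps_X) * of_int (m i (p i)) - of_int (m (p i) i))) * inverse (1 + fps_X) ^ (n div 2)"
      unfolding alex_def by (subst det_def'[of _ n]) auto
  qed
  then show ?thesis
    by (simp only:) (intro coeffs_degree_mult coeffs_degree_sum coeffs_degree_prod coeffs_degree_const coeffs_degree_entry)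
qed

section \<open>Coefficients of the logarithmic derivative as finite type functions\<close>

definition log_deriv :: "rat fps \<Rightarrow> rat fps" where
  "log_deriv f = fps_X * fps_deriv f * inverse f"

text \<open>Newton's identities, read off from \<open>log_deriv f * f = u f'\<close>. They avoid the
  coefficients of the inverse series, so that degree bounds follow by induction.\<close>

lemma log_deriv_recursion:
  assumes "f $ 0 \<noteq> 0"
  shows "log_deriv f $ n = (of_nat n * f $ n - (\<Sum>i<n. log_deriv f $ i * f $ (n - i))) / f $ 0"
proof -
  have "log_deriv f * f = fps_X * fps_deriv f"
    unfolding log_deriv_def using inverse_mult_eq_1[OF assms] by (simp add: mult.assoc)
  then have "(log_deriv f * f) $ n = of_nat n * f $ n"
    by (cases n) (auto simp: fps_deriv_nth simp flip: of_nat_Suc)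
  also have "(log_deriv f * f) $ n = (\<Sum>i<n. log_deriv f $ i * f $ (n - i)) + log_deriv f $ n * f $ 0"
    unfolding fps_mult_nth by (simp add: atLeast0AtMost lessThan_Suc_atMost[symmetric])
  finally show ?thesis using assms by (simp add: field_simps)
qed

lemma degree_less_log_deriv:
  assumes m0: "has_antisym A m0" "alex N m0 $ 0 \<noteq> 0"
  shows "degree_less A (Suc n) (\<lambda>m. log_deriv (alex N m) $ n)"
proof (induction n rule: less_induct)
  case (less n)
  have F: "degree_less A (Suc k) (\<lambda>m. alex N m $ k)" for k
    using coeffs_degree_alex[of A N] by (simp add: coeffs_degree_def)
  \<comment> \<open>The constant term of \<open>\<Delta>\<close> depends only on \<open>A\<close>,
    so the recursion divides by a constant.\<close>
  have const: "alex N m $ 0 = alex N m0 $ 0" if "has_antisym A m" for m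
  proof -
    let ?s = "\<lambda>i j. m i j - m0 i j"
    have "?s i j = ?s j i" for i j
    proof -
      have "m i j - m j i = m0 i j - m0 j i" using that m0(1) unfolding has_antisym_def by metis
      then show ?thesis by simp
    qed
    from F[of 0, unfolded degree_less.simps, rule_format, of ?s, OF this m0(1)]
    have "alex N (\<lambda>i j. m0 i j + ?s i j) $ 0 - alex N m0 $ 0 = 0" .
    then show ?thesis by simp
  qed
  have "degree_less A (Suc n) (\<lambda>m. inverse (alex N m0 $ 0) *
      (of_nat n * alex N m $ n + - 1 * (\<Sum>i<n. log_deriv (alex N m) $ i * alex N m $ (n - i))))"
  proof (intro degree_less_scale degree_less_add degree_less_sum F)
    fix i assume i: "i \<in> {..<n}"
    have "degree_less A (Suc i + Suc (n - i) - 1) (\<lambda>m. log_deriv (alex N m) $ i * alex N m $ (n - i))"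
      by (rule degree_less_mult) (use i less F in auto)
    then show "degree_less A (Suc n) (\<lambda>m. log_deriv (alex N m) $ i * alex N m $ (n - i))" using i by simp
  qed
  moreover have "log_deriv (alex N m) $ n = inverse (alex N m0 $ 0) *
      (of_nat n * alex N m $ n + - 1 * (\<Sum>i<n. log_deriv (alex N m) $ i * alex N m $ (n - i)))"
    if "has_antisym A m" for m
    using log_deriv_recursion[of "alex N m" n] const[OF that] m0(2) by (simp add: divide_inverse)
  ultimately show ?case using degree_less_cong by (metis (no_types, lifting))
qed

text \<open>Up to a sign, the alternating sum over the subsets of \<open>I\<close> is an iterated
  difference with one step for each element of \<open>I\<close>.\<close>

lemma degree_less_altsum:
  assumes "finite I" "degree_less A (card I) h" "has_antisym A m" "\<And>k. k \<in> I \<Longrightarrow> \<forall>i j. s k i j = s k j i"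
  shows "(\<Sum>X\<in>Pow I. (-1) ^ card X * h (plus_sum m s X)) = 0"
  using assms
proof (induction I arbitrary: h rule: finite_induct)
  case empty
  then show ?case by (simp add: plus_sum_def)
next
  case (insert x I)
  let ?h = "\<lambda>m. h (\<lambda>i j. m i j + s x i j)"
  have "(\<Sum>X\<in>Pow I. (-1) ^ card (insert x X) * h (plus_sum m s (insert x X))) =
    (\<Sum>X\<in>Pow I. - ((-1) ^ card X * ?h (plus_sum m s X)))"
  proof (rule sum.cong)
    fix X assume "X \<in> Pow I"
    then have X: "finite X" "x \<notin> X" using insert.hyps finite_subset by auto
    then have "plus_sum m s (insert x X) = (\<lambda>i j. plus_sum m s X i j + s x i j)"
      unfolding plus_sum_def by (simp add: add_ac)
    then show "(-1) ^ card (insert x X) * h (plus_sum m s (insert x X)) = - ((-1) ^ card X * ?h (plus_sum m s X))"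
      using X by simp
  qed simp
  then have "(\<Sum>X\<in>Pow (insert x I). (-1) ^ card X * h (plus_sum m s X)) =
    - (\<Sum>X\<in>Pow I. (-1) ^ card X * (?h (plus_sum m s X) - h (plus_sum m s X)))"
    by (simp add: sum_Pow_insert insert.hyps right_diff_distrib sum_subtractf sum_negf)
  also have "\<dots> = 0"
    using insert.IH[of "\<lambda>m. ?h m - h m"] insert.prems insert.hyps by simp
  finally show ?case .
qed

section \<open>Linear functionals\<close>

definition lin_ext :: "(S_class \<Rightarrow> rat) \<Rightarrow> (S_class \<Rightarrow>\<^sub>0 rat) \<Rightarrow> rat" where
  "lin_ext f x = (\<Sum>c\<in>Poly_Mapping.keys x. Poly_Mapping.lookup x c * f c)"

lemma lin_ext_superset:
  "finite F \<Longrightarrow> Poly_Mapping.keys x \<subseteq> F \<Longrightarrow> lin_ext f x = (\<Sum>c\<in>F. Poly_Mapping.lookup x c * f c)"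
  unfolding lin_ext_def by (rule sum.mono_neutral_left) (auto simp: in_keys_iff)

lemma lin_ext_add: "lin_ext f (x + y) = lin_ext f x + lin_ext f y"
proof -
  let ?F = "Poly_Mapping.keys x \<union> Poly_Mapping.keys y"
  have "lin_ext f (x + y) = (\<Sum>c\<in>?F. Poly_Mapping.lookup (x + y) c * f c)"
    using Poly_Mapping.keys_add[of x y] by (intro lin_ext_superset) auto
  also have "\<dots> = lin_ext f x + lin_ext f y"
    by (simp add: lin_ext_superset[of ?F] lookup_add distrib_right sum.distrib)
  finally show ?thesis .
qed

lemma lin_ext_zero [simp]: "lin_ext f 0 = 0"
  by (simp add: lin_ext_def)

lemma lin_ext_scale: "lin_ext f (pm_scale c x) = c * lin_ext f x"
proof -
  have "lin_ext f (pm_scale c x) = (\<Sum>k\<in>Poly_Mapping.keys x. Poly_Mapping.lookup (pm_scale c x) k * f k)"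
    by (rule lin_ext_superset) (auto simp: in_keys_iff lookup_pm_scale)
  then show ?thesis by (simp add: lookup_pm_scale lin_ext_def sum_distrib_left mult.assoc)
qed

lemma lin_ext_sum: "lin_ext f (\<Sum>i\<in>I. x i) = (\<Sum>i\<in>I. lin_ext f (x i))"
  by (induction I rule: infinite_finite_induct) (auto simp: lin_ext_add)

lemma lin_ext_single: "lin_ext f (Poly_Mapping.single c q) = q * f c"
  by (cases "q = 0") (simp_all add: lin_ext_def)

text \<open>Evaluated on a chosen representative; invariance of \<open>\<Delta>\<close> makes the
  choice immaterial.\<close>

definition log_inv :: "nat list \<Rightarrow> S_class \<Rightarrow> rat" where
  "log_inv es c = prod_list (map (\<lambda>e. log_deriv (alex_mat (rep_S_class c)) $ e) es)"

lemma log_inv_S_cls: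
  assumes "seifert n m"
  shows "log_inv es (S_cls n m) = prod_list (map (\<lambda>e. log_deriv (alex n m) $ e) es)"
proof -
  have "S_equiv (rep_S_class (abs_S_class (fun_mat n m))) (fun_mat n m)"
    by (rule Quotient3_rep_abs[OF Quotient3_S_class]) (use assms in \<open>auto simp: seifert_def intro: S_equiv.refl\<close>)
  then have "alex_mat (rep_S_class (S_cls n m)) = alex n m"
    unfolding S_cls_def using alex_mat_S_equiv alex_mat_fun_mat by metis
  then show ?thesis by (simp add: log_inv_def)
qed

lemma lin_ext_log_inv_altsum:
  assumes "seifert n m" "\<And>k. k \<in> I \<Longrightarrow> symm n (s k)"
  shows "lin_ext (log_inv es) (altsum n I s m) =
    (\<Sum>X\<in>Pow I. (-1) ^ card X * prod_list (map (\<lambda>e. log_deriv (alex n (plus_sum m s X)) $ e) es))"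
  unfolding altsum_def lin_ext_sum lin_ext_single
proof (rule sum.cong)
  fix X assume "X \<in> Pow I"
  then have "seifert n (plus_sum m s X)" using assms by (intro seifert_plus_sum) auto
  then show "(-1) ^ card X * log_inv es (S_cls n (plus_sum m s X)) =
    (-1) ^ card X * prod_list (map (\<lambda>e. log_deriv (alex n (plus_sum m s X)) $ e) es)"
    by (simp add: log_inv_S_cls)
qed simp

lemma alex_nth_0: "alex n m $ 0 = of_int (det (fun_mat n (\<lambda>i j. m i j - m j i)))"
proof -
  interpret h: comm_ring_hom "\<lambda>f :: rat fps. f $ 0"
    by unfold_locales auto
  let ?E = "mat n n (\<lambda>(i, j). (1 + fps_X) * of_int (m i j) - of_int (m j i)) :: rat fps mat"
  have "map_mat (\<lambda>f. f $ 0) ?E = map_mat of_int (fun_mat n (\<lambda>i j. m i j - m j i))"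
    by (rule eq_matI) (auto simp: fps_of_int[symmetric])
  then have "det ?E $ 0 = of_int (det (fun_mat n (\<lambda>i j. m i j - m j i)))"
    by (simp only: h.hom_det[symmetric] of_int_hom.hom_det)
  then show ?thesis by (simp add: alex_def fps_power_zeroth)
qed

lemma degree_less_log_inv:
  assumes "has_antisym A m0" "alex N m0 $ 0 \<noteq> 0"
  shows "degree_less A (Suc (sum_list es)) (\<lambda>m. prod_list (map (\<lambda>e. log_deriv (alex N m) $ e) es))"
proof (induction es)
  case Nil
  then show ?case using degree_less_const[of A 0 1] by simp
next
  case (Cons e es)
  show ?case using degree_less_mult[OF degree_less_log_deriv[OF assms, of e] Cons] by simp
qed

text \<open>Consequently a product of total degree \<open>d\<close> induces a functional modulo
  \<open>S_filt (Suc d)\<close>; these functionals will separate the cycle types.\<close>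

theorem log_inv_finite_type:
  assumes "x \<in> S_filt (Suc (sum_list es))"
  shows "lin_ext (log_inv es) x = 0"
proof -
  have "pm.subspace {x. lin_ext (log_inv es) x = 0}"
    by (rule pm.subspaceI) (auto simp: lin_ext_add lin_ext_scale)
  moreover have "lin_ext (log_inv es) (alternating_sum M d i) = 0"
    if M: "M \<in> seifert_mats" "\<forall>k<d. i k < dim_row M" and d: "d = Suc (sum_list es)" for M d i
  proof -
    define n where "n = dim_row M"
    define m where "m = (\<lambda>i j. M $$ (i, j))"
    have Mm: "M = fun_mat n m"
      using M by (intro eq_matI) (auto simp: n_def m_def seifert_mats_def)
    have m: "seifert n m" using M by (simp add: seifert_def Mm)
    define A where "A = (\<lambda>i j. m i j - m j i)"
    have A: "has_antisym A m" by (simp add: has_antisym_def A_def)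
    have "alex n m $ 0 \<noteq> 0" using m by (auto simp: alex_nth_0 seifert_iff)
    then have "degree_less A (card {..<d}) (\<lambda>m. prod_list (map (\<lambda>e. log_deriv (alex n m) $ e) es))"
      using degree_less_log_inv[OF A, of n es] d by simp
    then have "(\<Sum>X\<in>Pow {..<d}. (-1) ^ card X *
        prod_list (map (\<lambda>e. log_deriv (alex n (plus_sum m (\<lambda>k. unit_mat (i k)) X)) $ e) es)) = 0"
      by (intro degree_less_altsum[where A = A] A) (auto simp: unit_mat_def)
    moreover have "symm n (unit_mat c)" for c by (auto simp: symm_def unit_mat_def)
    ultimately show ?thesis
      unfolding Mm alternating_sum_altsum by (simp add: lin_ext_log_inv_altsum[OF m])
  qed
  ultimately have "S_filt (Suc (sum_list es)) \<subseteq> {x. lin_ext (log_inv es) x = 0}"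
    unfolding S_filt_def by (intro pm.span_minimal) auto
  then show ?thesis using assms by blast
qed

section \<open>Logarithmic derivatives\<close>

lemma log_deriv_mult:
  assumes "f $ 0 \<noteq> 0" "g $ 0 \<noteq> 0"
  shows "log_deriv (f * g) = log_deriv f + log_deriv g"
proof -
  have f: "f * inverse f = 1" and g: "g * inverse g = 1"
    using assms by (auto intro: inverse_mult_eq_1')
  have "log_deriv (f * g) = fps_X * (fps_deriv f * g + f * fps_deriv g) * (inverse f * inverse g)"
    by (simp add: log_deriv_def fps_inverse_mult algebra_simps)
  also have "\<dots> = fps_X * fps_deriv f * inverse f * (g * inverse g) + fps_X * fps_deriv g * inverse g * (f * inverse f)"
    by (simp only: algebra_simps)
  finally show ?thesis by (simp add: f g log_deriv_def)
qed

lemma log_deriv_sign: "\<sigma> = 1 \<or> \<sigma> = - 1 \<Longrightarrow> log_deriv \<sigma> = 0"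
proof -
  have "fps_deriv (- 1 :: rat fps) = - fps_deriv 1" by (rule fps_deriv_neg)
  then show "\<sigma> = 1 \<or> \<sigma> = - 1 \<Longrightarrow> log_deriv \<sigma> = 0" by (elim disjE) (simp_all only: log_deriv_def fps_deriv_1 minus_zero mult_zero_left mult_zero_right)
qed

lemma X_deriv_X_power: "fps_X * fps_deriv (fps_X ^ n) = (of_nat n * fps_X ^ n :: rat fps)"
  by (induction n) (simp_all add: algebra_simps)

lemma log_deriv_1_minus:
  assumes n: "0 < n"
  shows "i < n \<Longrightarrow> log_deriv (1 - fps_X ^ n * r) $ i = 0"
    and "log_deriv (1 - fps_X ^ n * r) $ n = - of_nat n * r $ 0"
proof -
  let ?f = "1 - fps_X ^ n * r"
  let ?g = "- (of_nat n * r + fps_X * fps_deriv r) * inverse ?f"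
  have "fps_X * fps_deriv ?f = fps_X ^ n * - (of_nat n * r + fps_X * fps_deriv r)"
  proof -
    have "fps_X * fps_deriv ?f = - ((fps_X * fps_deriv (fps_X ^ n)) * r) - fps_X ^ n * (fps_X * fps_deriv r)"
      by (simp add: algebra_simps del: fps_deriv_power)
    then show ?thesis by (simp only: X_deriv_X_power) (simp add: algebra_simps)
  qed
  then have e: "log_deriv ?f = fps_X ^ n * ?g" by (simp only: log_deriv_def mult.assoc)
  show "i < n \<Longrightarrow> log_deriv ?f $ i = 0" unfolding e by (simp add: fps_X_power_mult_nth)
  have "?g $ 0 = - (of_nat n * r $ 0)" using n by (simp add: fps_mult_nth_0 flip: fps_of_nat)
  then show "log_deriv ?f $ n = - of_nat n * r $ 0" unfolding e by (simp only: fps_X_power_mult_nth) simp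
qed

text \<open>The contribution of a complete even cycle, from its two block determinants
  \<open>1 - u^n\<close> and \<open>(1 + u)^n - u^n\<close>, the latter divided by
  \<open>(1 + u)^n\<close>. Each of the two terms begins with \<open>-n u^n\<close>.\<close>

definition cyc_log :: "nat \<Rightarrow> rat fps" where
  "cyc_log n = log_deriv (1 - fps_X ^ n) + log_deriv (1 - fps_X ^ n * inverse (1 + fps_X) ^ n)"

lemma cyc_log_nth:
  assumes "0 < n"
  shows "i < n \<Longrightarrow> cyc_log n $ i = 0" "cyc_log n $ n = - 2 * of_nat n"
  using log_deriv_1_minus(1)[OF assms, of i 1] log_deriv_1_minus(1)[OF assms, of i "inverse (1 + fps_X) ^ n"]
    log_deriv_1_minus(2)[OF assms, of 1] log_deriv_1_minus(2)[OF assms, of "inverse (1 + fps_X) ^ n"]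
  by (simp_all add: cyc_log_def fps_power_zeroth)

section \<open>The Alexander polynomial of a union of cycles\<close>

text \<open>For \<open>n > 1\<close>, row 0 has entries only in columns 0 and \<open>n - 1\<close>,
  and both minors are triangular; they contribute the identity and the full cycle.\<close>

lemma det_cycle:
  fixes a :: "'a :: comm_ring_1"
  assumes "0 < n"
  shows "det (mat n n (\<lambda>(i, j). (if i = j then a else 0) + (if i = cyc_succ [n] j then w j else 0))) =
    a ^ n - (-1) ^ n * (\<Prod>j<n. w j)"
proof (cases "n = 1")
  case True
  then show ?thesis by (simp add: det_single[of _])
next
  case False
  then obtain k where k: "n = Suc (Suc k)" using assms by (metis One_nat_def gr0_implies_Suc not_less_eq less_one nat_neq_iff neq0_conv)
  let ?e = "\<lambda>i j. (if i = j then a else 0) + (if i = cyc_succ [n] j then w j else 0)"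
  define A where "A = mat n n (\<lambda>(i, j). ?e i j)"
  have A: "A $$ (i, j) = ?e i j" if "i < n" "j < n" for i j using that by (simp add: A_def)
  have dA: "dim_row A = n" "dim_col A = n" by (simp_all add: A_def)
  have succ_eq: "cyc_succ [n] j = (if j = Suc k then 0 else Suc j)"
    "cyc_succ [Suc (Suc k)] j = (if j = Suc k then 0 else Suc j)" for j by (auto simp: k)
  have "det A = (\<Sum>j<n. A $$ (0, j) * cofactor A 0 j)"
    by (rule laplace_expansion_row) (use assms in \<open>auto simp: A_def\<close>)
  also have "\<dots> = A $$ (0, 0) * cofactor A 0 0 + A $$ (0, Suc k) * cofactor A 0 (Suc k)"
  proof -
    have "(\<Sum>j<n. A $$ (0, j) * cofactor A 0 j) =
        (\<Sum>j\<in>{0, Suc k}. A $$ (0, j) * cofactor A 0 j)"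
      by (rule sum.mono_neutral_right) (auto simp: k A succ_eq simp del: cyc_succ.simps)
    then show ?thesis by simp
  qed
  also have "cofactor A 0 0 = a ^ Suc k"
  proof -
    let ?B = "mat_delete A 0 0"
    have B: "?B \<in> carrier_mat (Suc k) (Suc k)" using mat_delete_carrier[of A n n] by (simp add: A_def k)
    have Be: "?B $$ (i, j) = ?e (Suc i) (Suc j)" if "i < Suc k" "j < Suc k" for i j
      using that by (simp add: mat_delete_def A dA k del: cyc_succ.simps)
    have "det ?B = prod_list (diag_mat ?B)"
      by (rule det_lower_triangular[OF _ B]) (auto simp: Be succ_eq simp del: cyc_succ.simps)
    also have "diag_mat ?B = map (\<lambda>i. a) [0..<Suc k]"
      unfolding diag_mat_def carrier_matD(1)[OF B] by (rule map_cong) (auto simp: Be succ_eq simp del: cyc_succ.simps)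
    also have "prod_list (map (\<lambda>i. a) [0..<Suc k]) = a ^ Suc k"
      by (simp only: map_replicate_const length_upt prod_list_replicate) simp
    finally show ?thesis by (simp add: cofactor_def)
  qed
  also have "cofactor A 0 (Suc k) = (-1) ^ Suc k * (\<Prod>j<Suc k. w j)"
  proof -
    let ?B = "mat_delete A 0 (Suc k)"
    have B: "?B \<in> carrier_mat (Suc k) (Suc k)" using mat_delete_carrier[of A n n] by (simp add: A_def k)
    have Be: "?B $$ (i, j) = ?e (Suc i) j" if "i < Suc k" "j < Suc k" for i j
      using that by (simp add: mat_delete_def A dA k del: cyc_succ.simps)
    have "det ?B = prod_list (diag_mat ?B)"
      by (rule det_upper_triangular[OF upper_triangularI B])
        (use B in \<open>auto simp: Be succ_eq simp del: cyc_succ.simps\<close>)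
    also have "diag_mat ?B = map w [0..<Suc k]"
      unfolding diag_mat_def carrier_matD(1)[OF B] by (rule map_cong) (auto simp: Be succ_eq simp del: cyc_succ.simps)
    also have "prod_list (map w [0..<Suc k]) = (\<Prod>j<Suc k. w j)"
      by (simp only: prod.distinct_set_conv_list[symmetric] distinct_upt set_upt atLeast0LessThan)
    finally show ?thesis by (simp add: cofactor_def)
  qed
  also have "A $$ (0, 0) = a" by (simp add: A k)
  also have "A $$ (0, Suc k) = w (Suc k)" by (simp add: A k)
  finally show ?thesis by (simp add: A_def k mult_ac)
qed

text \<open>Listing even indices before odd ones gives a block antidiagonal matrix, and exchanging
  its block columns a block diagonal one. The sign is left open because a logarithmic derivative
  does not see it.\<close>

lemma det_interleaved:
  fixes E :: "nat \<Rightarrow> nat \<Rightarrow> 'a::idom"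
  assumes E: "\<And>i j. E (2 * i) (2 * j) = 0" "\<And>i j. E (2 * i + 1) (2 * j + 1) = 0"
  shows "\<exists>\<sigma>. (\<sigma> = 1 \<or> \<sigma> = - 1) \<and> det (mat (2 * n) (2 * n) (\<lambda>(i, j). E i j)) =
    \<sigma> * (det (mat n n (\<lambda>(i, j). E (2 * i) (2 * j + 1))) * det (mat n n (\<lambda>(i, j). E (2 * i + 1) (2 * j))))"
proof -
  define N where "N = 2 * n"
  define \<pi> where "\<pi> i = (if i < n then 2 * i else 2 * (i - n) + 1)" for i
  let ?p = "\<lambda>i a. of_bool (a = \<pi> i) :: 'a"
  let ?P = "mat N N (\<lambda>(i, a). ?p i a)"
  let ?B = "mat n n (\<lambda>(i, j). E (2 * i) (2 * j + 1))" and ?C = "mat n n (\<lambda>(i, j). E (2 * i + 1) (2 * j))"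
  have pN: "\<pi> i < N" if "i < N" for i using that by (auto simp: \<pi>_def N_def)
  have pinj: "\<pi> i = \<pi> j \<longleftrightarrow> i = j" if "i < N" "j < N" for i j
    using that by (auto simp: \<pi>_def N_def split: if_splits) presburger+
  have "?P * transpose_mat ?P = 1\<^sub>m N"
  proof (rule eq_matI)
    fix i j assume ij: "i < dim_row (1\<^sub>m N)" "j < dim_col (1\<^sub>m N)"
    then have "(?P * transpose_mat ?P) $$ (i, j) = (\<Sum>a<N. ?p i a * ?p j a)"
      by (simp add: scalar_prod_def atLeast0LessThan)
    also have "\<dots> = ?p j (\<pi> i)"
      by (subst sum_lessThan_unique[of "\<pi> i"]) (use ij pN in auto)
    finally show "(?P * transpose_mat ?P) $$ (i, j) = 1\<^sub>m N $$ (i, j)"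
      using ij pinj[of i j] by auto
  qed auto
  then have "det ?P * det (transpose_mat ?P) = 1"
    using det_mult[of ?P N "transpose_mat ?P"] by simp
  then have dP: "det ?P ^ 2 = 1" by (simp add: det_transpose[of _ N] power2_eq_square)
  have "mat N N (\<lambda>(i, j). \<Sum>a<N. \<Sum>b<N. ?p i a * E a b * ?p j b) = mat N N (\<lambda>(i, j). E (\<pi> i) (\<pi> j))"
  proof (rule eq_matI)
    fix i j assume "i < dim_row (mat N N (\<lambda>(i, j). E (\<pi> i) (\<pi> j)))" "j < dim_col (mat N N (\<lambda>(i, j). E (\<pi> i) (\<pi> j)))"
    then have ij: "i < N" "j < N" by auto
    have "(\<Sum>a<N. \<Sum>b<N. ?p i a * E a b * ?p j b) = (\<Sum>b<N. ?p i (\<pi> i) * E (\<pi> i) b * ?p j b)"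
      by (rule sum_lessThan_unique) (use ij pN in auto)
    also have "\<dots> = ?p i (\<pi> i) * E (\<pi> i) (\<pi> j) * ?p j (\<pi> j)"
      by (rule sum_lessThan_unique) (use ij pN in auto)
    finally show "mat N N (\<lambda>(i, j). \<Sum>a<N. \<Sum>b<N. ?p i a * E a b * ?p j b) $$ (i, j) =
      mat N N (\<lambda>(i, j). E (\<pi> i) (\<pi> j)) $$ (i, j)" using ij by simp
  qed auto
  then have 1: "det (mat N N (\<lambda>(i, j). E i j)) = det (mat N N (\<lambda>(i, j). E (\<pi> i) (\<pi> j)))"
    using det_congruence[of N ?p E] dP by simp
  let ?Z = "0\<^sub>m n n :: 'a mat" and ?I = "1\<^sub>m n :: 'a mat"
  have 2: "mat N N (\<lambda>(i, j). E (\<pi> i) (\<pi> j)) = four_block_mat ?Z ?B ?C ?Z"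
    by (rule eq_matI) (auto simp: \<pi>_def N_def E E[simplified])
  define S where "S = four_block_mat ?Z ?I ?I ?Z"
  have S: "S \<in> carrier_mat (n + n) (n + n)" unfolding S_def by (rule four_block_carrier_mat) auto
  have "S * S = 1\<^sub>m (n + n)"
    unfolding S_def by (subst mult_four_block_mat[of _ n n _ n _ n _ _ n _ n]) (auto simp flip: four_block_one_mat)
  then have "det S * det S = 1" using det_mult[OF S S] by simp
  then have sS: "det S = 1 \<or> det S = - 1" by (simp add: square_eq_1_iff)
  have "four_block_mat ?Z ?B ?C ?Z * S = four_block_mat ?B ?Z ?Z ?C"
    unfolding S_def by (subst mult_four_block_mat[of _ n n _ n _ n _ _ n _ n]) auto
  moreover have "four_block_mat ?Z ?B ?C ?Z \<in> carrier_mat (n + n) (n + n)" by (rule four_block_carrier_mat) auto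
  ultimately have "det (four_block_mat ?Z ?B ?C ?Z) * det S = det (four_block_mat ?B ?Z ?Z ?C)"
    using det_mult[OF _ S] by metis
  also have "\<dots> = det ?B * det ?C"
    by (rule det_four_block_mat_upper_right_zero) auto
  finally have "det (four_block_mat ?Z ?B ?C ?Z) = det S * (det ?B * det ?C)"
    using sS by (auto simp: minus_equation_iff)
  then show ?thesis
    using 1 2 sS unfolding N_def by (intro exI[of _ "det S"]) simp
qed

lemma alex_block:
  assumes "even n" and z: "\<And>i j. i < n \<Longrightarrow> n \<le> j \<Longrightarrow> j < n + k \<Longrightarrow> m i j = 0 \<and> m j i = 0"
  shows "alex (n + k) m = alex n m * alex k (\<lambda>i j. m (i + n) (j + n))"
proof -
  let ?e = "\<lambda>i j. (1 + fps_X) * of_int (m i j) - of_int (m j i) :: rat fps"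
  have "mat (n + k) (n + k) (\<lambda>(i, j). ?e i j) =
    four_block_mat (mat n n (\<lambda>(i, j). ?e i j)) (0\<^sub>m n k) (0\<^sub>m k n) (mat k k (\<lambda>(i, j). ?e (i + n) (j + n)))"
    by (rule eq_matI) (auto simp: z)
  then have "det (mat (n + k) (n + k) (\<lambda>(i, j). ?e i j)) =
    det (mat n n (\<lambda>(i, j). ?e i j)) * det (mat k k (\<lambda>(i, j). ?e (i + n) (j + n)))"
    by (simp add: det_four_block_mat_upper_right_zero[of _ n _ k])
  moreover have "(n + k) div 2 = n div 2 + k div 2" using assms(1) by auto
  ultimately show ?thesis unfolding alex_def by (simp add: power_add mult_ac)
qed

text \<open>Each direction couples the odd coordinate of a vertex to the even coordinate of its
  successor, so that entries between indices of equal parity stay zero and the determinant splits in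
  two.\<close>

definition cyc_mat :: "nat list \<Rightarrow> nat set \<Rightarrow> imat" where
  "cyc_mat rs X = plus_sum std_mat (\<lambda>k. sym_prod (delta (2 * k + 1)) (delta (2 * cyc_succ rs k))) X"

text \<open>Both blocks are a scalar matrix plus \<open>u\<close> times the part of the cyclic
  permutation selected by \<open>X\<close>. If the cycle is incomplete, the product of its weights
  is 0 and \<open>\<Delta>\<close> is just a sign.\<close>

lemma log_deriv_alex_single:
  assumes n: "0 < n" "even n" and X: "X \<subseteq> {..<n}"
  shows "log_deriv (alex (2 * n) (cyc_mat [n] X)) = (if X = {..<n} then cyc_log n else 0)"
proof -
  let ?m = "cyc_mat [n] X"
  define y where "y i j = (of_bool (j \<in> X \<and> i = cyc_succ [n] j) :: int)" for i j
  have fX: "finite X" using X finite_subset by blast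
  have oe: "2 * a + 1 \<noteq> 2 * b" "2 * b \<noteq> 2 * a + 1" for a b :: nat by presburger+
  let ?s = "\<lambda>k. sym_prod (delta (2 * k + 1)) (delta (2 * cyc_succ [n] k))"
  have s_eo: "?s k (2 * i) (2 * j + 1) = (if k = j then of_bool (i = cyc_succ [n] j) else 0)"
    and s_oe: "?s k (2 * j + 1) (2 * i) = (if k = j then of_bool (i = cyc_succ [n] j) else 0)"
    and s_ee: "?s k (2 * i) (2 * j) = 0" and s_oo: "?s k (2 * i + 1) (2 * j + 1) = 0" for i j k
    unfolding sym_prod_def delta_def by (auto simp only: oe of_bool_def if_False if_True mult_zero_left mult_zero_right
        add_0_left add_0_right mult_1_left mult_1_right add_right_cancel mult_cancel1 simp_thms split: if_splits)
  have m_eo: "?m (2 * i) (2 * j + 1) = y i j"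
    and m_oe: "?m (2 * j + 1) (2 * i) = of_bool (i = j) + y i j"
    and m_ee: "?m (2 * i) (2 * j) = 0" and m_oo: "?m (2 * i + 1) (2 * j + 1) = 0" for i j
    unfolding cyc_mat_def plus_sum_def s_eo s_oe s_ee s_oo using fX by (auto simp: std_mat_def y_def oe[unfolded Suc_eq_plus1[symmetric]] simp del: cyc_succ.simps)
  let ?E = "\<lambda>i j. (1 + fps_X) * of_int (?m i j) - of_int (?m j i) :: rat fps"
  have "\<exists>\<sigma>. (\<sigma> = 1 \<or> \<sigma> = - 1) \<and> det (mat (2 * n) (2 * n) (\<lambda>(i, j). ?E i j)) =
    \<sigma> * (det (mat n n (\<lambda>(i, j). ?E (2 * i) (2 * j + 1))) * det (mat n n (\<lambda>(i, j). ?E (2 * i + 1) (2 * j))))"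
    by (rule det_interleaved) (simp_all only: m_ee m_oo of_int_0 mult_zero_right diff_zero)
  then obtain \<sigma> where \<sigma>: "\<sigma> = 1 \<or> \<sigma> = - 1" and dE: "det (mat (2 * n) (2 * n) (\<lambda>(i, j). ?E i j)) =
    \<sigma> * (det (mat n n (\<lambda>(i, j). ?E (2 * i) (2 * j + 1))) * det (mat n n (\<lambda>(i, j). ?E (2 * i + 1) (2 * j))))"
    by blast
  let ?w = "\<lambda>j. if j \<in> X then fps_X else 0 :: rat fps"
  let ?P = "if X = {..<n} then fps_X ^ n else 0 :: rat fps"
  have w: "(\<Prod>j<n. ?w j) = ?P"
  proof (cases "X = {..<n}")
    case True
    then show ?thesis by simp
  next
    case False
    then obtain j where "j < n" "j \<notin> X" using X by auto
    then show ?thesis using False by (auto intro: prod_zero)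
  qed
  have "mat n n (\<lambda>(i, j). ?E (2 * i) (2 * j + 1)) =
      mat n n (\<lambda>(i, j). (if i = j then - 1 else 0) + (if i = cyc_succ [n] j then ?w j else 0))"
    by (rule eq_matI, simp_all only: m_eo m_oe) (auto simp: y_def algebra_simps simp del: cyc_succ.simps)
  then have dB: "det (mat n n (\<lambda>(i, j). ?E (2 * i) (2 * j + 1))) = 1 - ?P"
    using n(2) by (simp only: det_cycle[OF n(1)] w) simp
  have "mat n n (\<lambda>(i, j). ?E (2 * i + 1) (2 * j)) = transpose_mat
      (mat n n (\<lambda>(i, j). (if i = j then 1 + fps_X else 0) + (if i = cyc_succ [n] j then ?w j else 0)))"
    by (rule eq_matI, simp_all only: m_eo m_oe) (auto simp: y_def m_eo[unfolded Suc_eq_plus1[symmetric]] m_oe[unfolded Suc_eq_plus1[symmetric]] algebra_simps simp del: cyc_succ.simps)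
  then have dC: "det (mat n n (\<lambda>(i, j). ?E (2 * i + 1) (2 * j))) = (1 + fps_X) ^ n - ?P"
    using n(2) by (simp only: det_transpose[of _ n] det_cycle[OF n(1)] w mat_carrier) simp
  have inv: "(1 + fps_X) ^ n * inverse (1 + fps_X) ^ n = (1 :: rat fps)"
    unfolding power_mult_distrib[symmetric] inverse_1_X by simp
  have "alex (2 * n) ?m = \<sigma> * (1 - ?P) * ((1 + fps_X) ^ n * inverse (1 + fps_X) ^ n - ?P * inverse (1 + fps_X) ^ n)"
    unfolding alex_def dE dB dC by (simp add: algebra_simps)
  then have a: "alex (2 * n) ?m = \<sigma> * ((1 - ?P) * (1 - ?P * inverse (1 + fps_X) ^ n))"
    unfolding inv by (simp only: mult.assoc)
  show ?thesis
  proof (cases "X = {..<n}")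
    case False
    then show ?thesis unfolding a using \<sigma> by (simp add: log_deriv_sign)
  next
    case True
    have s0: "\<sigma> $ 0 \<noteq> 0" using \<sigma> by auto
    have 1: "(1 - fps_X ^ n :: rat fps) $ 0 \<noteq> 0" "(1 - fps_X ^ n * inverse (1 + fps_X) ^ n :: rat fps) $ 0 \<noteq> 0"
      using n(1) by (auto simp: fps_mult_nth_0 fps_power_zeroth power_0_left)
    show ?thesis
      using True log_deriv_sign[OF \<sigma>] s0 1
      unfolding a by (simp add: log_deriv_mult fps_mult_nth_0 cyc_log_def)
  qed
qed

text \<open>The vertices of the \<open>i\<close>-th cycle. They are bounded by suffix sums because
  \<open>cyc_succ\<close> gives the head of the list the largest numbers.\<close>

definition cyc_block :: "nat list \<Rightarrow> nat \<Rightarrow> nat set" where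
  "cyc_block rs i = {sum_list (drop (Suc i) rs) ..< sum_list (drop i rs)}"

lemma cyc_block_Cons [simp]:
  "cyc_block (n # rs) 0 = {sum_list rs ..< sum_list rs + n}" "cyc_block (n # rs) (Suc i) = cyc_block rs i"
  by (auto simp: cyc_block_def)

lemma cyc_block_subset: "cyc_block rs i \<subseteq> {..<sum_list rs}"
proof (induction rs arbitrary: i)
  case (Cons n rs)
  show ?case
  proof (cases i)
    case (Suc j)
    then show ?thesis using Cons.IH[of j] by auto
  qed auto
qed (simp add: cyc_block_def)

lemma cyc_block_cover: "(\<Union>i<length rs. cyc_block rs i) = {..<sum_list rs}"
proof (induction rs)
  case (Cons n rs)
  have "(\<Union>i<length (n # rs). cyc_block (n # rs) i) = cyc_block (n # rs) 0 \<union> (\<Union>i<length rs. cyc_block (n # rs) (Suc i))"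
    by (simp only: list.size lessThan_Suc_eq_insert_0 add_0_right add_Suc_right UN_insert image_image UN_simps)
  then show ?case using Cons by auto
qed simp

lemma cyc_block_disjoint: "k \<in> cyc_block rs i \<Longrightarrow> k \<in> cyc_block rs i' \<Longrightarrow> i = i'"
proof (induction rs arbitrary: i i')
  case (Cons n rs)
  have disj: "k \<in> cyc_block rs j \<Longrightarrow> \<not> sum_list rs \<le> k" for j using cyc_block_subset[of rs j] by auto
  show ?case
  proof (cases i)
    case 0
    then show ?thesis using Cons.prems disj by (cases i') auto
  next
    case (Suc j)
    show ?thesis
    proof (cases i')
      case 0
      then show ?thesis using Cons.prems disj Suc by auto
    next
      case (Suc j')
      then show ?thesis using Cons.prems Cons.IH[of j j'] \<open>i = Suc j\<close> by auto
    qed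
  qed
qed (simp add: cyc_block_def)

lemma cyc_block_nonempty: "\<forall>n\<in>set rs. 0 < n \<Longrightarrow> i < length rs \<Longrightarrow> cyc_block rs i \<noteq> {}"
proof (induction rs arbitrary: i)
  case (Cons n rs)
  then show ?case by (cases i) auto
qed simp

lemma seifert_cyc_mat: "seifert (2 * n) (cyc_mat rs X)"
  unfolding cyc_mat_def by (intro seifert_plus_sum seifert_std_mat) simp

lemma alex_seifert_nonzero: "seifert n m \<Longrightarrow> alex n m $ 0 \<noteq> 0"
  by (auto simp: alex_nth_0 seifert_iff)

text \<open>The perturbed matrix is a direct sum over the cycles, the head occupying the last
  coordinates. Multiplicativity of \<open>\<Delta>\<close> makes the logarithmic derivative a sum
  over the complete cycles.\<close>

lemma log_deriv_alex_cyc_mat: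
  assumes "\<forall>n\<in>set rs. 0 < n \<and> even n" "X \<subseteq> {..<sum_list rs}"
  shows "log_deriv (alex (2 * sum_list rs) (cyc_mat rs X)) =
    (\<Sum>i<length rs. if cyc_block rs i \<subseteq> X then cyc_log (rs ! i) else 0)"
  using assms
proof (induction rs arbitrary: X)
  case Nil
  then show ?case by (simp add: alex_def log_deriv_sign)
next
  case (Cons n rs)
  define b where "b = sum_list rs"
  define Y where "Y = {k. k + b \<in> X}"
  have n: "0 < n" "even n" and pos: "\<forall>n\<in>set rs. 0 < n" using Cons.prems by auto
  have fX: "finite X" using Cons.prems(2) finite_subset by blast
  have Xb: "X \<subseteq> {..<b + n}" using Cons.prems(2) by (simp add: b_def add.commute)
  have YX: "Y \<subseteq> {..<n}" using Xb by (auto simp: Y_def)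
  let ?s = "\<lambda>k. sym_prod (delta (2 * k + 1)) (delta (2 * cyc_succ (n # rs) k))"
  have scb: "cyc_succ (n # rs) k = cyc_succ rs k" "cyc_succ rs k < b" if "k < b" for k
    using cyc_succ_less[OF pos, of k] that n by (auto simp: b_def)
  have scn: "cyc_succ (n # rs) (k + b) = cyc_succ [n] k + b" for k
    by (auto simp: b_def cyc_succ_above)
  have low: "?s k i j = 0" if "k < b" "2 * b \<le> i \<or> 2 * b \<le> j" for k i j
    using that scb[OF that(1)] by (auto simp: sym_prod_def delta_def simp del: cyc_succ.simps)
  have high: "?s k i j = 0" if "b \<le> k" "i < 2 * b \<or> j < 2 * b" for k i j
  proof -
    have "b \<le> cyc_succ (n # rs) k" using scn[of "k - b"] that by simp
    then show ?thesis using that by (auto simp: sym_prod_def delta_def simp del: cyc_succ.simps)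
  qed
  have "alex (2 * b + 2 * n) (cyc_mat (n # rs) X) =
    alex (2 * b) (cyc_mat (n # rs) X) * alex (2 * n) (\<lambda>i j. cyc_mat (n # rs) X (i + 2 * b) (j + 2 * b))"
  proof (rule alex_block)
    fix i j assume ij: "i < 2 * b" "2 * b \<le> j" "j < 2 * b + 2 * n"
    have z: "?s k i j = 0" "?s k j i = 0" for k
    proof -
      show "?s k i j = 0"
      proof (cases "k < b")
        case True
        then show ?thesis by (rule low) (use ij in simp)
      next
        case False
        then have "b \<le> k" by simp
        then show ?thesis by (rule high) (use ij in simp)
      qed
      show "?s k j i = 0"
      proof (cases "k < b")
        case True
        then show ?thesis by (rule low) (use ij in simp)
      next
        case False
        then have "b \<le> k" by simp
        then show ?thesis by (rule high) (use ij in simp)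
      qed
    qed
    have "std_mat i j = 0" "std_mat j i = 0" using ij by (auto simp: std_mat_def) presburger
    then show "cyc_mat (n # rs) X i j = 0 \<and> cyc_mat (n # rs) X j i = 0"
      by (simp only: cyc_mat_def plus_sum_def z sum.neutral_const) simp
  qed simp
  also have "alex (2 * b) (cyc_mat (n # rs) X) = alex (2 * b) (cyc_mat rs (X \<inter> {..<b}))"
  proof (rule alex_cong)
    fix i j assume ij: "i < 2 * b" "j < 2 * b"
    have "(\<Sum>k\<in>X. ?s k i j) = (\<Sum>k\<in>X \<inter> {..<b}. ?s k i j)"
    proof (rule sum.mono_neutral_right[OF fX])
      show "\<forall>k\<in>X - X \<inter> {..<b}. ?s k i j = 0"
        using ij by (intro ballI high) auto
    qed auto
    also have "\<dots> = (\<Sum>k\<in>X \<inter> {..<b}. sym_prod (delta (2 * k + 1)) (delta (2 * cyc_succ rs k)) i j)"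
      by (rule sum.cong) (auto simp: scb simp del: cyc_succ.simps)
    finally show "cyc_mat (n # rs) X i j = cyc_mat rs (X \<inter> {..<b}) i j"
      by (simp only: cyc_mat_def plus_sum_def)
  qed
  also have "alex (2 * n) (\<lambda>i j. cyc_mat (n # rs) X (i + 2 * b) (j + 2 * b)) = alex (2 * n) (cyc_mat [n] Y)"
  proof (rule alex_cong)
    fix i j
    have "(\<Sum>k\<in>X. ?s k (i + 2 * b) (j + 2 * b)) = (\<Sum>k\<in>(\<lambda>k. k + b) ` Y. ?s k (i + 2 * b) (j + 2 * b))"
    proof (rule sum.mono_neutral_right[OF fX])
      show "\<forall>k\<in>X - (\<lambda>k. k + b) ` Y. ?s k (i + 2 * b) (j + 2 * b) = 0"
      proof
        fix k assume k: "k \<in> X - (\<lambda>k. k + b) ` Y"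
        have "k < b"
        proof (rule ccontr)
          assume "\<not> k < b"
          then have "k = (k - b) + b" by simp
          then show False using k by (metis (mono_tags, lifting) DiffE Y_def imageI mem_Collect_eq)
        qed
        then show "?s k (i + 2 * b) (j + 2 * b) = 0" by (rule low) simp
      qed
    qed (auto simp: Y_def)
    also have "\<dots> = (\<Sum>k\<in>Y. ?s (k + b) (i + 2 * b) (j + 2 * b))"
      by (subst sum.reindex) (auto simp: inj_on_def)
    also have "\<dots> = (\<Sum>k\<in>Y. sym_prod (delta (2 * k + 1)) (delta (2 * cyc_succ [n] k)) i j)"
      unfolding scn by (rule sum.cong) (auto simp: sym_prod_def delta_def simp del: cyc_succ.simps)
    moreover have "std_mat (i + 2 * b) (j + 2 * b) = std_mat i j" by (simp add: std_mat_def)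
    ultimately show "cyc_mat (n # rs) X (i + 2 * b) (j + 2 * b) = cyc_mat [n] Y i j"
      by (simp only: cyc_mat_def plus_sum_def)
  qed
  finally have split: "alex (2 * b + 2 * n) (cyc_mat (n # rs) X) =
      alex (2 * b) (cyc_mat rs (X \<inter> {..<b})) * alex (2 * n) (cyc_mat [n] Y)" .
  have "2 * sum_list (n # rs) = 2 * b + 2 * n" by (simp add: b_def)
  then have "log_deriv (alex (2 * sum_list (n # rs)) (cyc_mat (n # rs) X)) =
      log_deriv (alex (2 * b) (cyc_mat rs (X \<inter> {..<b}))) + log_deriv (alex (2 * n) (cyc_mat [n] Y))"
    by (simp only: split) (intro log_deriv_mult alex_seifert_nonzero seifert_cyc_mat)
  also have "log_deriv (alex (2 * b) (cyc_mat rs (X \<inter> {..<b}))) =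
      (\<Sum>i<length rs. if cyc_block rs i \<subseteq> X \<inter> {..<b} then cyc_log (rs ! i) else 0)"
    unfolding b_def using Cons.prems by (intro Cons.IH) auto
  also have "\<dots> = (\<Sum>i<length rs. if cyc_block rs i \<subseteq> X then cyc_log (rs ! i) else 0)"
    using cyc_block_subset[of rs] by (intro sum.cong) (auto simp: b_def)
  also have "log_deriv (alex (2 * n) (cyc_mat [n] Y)) = (if {b..<b + n} \<subseteq> X then cyc_log n else 0)"
  proof -
    have "Y = {..<n} \<longleftrightarrow> {b..<b + n} \<subseteq> X"
    proof
      assume Y: "Y = {..<n}"
      show "{b..<b + n} \<subseteq> X"
      proof
        fix k assume "k \<in> {b..<b + n}"
        then have "k - b \<in> Y" "k - b + b = k" using Y by auto
        then show "k \<in> X" by (simp add: Y_def)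
      qed
    qed (use YX in \<open>auto simp: Y_def\<close>)
    then show ?thesis by (simp only: log_deriv_alex_single[OF n YX])
  qed
  finally show ?case
    by (simp only: length_Cons sum.lessThan_Suc_shift nth_Cons_0 nth_Cons_Suc cyc_block_Cons b_def add.commute)
qed

section \<open>Evaluation on cycle types\<close>

text \<open>A realization of \<open>cycle_gram rs\<close> by basis vectors. Unlike the generic
  vectors of \<open>realize\<close>, it leads to matrices whose \<open>\<Delta>\<close> can be
  computed.\<close>

definition cyc_elt :: "nat list \<Rightarrow> S_class \<Rightarrow>\<^sub>0 rat" where
  "cyc_elt rs = slot_sum (sum_list rs) (sum_list rs)
    (\<lambda>(k, b). if b then delta (2 * cyc_succ rs k) else delta (2 * k + 1))"

lemma symp_delta:
  "symp g (delta (2 * a)) (delta (2 * l + 1)) = of_bool (a = l \<and> a < g)"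
  "symp g (delta (2 * l + 1)) (delta (2 * a)) = - of_bool (a = l \<and> a < g)"
  "symp g (delta (2 * a)) (delta (2 * c)) = 0"
  "symp g (delta (2 * a + 1)) (delta (2 * c + 1)) = 0"
proof -
  have odd_even: "2 * a + 1 \<noteq> 2 * b" "2 * b \<noteq> 2 * a + 1" for a b :: nat by presburger+
  show 1: "symp g (delta (2 * a)) (delta (2 * l + 1)) = of_bool (a = l \<and> a < g)"
  proof (cases "a < g")
    case True
    have "symp g (delta (2 * a)) (delta (2 * l + 1)) = of_bool (a = l)"
      unfolding symp_def by (subst sum_lessThan_unique[OF True]) (use odd_even in \<open>auto simp: delta_def\<close>)
    then show ?thesis using True by simp
  next
    case False
    then show ?thesis unfolding symp_def using odd_even by (auto simp: delta_def intro!: sum.neutral)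
  qed
  then show "symp g (delta (2 * l + 1)) (delta (2 * a)) = - of_bool (a = l \<and> a < g)"
    using symp_antisym by metis
  show "symp g (delta (2 * a)) (delta (2 * c)) = 0" "symp g (delta (2 * a + 1)) (delta (2 * c + 1)) = 0"
    unfolding symp_def using odd_even by (auto simp: delta_def intro!: sum.neutral)
qed

lemma cyc_elt_gram_sum:
  assumes "\<forall>n\<in>set rs. 0 < n"
  shows "filt_eq (sum_list rs) (cyc_elt rs) (gram_sum (sum_list rs) (cycle_gram rs))"
  unfolding cyc_elt_def
proof (rule slot_sum_gram_sum)
  fix s r assume sr: "s \<in> slots (sum_list rs)" "r \<in> slots (sum_list rs)"
  obtain k b l c where s: "s = (k, b)" and r: "r = (l, c)" by (cases s, cases r) auto
  have "cyc_succ rs k < sum_list rs" "cyc_succ rs l < sum_list rs" using cyc_succ_less[OF assms] sr s r by auto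
  then show "symp (sum_list rs) ((\<lambda>(k, b). if b then delta (2 * cyc_succ rs k) else delta (2 * k + 1)) s)
      ((\<lambda>(k, b). if b then delta (2 * cyc_succ rs k) else delta (2 * k + 1)) r) = cycle_gram rs s r"
    unfolding s r by (cases b; cases c; simp only: prod.case if_True if_False symp_delta)
      (auto simp: cycle_gram_def)
qed

text \<open>If some \<open>x\<close> of \<open>V\<close> is outside \<open>U\<close>, the sets with
  and without \<open>x\<close> cancel in pairs.\<close>

lemma alternating_superset_sum:
  assumes "finite V" "U \<subseteq> V"
  shows "(\<Sum>X\<in>Pow V. (-1) ^ card X * of_bool (U \<subseteq> X)) = (if U = V then (-1) ^ card V else 0 :: 'a::comm_ring_1)"
proof (cases "U = V")
  case True
  have "(\<Sum>X\<in>Pow V. (-1) ^ card X * of_bool (U \<subseteq> X)) = (\<Sum>X\<in>{V}. (-1) ^ card X * (of_bool (U \<subseteq> X) :: 'a))"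
    by (rule sum.mono_neutral_right) (use assms True in auto)
  then show ?thesis using True by simp
next
  case False
  then obtain x where x: "x \<in> V" "x \<notin> U" using assms by auto
  obtain W where W: "V = insert x W" "x \<notin> W" using x(1) by (metis Set.set_insert)
  have fW: "finite W" using W assms(1) by simp
  have "(\<Sum>X\<in>Pow W. (-1) ^ card (insert x X) * of_bool (U \<subseteq> insert x X)) =
    (\<Sum>X\<in>Pow W. - ((-1) ^ card X * (of_bool (U \<subseteq> X) :: 'a)))"
  proof (rule sum.cong)
    fix X assume "X \<in> Pow W"
    then have "finite X" "x \<notin> X" using W(2) fW finite_subset by auto
    moreover have "U \<subseteq> insert x X \<longleftrightarrow> U \<subseteq> X" using x(2) by auto
    ultimately show "(-1) ^ card (insert x X) * of_bool (U \<subseteq> insert x X) = - ((-1) ^ card X * (of_bool (U \<subseteq> X) :: 'a))"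
      by simp
  qed simp
  then show ?thesis using False by (simp add: W(1) sum_Pow_insert[OF fW W(2)] sum_negf)
qed

text \<open>Expanding the product over \<open>es\<close> of sums over cycles gives a term for each
  assignment \<open>h\<close> of cycles to entries. This term lives on the sets \<open>X\<close>
  that contain all assigned cycles, so that the alternating sum keeps only the assignments whose
  cycles cover everything.\<close>

lemma log_inv_cyc_elt:
  assumes rs: "\<forall>n\<in>set rs. 0 < n \<and> even n"
  shows "lin_ext (log_inv es) (cyc_elt rs) = (-1) ^ sum_list rs *
    (\<Sum>h\<in>{..<length es} \<rightarrow>\<^sub>E {..<length rs}.
      if (\<Union>j<length es. cyc_block rs (h j)) = {..<sum_list rs}
      then \<Prod>j<length es. cyc_log (rs ! h j) $ (es ! j) else 0)"
proof -
  let ?d = "sum_list rs" and ?r = "length es" and ?m = "length rs"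
  let ?H = "{..<?r} \<rightarrow>\<^sub>E {..<?m}"
  let ?c = "\<lambda>h. \<Prod>j<?r. cyc_log (rs ! h j) $ (es ! j)"
  have expand: "prod_list (map (\<lambda>e. log_deriv (alex (2 * ?d) (cyc_mat rs X)) $ e) es) =
      (\<Sum>h\<in>?H. ?c h * of_bool ((\<Union>j<?r. cyc_block rs (h j)) \<subseteq> X))" if "X \<subseteq> {..<?d}" for X
  proof -
    have "prod_list (map (\<lambda>e. log_deriv (alex (2 * ?d) (cyc_mat rs X)) $ e) es) =
        (\<Prod>j<?r. \<Sum>i<?m. cyc_log (rs ! i) $ (es ! j) * of_bool (cyc_block rs i \<subseteq> X))"
      unfolding log_deriv_alex_cyc_mat[OF rs that]
      by (simp add: prod.list_conv_set_nth atLeast0LessThan fps_sum_nth if_distrib[of "\<lambda>f. f $ _"] of_bool_def mult.commute cong: if_cong)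
        (auto intro!: prod.cong sum.cong)
    also have "\<dots> = (\<Sum>h\<in>?H. \<Prod>j<?r. cyc_log (rs ! h j) $ (es ! j) * of_bool (cyc_block rs (h j) \<subseteq> X))"
      by (rule prod_sum_PiE) auto
    also have "\<dots> = (\<Sum>h\<in>?H. ?c h * of_bool ((\<Union>j<?r. cyc_block rs (h j)) \<subseteq> X))"
    proof (rule sum.cong[OF HOL.refl])
      fix h
      have "(\<Prod>j<?r. of_bool (cyc_block rs (h j) \<subseteq> X) :: rat) = of_bool ((\<Union>j<?r. cyc_block rs (h j)) \<subseteq> X)"
      proof (cases "(\<Union>j<?r. cyc_block rs (h j)) \<subseteq> X")
        case True
        then have "(\<Prod>j<?r. of_bool (cyc_block rs (h j) \<subseteq> X) :: rat) = (\<Prod>j<?r. 1)"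
          by (intro prod.cong) auto
        then show ?thesis using True by simp
      next
        case False
        then obtain j where "j < ?r" "\<not> cyc_block rs (h j) \<subseteq> X" by blast
        then show ?thesis using False by (auto intro!: prod_zero bexI[of _ j])
      qed
      then show "(\<Prod>j<?r. cyc_log (rs ! h j) $ (es ! j) * of_bool (cyc_block rs (h j) \<subseteq> X)) =
          ?c h * of_bool ((\<Union>j<?r. cyc_block rs (h j)) \<subseteq> X)"
        by (simp only: prod.distrib)
    qed
    finally show ?thesis .
  qed
  have "lin_ext (log_inv es) (cyc_elt rs) = (\<Sum>X\<in>Pow {..<?d}. (-1) ^ card X *
      prod_list (map (\<lambda>e. log_deriv (alex (2 * ?d) (cyc_mat rs X)) $ e) es))"
    unfolding cyc_elt_def slot_sum_def cyc_mat_def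
    by (subst lin_ext_log_inv_altsum[OF seifert_std_mat]) auto
  also have "\<dots> = (\<Sum>X\<in>Pow {..<?d}. (-1) ^ card X * (\<Sum>h\<in>?H. ?c h * of_bool ((\<Union>j<?r. cyc_block rs (h j)) \<subseteq> X)))"
    by (rule sum.cong) (auto simp: expand)
  also have "\<dots> = (\<Sum>h\<in>?H. ?c h * (\<Sum>X\<in>Pow {..<?d}. (-1) ^ card X * of_bool ((\<Union>j<?r. cyc_block rs (h j)) \<subseteq> X)))"
    unfolding sum_distrib_left by (subst sum.swap) (simp add: mult_ac)
  also have "\<dots> = (\<Sum>h\<in>?H. ?c h * (if (\<Union>j<?r. cyc_block rs (h j)) = {..<?d} then (-1) ^ ?d else 0))"
  proof (rule sum.cong[OF HOL.refl])
    fix h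
    have "(\<Union>j<?r. cyc_block rs (h j)) \<subseteq> {..<?d}" using cyc_block_subset by blast
    from alternating_superset_sum[OF finite_lessThan this, where 'a = rat]
    show "?c h * (\<Sum>X\<in>Pow {..<?d}. (-1) ^ card X * of_bool ((\<Union>j<?r. cyc_block rs (h j)) \<subseteq> X)) =
      ?c h * (if (\<Union>j<?r. cyc_block rs (h j)) = {..<?d} then (-1) ^ ?d else 0)"
      by (simp only: card_lessThan)
  qed
  also have "\<dots> = (-1) ^ ?d * (\<Sum>h\<in>?H. if (\<Union>j<?r. cyc_block rs (h j)) = {..<?d} then ?c h else 0)"
    unfolding sum_distrib_left by (rule sum.cong) auto
  finally show ?thesis .
qed

lemma cyc_block_cover_surj:
  assumes "\<forall>n\<in>set rs. 0 < n" "(\<Union>j<r. cyc_block rs (h j)) = {..<sum_list rs}" "i < length rs"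
  shows "i \<in> h ` {..<r}"
proof -
  obtain k where k: "k \<in> cyc_block rs i" using cyc_block_nonempty[OF assms(1,3)] by blast
  then have "k \<in> (\<Union>j<r. cyc_block rs (h j))" using assms(2) cyc_block_subset[of rs i] by auto
  then show ?thesis using cyc_block_disjoint[OF k] by blast
qed

text \<open>A covering assignment is onto the cycles, which is impossible with fewer entries than
  cycles.\<close>

lemma log_inv_cyc_elt_longer:
  assumes rs: "\<forall>n\<in>set rs. 0 < n \<and> even n" and "length es < length rs"
  shows "lin_ext (log_inv es) (cyc_elt rs) = 0"
proof -
  have "(\<Union>j<length es. cyc_block rs (h j)) \<noteq> {..<sum_list rs}" for h
  proof
    assume "(\<Union>j<length es. cyc_block rs (h j)) = {..<sum_list rs}"
    then have "{..<length rs} \<subseteq> h ` {..<length es}" using cyc_block_cover_surj[of rs h "length es"] rs by auto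
    then have "card {..<length rs} \<le> card {..<length es}" by (rule surj_card_le[rotated]) simp
    then show False using assms(2) by simp
  qed
  then show ?thesis by (simp add: log_inv_cyc_elt[OF rs])
qed

text \<open>A summand can only be nonzero if it matches the entries of \<open>es\<close> with the cycles, and each entry
  of \<open>es\<close> is at least the corresponding cycle length; as the totals agree, they are equal.\<close>

lemma nonzero_summand:
  assumes rs: "\<forall>n\<in>set rs. 0 < n \<and> even n" and len: "length es = length rs" and sum: "sum_list es = sum_list rs"
    and h: "h \<in> {..<length es} \<rightarrow>\<^sub>E {..<length rs}" "(\<Union>j<length es. cyc_block rs (h j)) = {..<sum_list rs}"
    and nz: "(\<Prod>j<length es. cyc_log (rs ! h j) $ (es ! j)) \<noteq> 0"
  shows "bij_betw h {..<length rs} {..<length rs}" "\<And>j. j < length rs \<Longrightarrow> es ! j = rs ! h j"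
proof -
  let ?m = "length rs"
  have hm: "h j < ?m" if "j < ?m" for j using h(1) that len by auto
  have "{..<?m} \<subseteq> h ` {..<?m}" using cyc_block_cover_surj[of rs h "length es"] rs h(2) len by auto
  then have im: "h ` {..<?m} = {..<?m}" using hm by auto
  then show bij: "bij_betw h {..<?m} {..<?m}"
    by (simp add: bij_betw_def eq_card_imp_inj_on)
  have le: "rs ! h j \<le> es ! j" if "j < ?m" for j
  proof (rule ccontr)
    assume "\<not> rs ! h j \<le> es ! j"
    moreover have "0 < rs ! h j" using rs hm[OF that] by auto
    ultimately have "cyc_log (rs ! h j) $ (es ! j) = 0" by (intro cyc_log_nth(1)) auto
    then have "(\<Prod>j<length es. cyc_log (rs ! h j) $ (es ! j)) = 0" using that len by (auto intro!: prod_zero bexI[of _ j])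
    then show False using nz by simp
  qed
  have "(\<Sum>j<?m. rs ! h j) = (\<Sum>j<?m. rs ! j)" by (rule sum.reindex_bij_betw[OF bij])
  also have "\<dots> = (\<Sum>j<?m. es ! j)"
    using sum len by (simp add: sum_list_sum_nth atLeast0LessThan)
  finally show "es ! j = rs ! h j" if "j < ?m" for j
    using sum_mono_inv[of "\<lambda>j. rs ! h j" "{..<?m}" "\<lambda>j. es ! j" j] le that by auto
qed

text \<open>An assignment with nonzero summand would be a permutation that rearranges
  \<open>rs\<close> into \<open>es\<close>.\<close>

lemma log_inv_cyc_elt_different:
  assumes rs: "\<forall>n\<in>set rs. 0 < n \<and> even n" and len: "length es = length rs" and sum: "sum_list es = sum_list rs"
    and ne: "mset es \<noteq> mset rs"
  shows "lin_ext (log_inv es) (cyc_elt rs) = 0"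
proof -
  have "(\<Prod>j<length es. cyc_log (rs ! h j) $ (es ! j)) = 0"
    if h: "h \<in> {..<length es} \<rightarrow>\<^sub>E {..<length rs}" "(\<Union>j<length es. cyc_block rs (h j)) = {..<sum_list rs}" for h
  proof (rule ccontr)
    assume nz: "(\<Prod>j<length es. cyc_log (rs ! h j) $ (es ! j)) \<noteq> 0"
    note b = nonzero_summand[OF rs len sum h nz]
    let ?f = "\<lambda>i. if i < length rs then h i else i"
    have "bij_betw ?f {..<length rs} {..<length rs}"
      using b(1) by (rule bij_betw_cong[THEN iffD1, rotated]) simp
    then have f: "?f permutes {..<length rs}" by (rule bij_imp_permutes) simp
    have "es = permute_list ?f rs"
      by (rule nth_equalityI) (use len b(2) permute_list_nth[OF f] in auto)
    then show False using ne mset_permute_list[OF f] by simp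
  qed
  then have "(\<Sum>h\<in>{..<length es} \<rightarrow>\<^sub>E {..<length rs}. if (\<Union>j<length es. cyc_block rs (h j)) = {..<sum_list rs}
      then \<Prod>j<length es. cyc_log (rs ! h j) $ (es ! j) else 0) = 0"
    by (intro sum.neutral ballI) (simp only: if_cancel split: if_split, blast)
  then show ?thesis unfolding log_inv_cyc_elt[OF rs] by simp
qed

text \<open>Nothing cancels: every nonzero summand is the product of the same leading coefficients
  \<open>-2 n\<close>, and the identity assignment gives one of them.\<close>

lemma log_inv_cyc_elt_same:
  assumes rs: "\<forall>n\<in>set rs. 0 < n \<and> even n"
  shows "lin_ext (log_inv rs) (cyc_elt rs) \<noteq> 0"
proof -
  let ?m = "length rs"
  let ?H = "{..<?m} \<rightarrow>\<^sub>E {..<?m}"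
  define c where "c = (\<Prod>j<?m. - 2 * of_nat (rs ! j) :: rat)"
  define t where "t h = (if (\<Union>j<?m. cyc_block rs (h j)) = {..<sum_list rs}
      then \<Prod>j<?m. cyc_log (rs ! h j) $ (rs ! j) else 0)" for h
  have c: "c \<noteq> 0" unfolding c_def using rs by (auto simp: prod_zero_iff)
  have diag: "cyc_log (rs ! j) $ (rs ! j) = - 2 * of_nat (rs ! j)" if "j < ?m" for j
    using that rs by (intro cyc_log_nth(2)) auto
  have tc: "t h = c" if "h \<in> ?H" "t h \<noteq> 0" for h
  proof -
    have cov: "(\<Union>j<?m. cyc_block rs (h j)) = {..<sum_list rs}" and nz: "(\<Prod>j<?m. cyc_log (rs ! h j) $ (rs ! j)) \<noteq> 0"
      using that(2) by (auto simp: t_def split: if_splits)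
    have "(\<Prod>j<?m. cyc_log (rs ! h j) $ (rs ! j)) = c"
      unfolding c_def
      by (rule prod.cong) (use nonzero_summand(2)[OF rs _ _ that(1) cov nz] diag in auto)
    then show ?thesis using cov by (simp add: t_def)
  qed
  let ?id = "\<lambda>j\<in>{..<?m}. j"
  have "(\<Union>j<?m. cyc_block rs (?id j)) = {..<sum_list rs}"
    using cyc_block_cover[of rs] by simp
  then have "t ?id = c" unfolding t_def c_def by (simp add: diag)
  then have idt: "?id \<in> {h \<in> ?H. t h \<noteq> 0}" using c by auto
  have fH: "finite ?H" by (rule finite_PiE) auto
  have "(\<Sum>h\<in>?H. t h) = (\<Sum>h\<in>{h \<in> ?H. t h \<noteq> 0}. t h)"
    by (rule sum.mono_neutral_right) (use fH in auto)
  also have "\<dots> = (\<Sum>h\<in>{h \<in> ?H. t h \<noteq> 0}. c)"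
    by (rule sum.cong) (use tc in auto)
  also have "\<dots> = of_nat (card {h \<in> ?H. t h \<noteq> 0}) * c" by simp
  also have "\<dots> \<noteq> 0"
  proof -
    have "finite {h \<in> ?H. t h \<noteq> 0}" by (rule finite_subset[OF _ fH]) blast
    moreover have "{h \<in> ?H. t h \<noteq> 0} \<noteq> {}" using idt by blast
    ultimately have "card {h \<in> ?H. t h \<noteq> 0} \<noteq> 0" by (simp only: card_0_eq not_False_eq_True)
    then show ?thesis using c by simp
  qed
  finally show ?thesis using log_inv_cyc_elt[OF rs, of rs] by (simp add: t_def)
qed

section \<open>Monomials and cycle types\<close>

text \<open>The variable \<open>w n\<close> stands for a cycle of length \<open>n\<close> and its
  exponent for the multiplicity; sorting merely fixes an order.\<close>

definition cycles_of :: "(nat \<Rightarrow>\<^sub>0 nat) \<Rightarrow> nat list" where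
  "cycles_of m = concat (map (\<lambda>n. replicate (Poly_Mapping.lookup m n) n) (sorted_list_of_set (Poly_Mapping.keys m)))"

lemma set_cycles_of: "set (cycles_of m) \<subseteq> Poly_Mapping.keys m"
  by (auto simp: cycles_of_def)

lemma count_cycles_of: "count (mset (cycles_of m)) n = Poly_Mapping.lookup m n"
proof -
  have "count (mset (concat (map (\<lambda>n. replicate (f n) n) xs))) k = (if k \<in> set xs then f k else 0)"
    if "distinct xs" for f :: "nat \<Rightarrow> nat" and xs k
    using that by (induction xs) auto
  then show ?thesis by (simp add: cycles_of_def in_keys_iff)
qed

lemma sum_list_cycles_of: "sum_list (cycles_of m) = weighted_degree m"
proof -
  have "sum_list (concat (map (\<lambda>n. replicate (f n) n) xs)) = (\<Sum>n\<in>set xs. n * f n)"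
    if "distinct xs" for f :: "nat \<Rightarrow> nat" and xs
    using that by (induction xs) (auto simp: sum_list_replicate)
  then show ?thesis by (simp add: cycles_of_def weighted_degree_def)
qed

lemma mset_cycles_of_inj: "mset (cycles_of m) = mset (cycles_of m') \<Longrightarrow> m = m'"
  using count_cycles_of[of m] count_cycles_of[of m'] by (intro poly_mapping_eqI) simp

lemma ex_cycles_of:
  obtains m where "mset (cycles_of m) = mset rs" "Poly_Mapping.keys m = set rs"
proof -
  have "finite {n. count (mset rs) n \<noteq> 0}"
    by (simp add: count_eq_zero_iff)
  then have l: "Poly_Mapping.lookup (Abs_poly_mapping (count (mset rs))) = count (mset rs)"
    by (simp add: Abs_poly_mapping_inverse)
  show thesis
  proof
    show "mset (cycles_of (Abs_poly_mapping (count (mset rs)))) = mset rs"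
      by (rule multiset_eqI) (simp add: count_cycles_of l)
    show "Poly_Mapping.keys (Abs_poly_mapping (count (mset rs))) = set rs"
      by (auto simp: in_keys_iff l count_eq_zero_iff)
  qed
qed

definition monom_elt :: "(nat \<Rightarrow>\<^sub>0 nat) \<Rightarrow> S_class \<Rightarrow>\<^sub>0 rat" where
  "monom_elt m = cyc_elt (cycles_of m)"

definition even_monom :: "(nat \<Rightarrow>\<^sub>0 nat) \<Rightarrow> bool" where
  "even_monom m \<longleftrightarrow> (\<forall>n\<in>Poly_Mapping.keys m. even n \<and> n \<ge> 2)"

lemma even_poly_ring_iff: "p \<in> even_poly_ring \<longleftrightarrow> (\<forall>m\<in>Poly_Mapping.keys p. even_monom m)"
  by (simp add: even_poly_ring_def even_monom_def)

lemma even_monom_cycles: "even_monom m \<Longrightarrow> \<forall>n\<in>set (cycles_of m). 0 < n \<and> even n"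
  using set_cycles_of[of m] unfolding even_monom_def by fastforce

lemma slot_sum_filt: "slot_sum g d u \<in> S_filt d"
  unfolding slot_sum_def using altsum_symm[OF finite_lessThan seifert_std_mat[of g] symm_sym_prod, of d] by simp

lemma cyc_elt_filt: "cyc_elt rs \<in> S_filt (sum_list rs)"
  unfolding cyc_elt_def by (rule slot_sum_filt)

section \<open>The isomorphism\<close>

text \<open>Selecting the monomials of weighted degree \<open>d\<close> lets one polynomial supply
  all components of the graded map.\<close>

definition monom_comb :: "nat \<Rightarrow> ((nat \<Rightarrow>\<^sub>0 nat) \<Rightarrow>\<^sub>0 rat) \<Rightarrow> S_class \<Rightarrow>\<^sub>0 rat" where
  "monom_comb d p = (\<Sum>m\<in>{m \<in> Poly_Mapping.keys p. weighted_degree m = d}. pm_scale (Poly_Mapping.lookup p m) (monom_elt m))"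

lemma monom_comb_superset:
  assumes "finite F" "Poly_Mapping.keys p \<subseteq> F"
  shows "monom_comb d p = (\<Sum>m\<in>{m \<in> F. weighted_degree m = d}. pm_scale (Poly_Mapping.lookup p m) (monom_elt m))"
  unfolding monom_comb_def by (rule sum.mono_neutral_left) (use assms in \<open>auto simp: in_keys_iff\<close>)

lemma monom_comb_add: "monom_comb d (p + q) = monom_comb d p + monom_comb d q"
proof -
  let ?F = "Poly_Mapping.keys p \<union> Poly_Mapping.keys q"
  have "monom_comb d (p + q) = (\<Sum>m\<in>{m \<in> ?F. weighted_degree m = d}. pm_scale (Poly_Mapping.lookup (p + q) m) (monom_elt m))"
    using Poly_Mapping.keys_add[of p q] by (intro monom_comb_superset) auto
  also have "\<dots> = monom_comb d p + monom_comb d q"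
    by (simp add: monom_comb_superset[of ?F] lookup_add pm.scale_left_distrib sum.distrib)
  finally show ?thesis .
qed

lemma monom_comb_0 [simp]: "monom_comb d 0 = 0"
  by (simp add: monom_comb_def)

lemma keys_pm_scale: "Poly_Mapping.keys (pm_scale c p) \<subseteq> Poly_Mapping.keys p"
  by (auto simp: in_keys_iff lookup_pm_scale)

lemma monom_comb_scale: "monom_comb d (pm_scale c p) = pm_scale c (monom_comb d p)"
proof -
  have "monom_comb d (pm_scale c p) = (\<Sum>m\<in>{m \<in> Poly_Mapping.keys p. weighted_degree m = d}.
      pm_scale (Poly_Mapping.lookup (pm_scale c p) m) (monom_elt m))"
    by (rule monom_comb_superset[OF finite_keys keys_pm_scale])
  then show ?thesis by (simp add: lookup_pm_scale monom_comb_def pm.scale_sum_right)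
qed

lemma monom_comb_diff: "monom_comb d (p - q) = monom_comb d p - monom_comb d q"
  using monom_comb_add[of d "p - q" q] by simp

lemma monom_comb_sum: "monom_comb d (\<Sum>i\<in>I. p i) = (\<Sum>i\<in>I. monom_comb d (p i))"
  by (induction I rule: infinite_finite_induct) (auto simp: monom_comb_add)

lemma monom_comb_single: "weighted_degree m = d \<Longrightarrow> monom_comb d (Poly_Mapping.single m 1) = monom_elt m"
proof -
  assume "weighted_degree m = d"
  then have "{x \<in> {m}. weighted_degree x = d} = {m}" by auto
  then show ?thesis by (simp add: monom_comb_def)
qed

lemma monom_comb_filt: "monom_comb d p \<in> S_filt d"
proof -
  have "pm_scale c (monom_elt m) \<in> S_filt d" if "weighted_degree m = d" for c m
    using S_filt_scale[OF cyc_elt_filt[of "cycles_of m"]] that by (simp add: monom_elt_def sum_list_cycles_of)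
  then show ?thesis
    unfolding monom_comb_def S_filt_def by (intro pm.span_sum) auto
qed

lemma monom_comb_other_degree:
  assumes "p \<in> even_poly_part e" "e \<noteq> d"
  shows "monom_comb d p = 0"
proof -
  have "{m \<in> Poly_Mapping.keys p. weighted_degree m = d} = {}"
    using assms by (auto simp: even_poly_part_def)
  then show ?thesis unfolding monom_comb_def by (simp only: sum.empty)
qed

text \<open>Among the monomials that occur in a relation, one with the smallest number of factors is detected
  by the corresponding product of invariants, which vanishes on all the other ones.\<close>

lemma monom_comb_independent:
  assumes p: "p \<in> even_poly_ring" and in_filt: "monom_comb d p \<in> S_filt (Suc d)" and m: "weighted_degree m = d"
  shows "Poly_Mapping.lookup p m = 0"
proof (rule ccontr)
  assume "Poly_Mapping.lookup p m \<noteq> 0"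
  let ?D = "{m \<in> Poly_Mapping.keys p. weighted_degree m = d}"
  have "m \<in> ?D" using m \<open>Poly_Mapping.lookup p m \<noteq> 0\<close> by (simp add: in_keys_iff)
  then obtain m0 where m0: "m0 \<in> ?D" and min: "\<And>m. m \<in> ?D \<Longrightarrow> length (cycles_of m0) \<le> length (cycles_of m)"
    using ex_has_least_nat[of "\<lambda>m. m \<in> ?D" m "\<lambda>m. length (cycles_of m)"] by blast
  define es where "es = cycles_of m0"
  have es: "sum_list es = d" using m0 by (simp add: es_def sum_list_cycles_of)
  have cyc: "\<forall>n\<in>set (cycles_of m). 0 < n \<and> even n" if "m \<in> ?D" for m
    using that p by (intro even_monom_cycles) (simp add: even_poly_ring_iff)
  have z: "lin_ext (log_inv es) (monom_elt m) = 0" if "m \<in> ?D" "m \<noteq> m0" for m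
  proof (cases "length es < length (cycles_of m)")
    case True
    then show ?thesis unfolding monom_elt_def by (intro log_inv_cyc_elt_longer cyc that)
  next
    case False
    then have "length es = length (cycles_of m)" using min[OF that(1)] by (simp add: es_def)
    moreover have "sum_list es = sum_list (cycles_of m)" using es that by (simp add: sum_list_cycles_of)
    moreover have "mset es \<noteq> mset (cycles_of m)" using mset_cycles_of_inj that(2) unfolding es_def by blast
    ultimately show ?thesis unfolding monom_elt_def by (intro log_inv_cyc_elt_different cyc that)
  qed
  have "0 = lin_ext (log_inv es) (monom_comb d p)"
    using log_inv_finite_type[of "monom_comb d p" es] in_filt es by simp
  also have "\<dots> = (\<Sum>m\<in>?D. Poly_Mapping.lookup p m * lin_ext (log_inv es) (monom_elt m))"
    by (simp add: monom_comb_def lin_ext_sum lin_ext_scale)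
  also have "\<dots> = (\<Sum>m\<in>{m0}. Poly_Mapping.lookup p m * lin_ext (log_inv es) (monom_elt m))"
    by (rule sum.mono_neutral_right) (use m0 z in auto)
  also have "\<dots> = Poly_Mapping.lookup p m0 * lin_ext (log_inv es) (cyc_elt es)"
    by (simp add: monom_elt_def es_def)
  finally show False
    using log_inv_cyc_elt_same[OF cyc[OF m0]] m0 by (simp add: es_def in_keys_iff)
qed

text \<open>The elements with such an expansion form a subspace \<open>T\<close> that contains the
  next step and all even cycle types, so \<open>S_filt_even_cycles\<close> applies to it.\<close>

lemma monom_comb_spanning:
  assumes "x \<in> S_filt d"
  obtains p where "p \<in> even_poly_part d" "x - monom_comb d p \<in> S_filt (Suc d)"
proof -
  define T where "T = {x. \<exists>p\<in>even_poly_part d. x - monom_comb d p \<in> S_filt (Suc d)}"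
  have zero: "0 \<in> even_poly_part d" by (simp add: even_poly_part_def even_poly_ring_def)
  have sub: "pm.subspace T"
  proof (rule pm.subspaceI)
    show "0 \<in> T" unfolding T_def using zero S_filt_0 by force
    fix x y assume "x \<in> T" "y \<in> T"
    then obtain p q where p: "p \<in> even_poly_part d" "x - monom_comb d p \<in> S_filt (Suc d)"
      and q: "q \<in> even_poly_part d" "y - monom_comb d q \<in> S_filt (Suc d)"
      unfolding T_def by blast
    have "p + q \<in> even_poly_part d"
      using p(1) q(1) Poly_Mapping.keys_add[of p q] unfolding even_poly_part_def even_poly_ring_iff by blast
    moreover have "(x + y) - monom_comb d (p + q) \<in> S_filt (Suc d)"
      using S_filt_add[OF p(2) q(2)] by (simp add: monom_comb_add algebra_simps)
    ultimately show "x + y \<in> T" unfolding T_def by blast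
  next
    fix c x assume "x \<in> T"
    then obtain p where p: "p \<in> even_poly_part d" "x - monom_comb d p \<in> S_filt (Suc d)"
      unfolding T_def by blast
    have "pm_scale c p \<in> even_poly_part d"
      using p(1) keys_pm_scale[of c p] unfolding even_poly_part_def even_poly_ring_iff by blast
    moreover have "pm_scale c x - monom_comb d (pm_scale c p) \<in> S_filt (Suc d)"
      using S_filt_scale[OF p(2), of c] by (simp add: monom_comb_scale pm.scale_right_diff_distrib)
    ultimately show "pm_scale c x \<in> T" unfolding T_def by blast
  qed
  have "S_filt (Suc d) \<subseteq> T"
    unfolding T_def using zero by force
  moreover have "gram_sum d (cycle_gram rs) \<in> T" if rs: "\<forall>n\<in>set rs. 0 < n \<and> even n" "sum_list rs = d" for rs
  proof -
    obtain m where m: "mset (cycles_of m) = mset rs" "Poly_Mapping.keys m = set rs" by (rule ex_cycles_of)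
    have wd: "weighted_degree m = d"
      using rs(2) m(1) sum_list_cycles_of[of m] by (metis sum_mset_sum_list)
    have "even_monom m" unfolding even_monom_def m(2) using rs(1) by (auto simp: Suc_leI dvd_imp_le)
    then have "Poly_Mapping.single m 1 \<in> even_poly_part d"
      by (simp add: even_poly_part_def even_poly_ring_iff wd)
    moreover have "filt_eq d (gram_sum d (cycle_gram rs)) (monom_elt m)"
    proof -
      have pos: "\<forall>n\<in>set (cycles_of m). 0 < n" using m(1) rs(1) by (metis mset_eq_setD)
      have sd: "sum_list (cycles_of m) = d" using wd by (simp add: sum_list_cycles_of)
      have "filt_eq d (gram_sum d (cycle_gram rs)) (gram_sum d (cycle_gram (cycles_of m)))"
        by (rule gram_sum_cyc_rel[OF cyc_rel_mset[OF m(1) pos] sd])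
      also have "filt_eq d \<dots> (monom_elt m)"
        using filt_eq_sym[OF cyc_elt_gram_sum[OF pos]] by (simp add: sd monom_elt_def)
      finally show ?thesis .
    qed
    ultimately show ?thesis unfolding T_def filt_eq_def using monom_comb_single[OF wd] by force
  qed
  ultimately have "S_filt d \<subseteq> T" by (rule S_filt_even_cycles[OF sub])
  then show thesis using assms that unfolding T_def by blast
qed

section \<open>Cosets, the graded map and its inverse\<close>

lemma coset_eq_iff:
  "v +o S_filt d = w +o S_filt d \<longleftrightarrow> v - w \<in> S_filt d"
proof
  assume "v +o S_filt d = w +o S_filt d"
  moreover have "v \<in> v +o S_filt d" using S_filt_0[of d] by (force simp: elt_set_plus_def)
  ultimately have "v \<in> w +o S_filt d" by simp
  then show "v - w \<in> S_filt d" by (auto simp: elt_set_plus_def)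
next
  assume vw: "v - w \<in> S_filt d"
  have "x \<in> v +o S_filt d" if x: "x \<in> w +o S_filt d" and vw: "v - w \<in> S_filt d" for x v w
  proof -
    obtain b where b: "b \<in> S_filt d" "x = w + b" using x by (auto simp: elt_set_plus_def)
    then have "x = v + (b - (v - w))" by simp
    then show ?thesis using S_filt_diff[OF b(1) vw] unfolding elt_set_plus_def by blast
  qed
  from this[of _ w v] this[of _ v w] show "v +o S_filt d = w +o S_filt d"
    using vw S_filt_neg[OF vw] by auto
qed

lemma S_filt_coset_iff: "v +o S_filt d = S_filt d \<longleftrightarrow> v \<in> S_filt d"
  using coset_eq_iff[of v d 0] by simp

lemma S_filt_plus: "S_filt d + S_filt d = S_filt d"
proof
  show "S_filt d + S_filt d \<subseteq> S_filt d"
    by (auto elim!: set_plus_elim intro: S_filt_add)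
  show "S_filt d \<subseteq> S_filt d + S_filt d"
  proof
    fix x assume "x \<in> S_filt d"
    from set_plus_intro[OF S_filt_0 this] show "x \<in> S_filt d + S_filt d" by simp
  qed
qed

text \<open>The isomorphism is built starting from polynomials, whose coefficients are explicit
  coordinates; the map \<open>\<phi>\<close> of the theorem is its inverse.\<close>

definition gr_map :: "((nat \<Rightarrow>\<^sub>0 nat) \<Rightarrow>\<^sub>0 rat) \<Rightarrow> nat \<Rightarrow> (S_class \<Rightarrow>\<^sub>0 rat) set" where
  "gr_map p d = monom_comb d p +o S_filt (Suc d)"

lemma gr_map_gr_S: "gr_map p \<in> gr_S"
proof -
  have "{d. gr_map p d \<noteq> S_filt (Suc d)} \<subseteq> weighted_degree ` Poly_Mapping.keys p"
  proof (rule subsetI, rule ccontr)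
    fix d assume d: "d \<in> {d. gr_map p d \<noteq> S_filt (Suc d)}" "d \<notin> weighted_degree ` Poly_Mapping.keys p"
    then have "{m \<in> Poly_Mapping.keys p. weighted_degree m = d} = {}" by auto
    then have "monom_comb d p = 0" unfolding monom_comb_def by (simp only: sum.empty)
    then show False using d by (simp add: gr_map_def)
  qed
  then have "finite {d. gr_map p d \<noteq> S_filt (Suc d)}" by (rule finite_subset) simp
  then show ?thesis
    using monom_comb_filt by (auto simp: gr_S_def quotient_space_def gr_map_def)
qed

lemma even_poly_ring_closed:
  "p \<in> even_poly_ring \<Longrightarrow> q \<in> even_poly_ring \<Longrightarrow> p + q \<in> even_poly_ring"
  "p \<in> even_poly_ring \<Longrightarrow> q \<in> even_poly_ring \<Longrightarrow> p - q \<in> even_poly_ring"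
  "p \<in> even_poly_ring \<Longrightarrow> pm_scale c p \<in> even_poly_ring"
  using Poly_Mapping.keys_add[of p q] Poly_Mapping.keys_diff[of p q] keys_pm_scale[of c p]
  unfolding even_poly_ring_iff by blast+

lemma gr_map_inj: "inj_on gr_map even_poly_ring"
proof (rule inj_onI)
  fix p q assume pq: "p \<in> even_poly_ring" "q \<in> even_poly_ring" "gr_map p = gr_map q"
  have "Poly_Mapping.lookup (p - q) m = 0" for m
  proof (rule monom_comb_independent)
    have "gr_map p (weighted_degree m) = gr_map q (weighted_degree m)" using pq by simp
    then show "monom_comb (weighted_degree m) (p - q) \<in> S_filt (Suc (weighted_degree m))"
      by (simp add: gr_map_def coset_eq_iff monom_comb_diff)
  qed (use pq even_poly_ring_closed in auto)
  then have "p - q = 0" by (intro poly_mapping_eqI) simp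
  then show "p = q" by simp
qed

lemma gr_map_surj:
  assumes "f \<in> gr_S"
  shows "\<exists>p\<in>even_poly_ring. gr_map p = f"
proof -
  have "\<exists>p. p \<in> even_poly_part d \<and> f d = monom_comb d p +o S_filt (Suc d)" for d
  proof -
    obtain x where x: "x \<in> S_filt d" "f d = x +o S_filt (Suc d)"
      using assms by (auto simp: gr_S_def quotient_space_def)
    obtain p where "p \<in> even_poly_part d" "x - monom_comb d p \<in> S_filt (Suc d)"
      using monom_comb_spanning[OF x(1)] by blast
    then show ?thesis using x(2) coset_eq_iff by blast
  qed
  then obtain P where P: "\<And>d. P d \<in> even_poly_part d" "\<And>d. f d = monom_comb d (P d) +o S_filt (Suc d)"
    by metis
  define F where "F = {d. f d \<noteq> S_filt (Suc d)}"
  have F: "finite F" using assms by (simp add: F_def gr_S_def)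
  \<comment> \<open>Summing over the finite set \<open>F\<close> keeps \<open>p\<close> a
    polynomial; in degrees outside \<open>F\<close> both sides are the zero coset.\<close>
  define p where "p = (\<Sum>e\<in>F. P e)"
  have "0 \<in> even_poly_ring" by (simp add: even_poly_ring_iff)
  have "p \<in> even_poly_ring"
    unfolding p_def using F \<open>0 \<in> even_poly_ring\<close>
  proof (induction F rule: finite_induct)
    case (insert e F)
    have "P e \<in> even_poly_ring" using P(1) by (simp add: even_poly_part_def)
    then show ?case using insert by (simp add: even_poly_ring_closed)
  qed simp
  moreover have "gr_map p d = f d" for d
  proof (cases "d \<in> F")
    case True
    have "monom_comb d p = (\<Sum>e\<in>F. monom_comb d (P e))" by (simp add: p_def monom_comb_sum)
    also have "\<dots> = (\<Sum>e\<in>{d}. monom_comb d (P e))"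
      by (rule sum.mono_neutral_right) (use F True monom_comb_other_degree[OF P(1)] in auto)
    finally show ?thesis by (simp add: gr_map_def P(2))
  next
    case False
    have "monom_comb d p = (\<Sum>e\<in>F. monom_comb d (P e))" by (simp add: p_def monom_comb_sum)
    also have "\<dots> = 0"
      by (intro sum.neutral ballI monom_comb_other_degree[OF P(1)]) (use False in auto)
    finally show ?thesis using False by (simp add: gr_map_def F_def)
  qed
  ultimately show ?thesis by blast
qed

lemma gr_map_add: "gr_S_add (gr_map p) (gr_map q) = gr_map (p + q)"
  by (simp add: fun_eq_iff gr_S_add_def gr_map_def monom_comb_add set_plus_rearrange S_filt_plus)

lemma gr_map_scale: "gr_S_scale c (gr_map p) = gr_map (pm_scale c p)"
proof
  fix d
  let ?W = "S_filt (Suc d)"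
  have "pm_scale c ` (v +o ?W) + ?W = pm_scale c v +o ?W" for v
  proof
    show "pm_scale c ` (v +o ?W) + ?W \<subseteq> pm_scale c v +o ?W"
    proof
      fix x assume "x \<in> pm_scale c ` (v +o ?W) + ?W"
      then obtain a b where ab: "a \<in> ?W" "b \<in> ?W" "x = pm_scale c (v + a) + b"
        by (auto simp: set_plus_def elt_set_plus_def)
      then have "x = pm_scale c v + (pm_scale c a + b)" by (simp add: pm.scale_right_distrib add.assoc)
      moreover have "pm_scale c a + b \<in> ?W" using ab by (intro S_filt_add S_filt_scale)
      ultimately show "x \<in> pm_scale c v +o ?W" unfolding elt_set_plus_def by blast
    qed
    show "pm_scale c v +o ?W \<subseteq> pm_scale c ` (v +o ?W) + ?W"
    proof
      fix x assume "x \<in> pm_scale c v +o ?W"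
      then obtain b where "b \<in> ?W" "x = pm_scale c v + b" by (auto simp: elt_set_plus_def)
      moreover have "v \<in> v +o ?W" using S_filt_0[of "Suc d"] by (force simp: elt_set_plus_def)
      ultimately show "x \<in> pm_scale c ` (v +o ?W) + ?W" by (auto intro: set_plus_intro)
    qed
  qed
  then show "gr_S_scale c (gr_map p) d = gr_map (pm_scale c p) d"
    by (simp add: gr_S_scale_def coset_scale_def gr_map_def monom_comb_scale)
qed

text \<open>For the inclusion from right to left, independence in every degree other than
  \<open>d\<close> removes the unwanted monomials from a preimage.\<close>

lemma gr_map_part: "gr_map ` even_poly_part d = gr_S_part d"
proof
  show "gr_map ` even_poly_part d \<subseteq> gr_S_part d"
    using gr_map_gr_S monom_comb_other_degree by (auto simp: gr_S_part_def gr_map_def)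
  show "gr_S_part d \<subseteq> gr_map ` even_poly_part d"
  proof
    fix f assume f: "f \<in> gr_S_part d"
    then obtain p where p: "p \<in> even_poly_ring" "gr_map p = f"
      using gr_map_surj unfolding gr_S_part_def by blast
    have "weighted_degree m = d" if m: "m \<in> Poly_Mapping.keys p" for m
    proof (rule ccontr)
      assume "weighted_degree m \<noteq> d"
      then have "gr_map p (weighted_degree m) = S_filt (Suc (weighted_degree m))"
        using f p(2) by (simp add: gr_S_part_def)
      then have "monom_comb (weighted_degree m) p \<in> S_filt (Suc (weighted_degree m))"
        by (simp add: gr_map_def S_filt_coset_iff)
      then have "Poly_Mapping.lookup p m = 0" by (rule monom_comb_independent[OF p(1)]) simp
      then show False using m by (simp add: in_keys_iff)
    qed
    then have "p \<in> even_poly_part d" using p(1) by (simp add: even_poly_part_def)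
    then show "f \<in> gr_map ` even_poly_part d" using p(2) by blast
  qed
qed

theorem theorem1p2:
  shows "\<exists>\<phi> :: (nat \<Rightarrow> (S_class \<Rightarrow>\<^sub>0 rat) set) \<Rightarrow> ((nat \<Rightarrow>\<^sub>0 nat) \<Rightarrow>\<^sub>0 rat).
           bij_betw \<phi> gr_S even_poly_ring \<and>
           (\<forall>f \<in> gr_S. \<forall>g \<in> gr_S. \<phi> (gr_S_add f g) = \<phi> f + \<phi> g) \<and>
           (\<forall>c. \<forall>f \<in> gr_S. \<phi> (gr_S_scale c f) = pm_scale c (\<phi> f)) \<and>
           (\<forall>d. \<phi> ` gr_S_part d = even_poly_part d)"
proof -
  have img: "gr_map ` even_poly_ring = gr_S"
    using gr_map_gr_S gr_map_surj by blast
  define \<phi> where "\<phi> = inv_into even_poly_ring gr_map"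
  have left: "\<phi> (gr_map p) = p" if "p \<in> even_poly_ring" for p
    unfolding \<phi>_def by (rule inv_into_f_f[OF gr_map_inj that])
  have bij: "bij_betw \<phi> gr_S even_poly_ring"
    unfolding \<phi>_def by (rule bij_betw_inv_into) (use img gr_map_inj in \<open>simp add: bij_betw_def\<close>)
  have "\<phi> (gr_S_add f g) = \<phi> f + \<phi> g" if fg: "f \<in> gr_S" "g \<in> gr_S" for f g
  proof -
    obtain p q where "f = gr_map p" "g = gr_map q" "p \<in> even_poly_ring" "q \<in> even_poly_ring"
      using fg img by blast
    then show ?thesis by (simp add: gr_map_add left even_poly_ring_closed)
  qed
  moreover have "\<phi> (gr_S_scale c f) = pm_scale c (\<phi> f)" if f: "f \<in> gr_S" for c f
  proof -
    obtain p where "f = gr_map p" "p \<in> even_poly_ring" using f img by blast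
    then show ?thesis by (simp add: gr_map_scale left even_poly_ring_closed)
  qed
  moreover have "\<phi> ` gr_S_part d = even_poly_part d" for d
  proof -
    have "\<phi> (gr_map p) = p" if "p \<in> even_poly_part d" for p
      using that left by (simp add: even_poly_part_def)
    then show ?thesis unfolding gr_map_part[symmetric] image_image by simp
  qed
  ultimately show ?thesis using bij by blast
qed

end
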